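(* The trivial line bundle $U=\mathcal M\times\mathbb C$ extends to $\widetilde{\mathcal M}$ as $\mathcal O_{\widetilde{\mathcal M}}(D)$, i.e. the extension $L$ defined by the vertical coordinates listed in the context is isomorphic to $\mathcal O_{\widetilde{\mathcal M}}(D)$, where $D\in\mathrm{Div}(\widetilde{\mathcal M})$ is the divisor $D=\mathrm{div}(\hat p)$ of the meromorphic section of $L$ extending the section $\hat p=1$ of $U$, and $$D\equiv A_0+2Q^1+2B^1_0-B^0_\infty-B^\infty_\infty$$ (linear equivalence). Moreover, the line bundle $\mathcal O_{\widetilde{\mathcal M}}(D)$ is trivial when restricted to each of the curves $Q^0,Q^1,Q^\infty$ and to the $(-2)$-curve $A_\infty$.
   Context: Everything is over $\mathbb C$. Let $\mathcal M=\{(t,q): t\in\mathbb C^*,\ q\in\mathbb P^1\setminus\{0,1,\infty\}\}$, and let $\widetilde{\mathcal M}$ be the blow-up of $\mathbb P^1\times\mathbb P^1$ (coordinates $(t,q)$) at the three points $(0,1),(\infty,0),(\infty,\infty)$. Denote by $A_j$ ($j=0,\infty$) the strict transform of $\{t=j\}$, by $Q^i$ ($i=0,1,\infty$) the strict transform of $\{q=i\}$, and by $B^i_j$ the exceptional curve over the point $(t,q)=(j,i)$; thus the exceptional curves are $B^1_0,B^0_\infty,B^\infty_\infty$, and the complement of $\mathcal M$ in $\widetilde{\mathcal M}$ is the union of the eight curves $Q^0,Q^1,Q^\infty,A_0,A_\infty,B^1_0,B^0_\infty,B^\infty_\infty$. The curve $A_\infty$ has self-intersection $-2$. Let $\hat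 p$ denote the fibre coordinate on the trivial line bundle $U=\mathcal M\times\mathbb C$. The extension $L$ of $U$ to $\widetilde{\mathcal M}$ is the line bundle on the smooth surface $\widetilde{\mathcal M}$ with $L|_{\mathcal M}=U$ such that near a generic point of each boundary curve the following function (the "vertical coordinate") is a linear fibre coordinate of $L$, i.e. gives a local holomorphic trivialization: - on $A_0$: $\hat p$; - on $Q^0$, $Q^\infty$, $B^0_\infty$ and $B^\infty_\infty$: $-\hat p/(q-1)^2$; - on $Q^1$ and $A_\infty$: $-\hat p/(qt)$; - on $B^1_0$: $-\hat p/(q-1)$. For a section $s$ of $L$ over $\mathcal M$ that extends meromorphically, $\mathrm{div}(s)$ is its divisor of zeros minus poles. *)

theory Defs
  imports "HOL-Analysis.Analysis" "HOL-Library.Poly_Mapping"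
begin

section \<open>Spaces with a sheaf of holomorphic functions\<close>

text \<open>
  A complex space is a topological space together with, for every open set, the
  functions that are holomorphic on it. Only the values on the open set matter.
\<close>

record 'a cspace =
  ctop :: "'a topology"
  hol :: "'a set \<Rightarrow> ('a \<Rightarrow> complex) \<Rightarrow> bool"

text \<open>Holomorphic functions of two variables: the total derivative exists and is complex linear.\<close>

definition holomorphic2_on :: "(complex \<times> complex \<Rightarrow> complex) \<Rightarrow> (complex \<times> complex) set \<Rightarrow> bool" where
  "holomorphic2_on f D \<longleftrightarrow>
     (\<forall>z\<in>D. \<exists>a b. (f has_derivative (\<lambda>h. a * fst h + b * snd h)) (at z))"

text \<open>
  An atlas is a set of pairs \<open>(D, \<psi>)\<close>, where \<open>\<psi>\<close> parametrizes a coordinate patch by the open set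
  \<open>D\<close> (so \<open>\<psi>\<close> is the inverse of a coordinate map).
\<close>

type_synonym 'a atlas2 = "((complex \<times> complex) set \<times> (complex \<times> complex \<Rightarrow> 'a)) set"

definition atlas_open :: "'a atlas2 \<Rightarrow> 'a set \<Rightarrow> bool" where
  "atlas_open A W \<longleftrightarrow>
     W \<subseteq> (\<Union>(D, \<psi>)\<in>A. \<psi> ` D) \<and> (\<forall>(D, \<psi>)\<in>A. open {z \<in> D. \<psi> z \<in> W})"

lemma istopology_atlas_open: "istopology (atlas_open A)"
  unfolding istopology_def
proof (intro conjI allI impI)
  fix S T assume S: "atlas_open A S" and T: "atlas_open A T"
  have "open {z \<in> D. \<psi> z \<in> S \<inter> T}" if "(D, \<psi>) \<in> A" for D \<psi>
  proof -
    have "{z \<in> D. \<psi> z \<in> S \<inter> T} = {z \<in> D. \<psi> z \<in> S} \<inter> {z \<in> D. \<psi> z \<in> T}" by auto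
    then show ?thesis using S T that unfolding atlas_open_def by auto
  qed
  then show "atlas_open A (S \<inter> T)" using S unfolding atlas_open_def by auto
next
  fix \<K> assume K: "\<forall>K\<in>\<K>. atlas_open A K"
  have "open {z \<in> D. \<psi> z \<in> \<Union>\<K>}" if "(D, \<psi>) \<in> A" for D \<psi>
  proof -
    have "{z \<in> D. \<psi> z \<in> \<Union>\<K>} = (\<Union>K\<in>\<K>. {z \<in> D. \<psi> z \<in> K})" by auto
    moreover have "open {z \<in> D. \<psi> z \<in> K}" if "K \<in> \<K>" for K
      using K that \<open>(D, \<psi>) \<in> A\<close> unfolding atlas_open_def by auto
    ultimately show ?thesis by auto
  qed
  moreover have "\<Union>\<K> \<subseteq> (\<Union>(D, \<psi>)\<in>A. \<psi> ` D)" using K unfolding atlas_open_def by blast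
  ultimately show "atlas_open A (\<Union>\<K>)" unfolding atlas_open_def by auto
qed

definition surface_of_atlas :: "'a atlas2 \<Rightarrow> 'a cspace" where
  "surface_of_atlas A =
     \<lparr> ctop = topology (atlas_open A),
       hol = (\<lambda>W f. atlas_open A W \<and>
                (\<forall>(D, \<psi>)\<in>A. holomorphic2_on (f \<circ> \<psi>) {z \<in> D. \<psi> z \<in> W})) \<rparr>"

text \<open>
  Restriction to a subset \<open>C\<close>: a function is holomorphic if locally it is the restriction of
  a holomorphic function of the ambient space. This is the induced structure both for open
  subsets and for (reduced) closed analytic subsets.
\<close>

definition crestrict :: "'a cspace \<Rightarrow> 'a set \<Rightarrow> 'a cspace" where
  "crestrict X C =
     \<lparr> ctop = subtopology (ctop X) C,
       hol = (\<lambda>V f. openin (subtopology (ctop X) C) V \<and>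
                (\<forall>x\<in>V. \<exists>W F. x \<in> W \<and> hol X W F \<and> W \<inter> C \<subseteq> V \<and> (\<forall>y\<in>W \<inter> C. F y = f y))) \<rparr>"

definition hol_unit :: "'a cspace \<Rightarrow> 'a set \<Rightarrow> ('a \<Rightarrow> complex) \<Rightarrow> bool" where
  "hol_unit X W u \<longleftrightarrow> hol X W u \<and> (\<forall>x\<in>W. u x \<noteq> 0)"


section \<open>Holomorphic line bundles\<close>

text \<open>
  A line bundle is given by its total space, its projection and local linear fibre coordinates
  \<open>(U, \<phi>)\<close>: on every fibre over \<open>U\<close> the function \<open>\<phi>\<close> is a bijection to the complex numbers, and two
  of them differ by a nowhere vanishing holomorphic function on the base. The vector space
  structure of the fibres is the one transported by the coordinates.
\<close>

record ('a, 'e) line_bundle =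
  total_space :: "'e set"
  proj :: "'e \<Rightarrow> 'a"
  coords :: "('a set \<times> ('e \<Rightarrow> complex)) set"

definition is_line_bundle :: "'a cspace \<Rightarrow> ('a, 'e) line_bundle \<Rightarrow> bool" where
  "is_line_bundle X L \<longleftrightarrow>
     proj L ` total_space L \<subseteq> topspace (ctop X) \<and>
     topspace (ctop X) \<subseteq> \<Union>(fst ` coords L) \<and>
     (\<forall>(U, \<phi>)\<in>coords L. openin (ctop X) U \<and>
        (\<forall>x\<in>U. bij_betw \<phi> {e \<in> total_space L. proj L e = x} UNIV)) \<and>
     (\<forall>(U, \<phi>)\<in>coords L. \<forall>(V, \<eta>)\<in>coords L.
        \<exists>g. hol_unit X (U \<inter> V) g \<and>
            (\<forall>e\<in>total_space L. proj L e \<in> U \<inter> V \<longrightarrow> \<eta> e = g (proj L e) * \<phi> e))"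

text \<open>
  The linear fibre coordinates of \<open>L\<close> over an open set \<open>W\<close>, that is, the holomorphic local
  trivializations over \<open>W\<close>.
\<close>

definition fibre_coord ::
  "'a cspace \<Rightarrow> ('a, 'e) line_bundle \<Rightarrow> 'a set \<Rightarrow> ('e \<Rightarrow> complex) \<Rightarrow> bool" where
  "fibre_coord X L W \<phi> \<longleftrightarrow>
     openin (ctop X) W \<and>
     (\<forall>(V, \<eta>)\<in>coords L.
        \<exists>g. hol_unit X (W \<inter> V) g \<and>
            (\<forall>e\<in>total_space L. proj L e \<in> W \<inter> V \<longrightarrow> \<phi> e = g (proj L e) * \<eta> e))"

definition bundle_iso ::
  "'a cspace \<Rightarrow> ('a, 'e) line_bundle \<Rightarrow> ('a, 'f) line_bundle \<Rightarrow> ('e \<Rightarrow> 'f) \<Rightarrow> bool" where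
  "bundle_iso X L L' F \<longleftrightarrow>
     is_line_bundle X L \<and> is_line_bundle X L' \<and>
     bij_betw F (total_space L) (total_space L') \<and>
     (\<forall>e\<in>total_space L. proj L' (F e) = proj L e) \<and>
     (\<forall>(V, \<eta>)\<in>coords L'. fibre_coord X L V (\<eta> \<circ> F))"

definition isomorphic_bundles ::
  "'a cspace \<Rightarrow> ('a, 'e) line_bundle \<Rightarrow> ('a, 'f) line_bundle \<Rightarrow> bool" where
  "isomorphic_bundles X L L' \<longleftrightarrow> (\<exists>F. bundle_iso X L L' F)"

definition trivial_bundle :: "'a cspace \<Rightarrow> ('a, 'a \<times> complex) line_bundle" where
  "trivial_bundle X =
     \<lparr> total_space = topspace (ctop X) \<times> UNIV, proj = fst, coords = {(topspace (ctop X), snd)} \<rparr>"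

definition bundle_restrict :: "('a, 'e) line_bundle \<Rightarrow> 'a set \<Rightarrow> ('a, 'e) line_bundle" where
  "bundle_restrict L C =
     \<lparr> total_space = {e \<in> total_space L. proj L e \<in> C}, proj = proj L,
       coords = (\<lambda>(U, \<phi>). (U \<inter> C, \<phi>)) ` coords L \<rparr>"

definition trivial_on :: "'a cspace \<Rightarrow> ('a, 'e) line_bundle \<Rightarrow> 'a set \<Rightarrow> bool" where
  "trivial_on X L C \<longleftrightarrow>
     isomorphic_bundles (crestrict X C) (bundle_restrict L C) (trivial_bundle (crestrict X C))"


section \<open>Divisors\<close>

definition analytic_subset :: "'a cspace \<Rightarrow> 'a set \<Rightarrow> bool" where
  "analytic_subset X Z \<longleftrightarrow>
     Z \<subseteq> topspace (ctop X) \<and>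
     (\<forall>x\<in>topspace (ctop X). \<exists>W F. x \<in> W \<and> openin (ctop X) W \<and> finite F \<and>
        (\<forall>f\<in>F. hol X W f) \<and> Z \<inter> W = {y \<in> W. \<forall>f\<in>F. f y = 0})"

definition irreducible_subset :: "'a cspace \<Rightarrow> 'a set \<Rightarrow> bool" where
  "irreducible_subset X Z \<longleftrightarrow>
     analytic_subset X Z \<and> Z \<noteq> {} \<and>
     (\<forall>Z1 Z2. analytic_subset X Z1 \<longrightarrow> analytic_subset X Z2 \<longrightarrow> Z = Z1 \<union> Z2 \<longrightarrow> Z = Z1 \<or> Z = Z2)"

text \<open>Irreducible hypersurfaces; on a surface these are the irreducible curves.\<close>

definition prime_divisor :: "'a cspace \<Rightarrow> 'a set \<Rightarrow> bool" where
  "prime_divisor X C \<longleftrightarrow>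
     irreducible_subset X C \<and> (ctop X) interior_of C = {} \<and>
     (\<forall>x\<in>topspace (ctop X). \<exists>W f. x \<in> W \<and> hol X W f \<and> C \<inter> W = {y \<in> W. f y = 0})"

definition divisors :: "'a cspace \<Rightarrow> ('a set \<Rightarrow>\<^sub>0 int) set" where
  "divisors X = {D. Poly_Mapping.keys D \<subseteq> Collect (prime_divisor X)}"

definition supp :: "('a set \<Rightarrow>\<^sub>0 int) \<Rightarrow> 'a set" where
  "supp D = \<Union>(Poly_Mapping.keys D)"

text \<open>\<open>f\<close> generates the ideal sheaf of \<open>C\<close> on \<open>W\<close>.\<close>

definition local_equation :: "'a cspace \<Rightarrow> 'a set \<Rightarrow> 'a set \<Rightarrow> ('a \<Rightarrow> complex) \<Rightarrow> bool" where
  "local_equation X C W f \<longleftrightarrow>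
     hol X W f \<and>
     (\<forall>V g. V \<subseteq> W \<longrightarrow> hol X V g \<longrightarrow>
        ((\<forall>y\<in>V \<inter> C. g y = 0) \<longleftrightarrow> (\<exists>h. hol X V h \<and> (\<forall>y\<in>V. g y = f y * h y))))"

definition hol_section ::
  "'a cspace \<Rightarrow> ('a, 'e) line_bundle \<Rightarrow> 'a set \<Rightarrow> ('a \<Rightarrow> 'e) \<Rightarrow> bool" where
  "hol_section X L N s \<longleftrightarrow>
     openin (ctop X) N \<and>
     (\<forall>y\<in>N. s y \<in> total_space L \<and> proj L (s y) = y) \<and>
     (\<forall>(V, \<eta>)\<in>coords L. hol X (N \<inter> V) (\<eta> \<circ> s))"

text \<open>
  In the next three definitions \<open>s\<close> is a holomorphic section over a dense open subset \<open>N\<close> of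
  the open set \<open>W\<close>. First: \<open>s\<close> extends meromorphically near \<open>x\<close>, as a quotient \<open>a / b\<close>.
\<close>

definition meromorphic_at ::
  "'a cspace \<Rightarrow> ('a, 'e) line_bundle \<Rightarrow> 'a set \<Rightarrow> ('a \<Rightarrow> 'e) \<Rightarrow> 'a \<Rightarrow> bool" where
  "meromorphic_at X L N s x \<longleftrightarrow>
     (\<exists>V \<phi> a b. x \<in> V \<and> fibre_coord X L V \<phi> \<and> hol X V a \<and> hol X V b \<and>
        (ctop X) interior_of {y \<in> V. b y = 0} = {} \<and>
        (\<forall>y\<in>V \<inter> N. b y * \<phi> (s y) = a y))"

text \<open>Near \<open>x\<close> the section \<open>s\<close> is a unit, i.e. extends to a local frame of \<open>L\<close>.\<close>

definition frame_at ::
  "'a cspace \<Rightarrow> ('a, 'e) line_bundle \<Rightarrow> 'a set \<Rightarrow> ('a \<Rightarrow> 'e) \<Rightarrow> 'a \<Rightarrow> bool" where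
  "frame_at X L N s x \<longleftrightarrow>
     (\<exists>V \<phi> u. x \<in> V \<and> fibre_coord X L V \<phi> \<and> hol_unit X V u \<and> (\<forall>y\<in>V \<inter> N. \<phi> (s y) = u y))"

text \<open>Near \<open>x\<close> the section \<open>s\<close> has exactly the order \<open>k\<close> along \<open>C\<close> and no other zeros or poles.\<close>

definition order_at ::
  "'a cspace \<Rightarrow> ('a, 'e) line_bundle \<Rightarrow> 'a set \<Rightarrow> ('a \<Rightarrow> 'e) \<Rightarrow> 'a set \<Rightarrow> int \<Rightarrow> 'a \<Rightarrow> bool" where
  "order_at X L N s C k x \<longleftrightarrow>
     (\<exists>V \<phi> f u. x \<in> V \<and> fibre_coord X L V \<phi> \<and> local_equation X C V f \<and> hol_unit X V u \<and>
        (\<forall>y\<in>V \<inter> N. \<phi> (s y) = u y * f y powi k))"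

text \<open>
  \<open>s\<close> is meromorphic on \<open>W\<close>, and its divisor of zeros minus poles on \<open>W\<close> is the restriction of
  \<open>D\<close>: the order of \<open>s\<close> at the generic point of a component \<open>C\<close> of \<open>D\<close> is the multiplicity of
  \<open>C\<close>, and \<open>s\<close> has neither zeros nor poles off the support of \<open>D\<close>. The space is thought of
  as compact, so "generic" means "all but finitely many".
\<close>

definition has_divisor_on ::
  "'a cspace \<Rightarrow> ('a, 'e) line_bundle \<Rightarrow> 'a set \<Rightarrow> 'a set \<Rightarrow> ('a \<Rightarrow> 'e) \<Rightarrow> ('a set \<Rightarrow>\<^sub>0 int) \<Rightarrow> bool" where
  "has_divisor_on X L W N s D \<longleftrightarrow>
     D \<in> divisors X \<and>
     openin (ctop X) W \<and> N \<subseteq> W \<and> W \<subseteq> (ctop X) closure_of N \<and>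
     hol_section X L N s \<and>
     (\<forall>x\<in>W. meromorphic_at X L N s x) \<and>
     (\<forall>x\<in>W - supp D. frame_at X L N s x) \<and>
     (\<forall>C\<in>Poly_Mapping.keys D.
        finite {x \<in> C \<inter> W. \<not> order_at X L N s C (Poly_Mapping.lookup D C) x})"

text \<open>\<open>div(s) = D\<close> for the meromorphic section extending the section \<open>s\<close> over \<open>N\<close>.\<close>

definition has_divisor ::
  "'a cspace \<Rightarrow> ('a, 'e) line_bundle \<Rightarrow> 'a set \<Rightarrow> ('a \<Rightarrow> 'e) \<Rightarrow> ('a set \<Rightarrow>\<^sub>0 int) \<Rightarrow> bool" where
  "has_divisor X L N s D \<longleftrightarrow> has_divisor_on X L (topspace (ctop X)) N s D"

text \<open>Meromorphic functions are the meromorphic sections of the trivial bundle.\<close>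

definition fun_has_divisor_on ::
  "'a cspace \<Rightarrow> 'a set \<Rightarrow> 'a set \<Rightarrow> ('a \<Rightarrow> complex) \<Rightarrow> ('a set \<Rightarrow>\<^sub>0 int) \<Rightarrow> bool" where
  "fun_has_divisor_on X W N f D \<longleftrightarrow> has_divisor_on X (trivial_bundle X) W N (\<lambda>x. (x, f x)) D"

definition linearly_equivalent ::
  "'a cspace \<Rightarrow> ('a set \<Rightarrow>\<^sub>0 int) \<Rightarrow> ('a set \<Rightarrow>\<^sub>0 int) \<Rightarrow> bool" where
  "linearly_equivalent X D E \<longleftrightarrow>
     (\<exists>N h. fun_has_divisor_on X (topspace (ctop X)) N h (D - E))"

text \<open>
  The line bundle \<open>\<O>(D)\<close>: a pair \<open>(W, f)\<close> with \<open>f\<close> a meromorphic function on \<open>W\<close> and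
  \<open>div f = D\<close> on \<open>W\<close> gives the trivialization \<open>h \<mapsto> h f\<close> of the sheaf of meromorphic functions
  \<open>h\<close> with \<open>div h + D \<ge> 0\<close>, so the transition functions are the quotients \<open>f' / f\<close>. An element
  of the fibre at \<open>x\<close> is the family \<open>\<xi>\<close> of its coordinates with respect to all such pairs
  around \<open>x\<close>; the value is \<open>0\<close> at the irrelevant indices.
\<close>

definition local_equations ::
  "'a cspace \<Rightarrow> ('a set \<Rightarrow>\<^sub>0 int) \<Rightarrow> ('a set \<times> ('a \<Rightarrow> complex)) set" where
  "local_equations X D = {(W, f). fun_has_divisor_on X W (W - supp D) f D}"

definition divisor_bundle ::
  "'a cspace \<Rightarrow> ('a set \<Rightarrow>\<^sub>0 int) \<Rightarrow> ('a, 'a \<times> ('a set \<times> ('a \<Rightarrow> complex) \<Rightarrow> complex)) line_bundle" where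
  "divisor_bundle X D =
     \<lparr> total_space = {(x, \<xi>). x \<in> topspace (ctop X) \<and>
          (\<forall>W f. \<not> ((W, f) \<in> local_equations X D \<and> x \<in> W) \<longrightarrow> \<xi> (W, f) = 0) \<and>
          (\<forall>(W, f)\<in>local_equations X D. \<forall>(W', f')\<in>local_equations X D. x \<in> W \<inter> W' \<longrightarrow>
             (\<exists>g. hol_unit X (W \<inter> W') g \<and> (\<forall>y\<in>W \<inter> W' - supp D. f' y = g y * f y) \<and>
                  \<xi> (W', f') = g x * \<xi> (W, f)))},
       proj = fst,
       coords = (\<lambda>(W, f). (W, \<lambda>(x, \<xi>). \<xi> (W, f))) ` local_equations X D \<rparr>"


section \<open>Blowing up points of a surface\<close>

datatype proj_line = Aff complex | Infty

definition aff_inv :: "complex \<Rightarrow> proj_line" where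
  "aff_inv w = (if w = 0 then Infty else Aff (1 / w))"

definition p1p1_atlas :: "(proj_line \<times> proj_line) atlas2" where
  "p1p1_atlas = {(UNIV, \<lambda>(x, y). (\<alpha> x, \<beta> y)) | \<alpha> \<beta>. \<alpha> \<in> {Aff, aff_inv} \<and> \<beta> \<in> {Aff, aff_inv}}"

text \<open>
  Blowing up replaces a point \<open>c\<close> by the projective line of its tangent directions \<open>Exc c d\<close>.
  The data are a set \<open>K\<close> of parametrizations \<open>\<kappa>\<close> of coordinate patches, defined on the whole
  plane, each centred at its own centre \<open>\<kappa> (0, 0)\<close> and containing no other centre. The direction
  \<open>d\<close> is the slope \<open>y / x\<close> in these coordinates.
\<close>

datatype 'a blowup = Pt 'a | Exc 'a proj_line

definition centre :: "(complex \<times> complex \<Rightarrow> 'a) \<Rightarrow> 'a" where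
  "centre \<kappa> = \<kappa> (0, 0)"

definition blowup_chart1 :: "(complex \<times> complex \<Rightarrow> 'a) \<Rightarrow> complex \<times> complex \<Rightarrow> 'a blowup" where
  "blowup_chart1 \<kappa> = (\<lambda>(x, v). if x = 0 then Exc (centre \<kappa>) (Aff v) else Pt (\<kappa> (x, x * v)))"

definition blowup_chart2 :: "(complex \<times> complex \<Rightarrow> 'a) \<Rightarrow> complex \<times> complex \<Rightarrow> 'a blowup" where
  "blowup_chart2 \<kappa> = (\<lambda>(u, y). if y = 0 then Exc (centre \<kappa>) (aff_inv u) else Pt (\<kappa> (u * y, y)))"

definition blowup_atlas ::
  "'a atlas2 \<Rightarrow> (complex \<times> complex \<Rightarrow> 'a) set \<Rightarrow> 'a blowup atlas2" where
  "blowup_atlas A K =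
     (\<lambda>(D, \<psi>). ({z \<in> D. \<psi> z \<notin> centre ` K}, Pt \<circ> \<psi>)) ` A \<union>
     (\<lambda>\<kappa>. (UNIV, blowup_chart1 \<kappa>)) ` K \<union>
     (\<lambda>\<kappa>. (UNIV, blowup_chart2 \<kappa>)) ` K"


section \<open>The surface and the extension of the trivial bundle\<close>

type_synonym point = "(proj_line \<times> proj_line) blowup"

text \<open>Coordinates \<open>(t, q - 1)\<close> at \<open>(0, 1)\<close>, \<open>(1/t, q)\<close> at \<open>(\<infinity>, 0)\<close>, \<open>(1/t, 1/q)\<close> at \<open>(\<infinity>, \<infinity>)\<close>.\<close>

definition centre_charts :: "(complex \<times> complex \<Rightarrow> proj_line \<times> proj_line) set" where
  "centre_charts =
     {\<lambda>(x, y). (Aff x, Aff (1 + y)), \<lambda>(x, y). (aff_inv x, Aff y), \<lambda>(x, y). (aff_inv x, aff_inv y)}"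

definition Mtilde :: "point cspace" where
  "Mtilde = surface_of_atlas (blowup_atlas p1p1_atlas centre_charts)"

definition Mopen :: "point set" where
  "Mopen = {Pt (Aff t, Aff q) | t q. t \<noteq> 0 \<and> q \<noteq> 0 \<and> q \<noteq> 1}"

definition strict_transform :: "(proj_line \<times> proj_line) set \<Rightarrow> point set" where
  "strict_transform \<Gamma> = (ctop Mtilde) closure_of (Pt ` (\<Gamma> - centre ` centre_charts))"

definition curveA :: "proj_line \<Rightarrow> point set" where
  "curveA j = strict_transform {(t, q). t = j}"

definition curveQ :: "proj_line \<Rightarrow> point set" where
  "curveQ i = strict_transform {(t, q). q = i}"

text \<open>\<open>curveB i j\<close> is the exceptional curve over \<open>(t, q) = (j, i)\<close>, for a centre \<open>(j, i)\<close>.\<close>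

definition curveB :: "proj_line \<Rightarrow> proj_line \<Rightarrow> point set" where
  "curveB i j = range (Exc (j, i))"

text \<open>
  The vertical coordinate along a boundary curve \<open>C\<close> is the product of the fibre coordinate on
  \<open>M \<times> \<complex>\<close> with the listed function of \<open>t\<close> and \<open>q\<close>.
\<close>

definition vertical_factors :: "(point set \<times> (complex \<Rightarrow> complex \<Rightarrow> complex)) set" where
  "vertical_factors =
     {(curveA (Aff 0), \<lambda>t q. 1),
      (curveQ (Aff 0), \<lambda>t q. - 1 / (q - 1)\<^sup>2),
      (curveQ Infty, \<lambda>t q. - 1 / (q - 1)\<^sup>2),
      (curveB (Aff 0) Infty, \<lambda>t q. - 1 / (q - 1)\<^sup>2),
      (curveB Infty Infty, \<lambda>t q. - 1 / (q - 1)\<^sup>2),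
      (curveQ (Aff 1), \<lambda>t q. - 1 / (q * t)),
      (curveA Infty, \<lambda>t q. - 1 / (q * t)),
      (curveB (Aff 1) (Aff 0), \<lambda>t q. - 1 / (q - 1))}"

text \<open>The trivial line bundle \<open>U\<close> on the open part.\<close>

definition trivialU :: "(point, point \<times> complex) line_bundle" where
  "trivialU = trivial_bundle (crestrict Mtilde Mopen)"

text \<open>
  \<open>L\<close> extends \<open>U\<close>, with identification \<open>\<iota>\<close> of the restriction of \<open>L\<close> with \<open>U\<close>, and the vertical
  coordinates are linear fibre coordinates of \<open>L\<close> near the generic (all but finitely many) points of
  the boundary curves. Here \<open>snd \<circ> \<iota>\<close> is the fibre coordinate of \<open>U\<close>, viewed on \<open>L\<close>.
\<close>

definition is_extension ::
  "(point, 'e) line_bundle \<Rightarrow> ('e \<Rightarrow> point \<times> complex) \<Rightarrow> bool" where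
  "is_extension L \<iota> \<longleftrightarrow>
     is_line_bundle Mtilde L \<and>
     bundle_iso (crestrict Mtilde Mopen) (bundle_restrict L Mopen) trivialU \<iota> \<and>
     (\<forall>(C, c)\<in>vertical_factors.
        finite {x \<in> C. \<not> (\<exists>W \<phi>. x \<in> W \<and> fibre_coord Mtilde L W \<phi> \<and>
          (\<forall>e\<in>total_space L. \<forall>t q. proj L e = Pt (Aff t, Aff q) \<longrightarrow> proj L e \<in> W \<inter> Mopen \<longrightarrow>
             \<phi> e = c t q * snd (\<iota> e)))})"

text \<open>The section of \<open>L\<close> over the open part that corresponds to the constant section 1 of \<open>U\<close>.\<close>

definition unit_section ::
  "(point, 'e) line_bundle \<Rightarrow> ('e \<Rightarrow> point \<times> complex) \<Rightarrow> point \<Rightarrow> 'e" where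
  "unit_section L \<iota> x = inv_into (total_space (bundle_restrict L Mopen)) \<iota> (x, 1)"

end

theory Submission
  imports Defs "HOL-Complex_Analysis.Complex_Analysis"
begin

text \<open>
  Idea. On the open part the functions \<open>t\<close>, \<open>q\<close> and \<open>q - 1\<close> have neither zeros nor poles, so every
  Laurent monomial in them has a divisor supported on the eight boundary curves, which can be read off
  in charts. The vertical coordinates are, up to sign, the four monomials \<open>1\<close>, \<open>(q - 1)\<^sup>-\<^sup>2\<close>,
  \<open>(q t)\<^sup>-\<^sup>1\<close> and \<open>(q - 1)\<^sup>-\<^sup>1\<close> times the fibre coordinate of \<open>U\<close>. The section \<open>1\<close> of \<open>U\<close> therefore
  has along each boundary curve the order of the monomial that belongs to this curve, which gives
  \<open>D = 2 Q\<^sup>\<infinity> + 2 B\<^sup>\<infinity>\<^sub>\<infinity> + A\<^sub>\<infinity> - B\<^sup>1\<^sub>0\<close>. The monomial \<open>1 / ((q - 1)\<^sup>2 t)\<close> has the divisor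
  \<open>D - (A\<^sub>0 + 2 Q\<^sup>1 + 2 B\<^sup>1\<^sub>0 - B\<^sup>0\<^sub>\<infinity> - B\<^sup>\<infinity>\<^sub>\<infinity>)\<close>, whence the linear equivalence
  (\<open>divD_equivalent\<close>).

  Each of the four monomials is a local equation of \<open>D\<close> away from the curves along which its order
  differs from that of \<open>D\<close>. These four domains (\<open>frame_dom\<close>) cover the surface, because the relevant
  curves became disjoint by blowing up. Moreover each of \<open>Q\<^sup>0\<close>, \<open>Q\<^sup>1\<close>, \<open>Q\<^sup>\<infinity>\<close>, \<open>A\<^sub>\<infinity>\<close> lies entirely in one
  of them (\<open>bdry_sub_frame_dom\<close>), and a local equation of \<open>D\<close> that is defined near a whole curve
  trivializes \<open>\<O>(D)\<close> on this curve (\<open>OD_trivial_on\<close>).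

  An extension \<open>L\<close> is prescribed only near generic points of the boundary curves. At these points
  the section divided by the matching monomial is a frame; so its coordinate with respect to
  any fibre coordinate of \<open>L\<close> is that monomial times a unit, except possibly at finitely many
  points. Hartogs' theorem removes these points (\<open>unit_ext_off_finite\<close>), and
  \<open>adapted_unit_section\<close> records the outcome. The same argument shows that two
  functions with the same divisor differ by a unit (\<open>fun_divisor_ratio\<close>), although the order
  of a function along a curve is known only at all but finitely many points. From these two
  facts follow \<open>div s = D\<close> (\<open>adapted_has_divisor\<close>) and \<open>L \<cong> \<O>(D)\<close> (\<open>adapted_iso\<close>). An extension exists,
  since a copy of \<open>\<O>(D)\<close> is one (\<open>extension_exists\<close>).

  Two analytic facts are needed in two variables: Hartogs' theorem for a point
  (\<open>hartogs_removable_point\<close>) and the divisibility of a function that vanishes on a coordinate line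
  (\<open>divide_by_coordinate\<close>). Both come from the double Cauchy integral over a torus.
\<close>

section \<open>Holomorphic functions of two variables\<close>

lemma holomorphic2_onD:
  assumes "holomorphic2_on f D" "z \<in> D"
  obtains a b where "(f has_derivative (\<lambda>h. a * fst h + b * snd h)) (at z)"
  using assms unfolding holomorphic2_on_def by blast

lemma holomorphic2_on_const: "holomorphic2_on (\<lambda>z. c) D"
  unfolding holomorphic2_on_def
  by (intro ballI exI[of _ 0]) simp

lemma holomorphic2_on_fst: "holomorphic2_on fst D"
  unfolding holomorphic2_on_def
  by (intro ballI exI[of _ 1] exI[of _ 0]) (auto intro!: derivative_eq_intros)

lemma holomorphic2_on_snd: "holomorphic2_on snd D"
  unfolding holomorphic2_on_def
  by (intro ballI exI[of _ 0] exI[of _ 1]) (auto intro!: derivative_eq_intros)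

lemma holomorphic2_on_add:
  assumes "holomorphic2_on f D" "holomorphic2_on g D"
  shows "holomorphic2_on (\<lambda>z. f z + g z) D"
  unfolding holomorphic2_on_def
proof
  fix z assume "z \<in> D"
  obtain a b where f: "(f has_derivative (\<lambda>h. a * fst h + b * snd h)) (at z)"
    using holomorphic2_onD[OF assms(1) \<open>z \<in> D\<close>] .
  obtain a' b' where g: "(g has_derivative (\<lambda>h. a' * fst h + b' * snd h)) (at z)"
    using holomorphic2_onD[OF assms(2) \<open>z \<in> D\<close>] .
  from has_derivative_add[OF f g]
  show "\<exists>a b. ((\<lambda>z. f z + g z) has_derivative (\<lambda>h. a * fst h + b * snd h)) (at z)"
    by (intro exI[of _ "a + a'"] exI[of _ "b + b'"]) (simp add: algebra_simps)
qed

lemma holomorphic2_on_mult: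
  assumes "holomorphic2_on f D" "holomorphic2_on g D"
  shows "holomorphic2_on (\<lambda>z. f z * g z) D"
  unfolding holomorphic2_on_def
proof
  fix z assume "z \<in> D"
  obtain a b where f: "(f has_derivative (\<lambda>h. a * fst h + b * snd h)) (at z)"
    using holomorphic2_onD[OF assms(1) \<open>z \<in> D\<close>] .
  obtain a' b' where g: "(g has_derivative (\<lambda>h. a' * fst h + b' * snd h)) (at z)"
    using holomorphic2_onD[OF assms(2) \<open>z \<in> D\<close>] .
  from has_derivative_mult[OF f g]
  show "\<exists>a b. ((\<lambda>z. f z * g z) has_derivative (\<lambda>h. a * fst h + b * snd h)) (at z)"
    by (intro exI[of _ "f z * a' + a * g z"] exI[of _ "f z * b' + b * g z"]) (simp add: algebra_simps)
qed

lemma holomorphic2_on_inverse: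
  assumes "holomorphic2_on f D" "\<And>z. z \<in> D \<Longrightarrow> f z \<noteq> 0"
  shows "holomorphic2_on (\<lambda>z. inverse (f z)) D"
  unfolding holomorphic2_on_def
proof
  fix z assume z: "z \<in> D"
  from holomorphic2_onD[OF assms(1) this]
  obtain a b where f: "(f has_derivative (\<lambda>h. a * fst h + b * snd h)) (at z)" .
  from Deriv.has_derivative_inverse[OF assms(2)[OF z] f]
  show "\<exists>a b. ((\<lambda>z. inverse (f z)) has_derivative (\<lambda>h. a * fst h + b * snd h)) (at z)"
    by (intro exI[of _ "- (inverse (f z) * a * inverse (f z))"] exI[of _ "- (inverse (f z) * b * inverse (f z))"])
      (simp add: algebra_simps)
qed

lemma holomorphic2_on_compose:
  assumes "holomorphic2_on g1 D" "holomorphic2_on g2 D" "holomorphic2_on f E"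
    "\<And>z. z \<in> D \<Longrightarrow> (g1 z, g2 z) \<in> E"
  shows "holomorphic2_on (\<lambda>z. f (g1 z, g2 z)) D"
  unfolding holomorphic2_on_def
proof
  fix z assume z: "z \<in> D"
  obtain a b where g1: "(g1 has_derivative (\<lambda>h. a * fst h + b * snd h)) (at z)"
    using holomorphic2_onD[OF assms(1) z] .
  obtain a' b' where g2: "(g2 has_derivative (\<lambda>h. a' * fst h + b' * snd h)) (at z)"
    using holomorphic2_onD[OF assms(2) z] .
  note g = has_derivative_Pair[OF g1 g2]
  obtain c d where "(f has_derivative (\<lambda>h. c * fst h + d * snd h)) (at (g1 z, g2 z))"
    using holomorphic2_onD[OF assms(3) assms(4)[OF z]] .
  from diff_chain_at[OF g this]
  show "\<exists>a b. ((\<lambda>z. f (g1 z, g2 z)) has_derivative (\<lambda>h. a * fst h + b * snd h)) (at z)"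
    by (intro exI[of _ "c * a + d * a'"] exI[of _ "c * b + d * b'"]) (simp add: algebra_simps o_def)
qed

lemma holomorphic2_on_subset: "holomorphic2_on f D \<Longrightarrow> E \<subseteq> D \<Longrightarrow> holomorphic2_on f E"
  unfolding holomorphic2_on_def by blast

lemma holomorphic2_on_local:
  assumes "\<And>z. z \<in> D \<Longrightarrow> \<exists>U g. open U \<and> z \<in> U \<and> holomorphic2_on g U \<and> (\<forall>w\<in>U. g w = f w)"
  shows "holomorphic2_on f D"
  unfolding holomorphic2_on_def
proof
  fix z assume "z \<in> D"
  from assms[OF this] obtain U g where U: "open U" "z \<in> U" "holomorphic2_on g U" "\<forall>w\<in>U. g w = f w" by blast
  from holomorphic2_onD[OF U(3,2)]
  obtain a b where "(g has_derivative (\<lambda>h. a * fst h + b * snd h)) (at z)" .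
  then show "\<exists>a b. (f has_derivative (\<lambda>h. a * fst h + b * snd h)) (at z)"
    using has_derivative_transform_within_open[of g _ z UNIV U f] U by auto
qed

lemma holomorphic2_on_cong:
  assumes "open D" "\<And>z. z \<in> D \<Longrightarrow> f z = g z"
  shows "holomorphic2_on f D \<longleftrightarrow> holomorphic2_on g D"
  by (rule iffI; rule holomorphic2_on_local) (use assms in \<open>metis\<close>)+

lemma holomorphic2_on_continuous: "holomorphic2_on f D \<Longrightarrow> continuous_on D f"
  unfolding holomorphic2_on_def
  by (meson continuous_at_imp_continuous_on has_derivative_continuous)

lemma holomorphic2_on_slice_fst:
  assumes "holomorphic2_on f D" "\<And>x. x \<in> S \<Longrightarrow> (x, y) \<in> D"
  shows "(\<lambda>x. f (x, y)) holomorphic_on S"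
  unfolding holomorphic_on_def
proof
  fix x assume "x \<in> S"
  from holomorphic2_onD[OF assms(1) assms(2)[OF this]]
  obtain a b where "(f has_derivative (\<lambda>h. a * fst h + b * snd h)) (at (x, y))" .
  moreover have "((\<lambda>x. (x, y)) has_derivative (\<lambda>h. (h, 0))) (at x within S)"
    by (auto intro!: derivative_eq_intros)
  ultimately have "((\<lambda>x. f (x, y)) has_derivative (\<lambda>h. a * h)) (at x within S)"
    using has_derivative_compose by fastforce
  then show "(\<lambda>x. f (x, y)) field_differentiable at x within S"
    unfolding field_differentiable_def has_field_derivative_def by blast
qed

lemma holomorphic2_on_slice_snd:
  assumes "holomorphic2_on f D" "\<And>y. y \<in> S \<Longrightarrow> (x, y) \<in> D"
  shows "(\<lambda>y. f (x, y)) holomorphic_on S"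
  unfolding holomorphic_on_def
proof
  fix y assume "y \<in> S"
  from holomorphic2_onD[OF assms(1) assms(2)[OF this]]
  obtain a b where "(f has_derivative (\<lambda>h. a * fst h + b * snd h)) (at (x, y))" .
  moreover have "((\<lambda>y. (x, y)) has_derivative (\<lambda>h. (0, h))) (at y within S)"
    by (auto intro!: derivative_eq_intros)
  ultimately have "((\<lambda>y. f (x, y)) has_derivative (\<lambda>h. b * h)) (at y within S)"
    using has_derivative_compose by fastforce
  then show "(\<lambda>y. f (x, y)) field_differentiable at y within S"
    unfolding field_differentiable_def has_field_derivative_def by blast
qed

section \<open>Cauchy integrals over a torus\<close>

definition circle_pt :: "complex \<Rightarrow> real \<Rightarrow> real \<Rightarrow> complex" where
  "circle_pt c r s = c + of_real r * exp (2 * of_real pi * \<i> * of_real s)"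

lemma norm_circle_pt: "r > 0 \<Longrightarrow> norm (circle_pt c r s - c) = r"
  by (simp add: circle_pt_def norm_mult)

lemma circle_pt_sphere: "r > 0 \<Longrightarrow> dist c (circle_pt c r s) = r"
  using norm_circle_pt[of r c s] by (simp add: dist_norm norm_minus_commute)

lemma circle_pt_neq: "r > 0 \<Longrightarrow> x \<in> ball c r \<Longrightarrow> circle_pt c r s \<noteq> x"
  using norm_circle_pt[of r c s] by (auto simp: dist_norm norm_minus_commute)

text \<open>
  Cauchy's formula on a circle parametrized by \<open>[0, 1]\<close>: there \<open>d\<zeta> = 2 \<pi> i (\<zeta> - c) ds\<close>, so that the factors
  \<open>2 \<pi> i\<close> cancel.
\<close>

lemma cauchy_circle_pt:
  assumes "continuous_on (cball c r) f" "f holomorphic_on ball c r" "x \<in> ball c r"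
  shows "integral (cbox 0 1) (\<lambda>s. f (circle_pt c r s) * (circle_pt c r s - c) / (circle_pt c r s - x)) = f x"
proof -
  have "((\<lambda>u. f u/(u-x)) has_contour_integral (2 * of_real pi * \<i> * f x)) (circlepath c r)"
    by (rule Cauchy_integral_circlepath) (use assms in \<open>auto simp: dist_norm norm_minus_commute\<close>)
  then have "((\<lambda>s. f (circlepath c r s) / (circlepath c r s - x) *
      vector_derivative (circlepath c r) (at s within {0..1})) has_integral (2 * of_real pi * \<i> * f x)) {0..1}"
    by (simp add: has_contour_integral_def)
  then have "((\<lambda>s. 2 * of_real pi * \<i> * (f (circle_pt c r s) * (circle_pt c r s - c) / (circle_pt c r s - x)))
      has_integral (2 * of_real pi * \<i> * f x)) {0..1}"
    by (rule has_integral_eq[rotated])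
      (simp add: vector_derivative_circlepath01, simp add: circlepath circle_pt_def)
  moreover have "inverse (2 * of_real pi * \<i>) * (2 * of_real pi * \<i> * y) = y" for y
    using left_inverse[of "2 * of_real pi * \<i>"] by (simp only: mult.assoc[symmetric]) simp
  ultimately have "((\<lambda>s. f (circle_pt c r s) * (circle_pt c r s - c) / (circle_pt c r s - x)) has_integral f x) {0..1}"
    using has_integral_mult_right[of _ "2 * of_real pi * \<i> * f x" "{0..1}" "inverse (2 * of_real pi * \<i>)"] by (metis (no_types, lifting) has_integral_eq)
  then show ?thesis by (simp add: integral_unique)
qed

text \<open>
  The integrand of the double Cauchy integral over the torus \<open>\<bar>\<zeta> - c\<^sub>1\<bar> = \<bar>\<eta> - c\<^sub>2\<bar> = r\<close>, in terms of the two
  angles, which run through \<open>[0, 1]\<close>.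
\<close>

definition torus_kernel :: "complex \<times> complex \<Rightarrow> real \<Rightarrow> (complex \<times> complex \<Rightarrow> complex) \<Rightarrow>
    complex \<times> complex \<Rightarrow> real \<times> real \<Rightarrow> complex" where
  "torus_kernel c r g z st =
     (let \<zeta> = circle_pt (fst c) r (fst st); \<eta> = circle_pt (snd c) r (snd st)
      in g (\<zeta>, \<eta>) * (\<zeta> - fst c) * (\<eta> - snd c) / ((\<zeta> - fst z) * (\<eta> - snd z)))"

definition torus_integral :: "complex \<times> complex \<Rightarrow> real \<Rightarrow> (complex \<times> complex \<Rightarrow> complex) \<Rightarrow>
    complex \<times> complex \<Rightarrow> complex" where
  "torus_integral c r g z = integral (cbox (0, 0) (1, 1)) (torus_kernel c r g z)"

lemma continuous_on_circle_pt [continuous_intros]: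
  "continuous_on S f \<Longrightarrow> continuous_on S (\<lambda>x. circle_pt c r (f x))"
  unfolding circle_pt_def by (intro continuous_intros)

lemma torus_kernel_continuous:
  assumes r: "r > 0" and g: "continuous_on (sphere (fst c) r \<times> sphere (snd c) r) g"
    and z: "z \<in> ball (fst c) r \<times> ball (snd c) r"
  shows "continuous_on S (torus_kernel c r g z)"
proof -
  have "continuous_on S (\<lambda>st. g (circle_pt (fst c) r (fst st), circle_pt (snd c) r (snd st)))"
    by (rule continuous_on_compose2[OF g])
      (auto intro!: continuous_intros simp: circle_pt_sphere r)
  then show ?thesis
    unfolding torus_kernel_def Let_def using z circle_pt_neq[OF r]
    by (intro continuous_intros) (auto simp: mem_Times_iff)
qed

lemma cauchy_kernel_has_derivative:
  fixes A \<zeta> \<eta> :: complex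
  assumes "\<zeta> \<noteq> fst w" "\<eta> \<noteq> snd w"
  shows "((\<lambda>z. A / ((\<zeta> - fst z) * (\<eta> - snd z))) has_derivative
    (\<lambda>h. A / ((\<zeta> - fst w) * (\<eta> - snd w)) / (\<zeta> - fst w) * fst h
        + A / ((\<zeta> - fst w) * (\<eta> - snd w)) / (\<eta> - snd w) * snd h)) (at w within U)"
proof -
  define a b where "a = \<zeta> - fst w" and "b = \<eta> - snd w"
  have ab: "a \<noteq> 0" "b \<noteq> 0" using assms by (auto simp: a_def b_def)
  have "((\<lambda>z. (\<zeta> - fst z) * (\<eta> - snd z)) has_derivative (\<lambda>h. a * (- snd h) + (- fst h) * b)) (at w within U)"
    unfolding a_def b_def by (auto intro!: derivative_eq_intros)
  from Deriv.has_derivative_divide[OF has_derivative_const[of A] this]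
  have "((\<lambda>z. A / ((\<zeta> - fst z) * (\<eta> - snd z))) has_derivative
    (\<lambda>h. - A * (inverse (a * b) * (a * (- snd h) + (- fst h) * b) * inverse (a * b)) + 0 / (a * b))) (at w within U)"
    using ab by (simp add: a_def b_def)
  also have "(\<lambda>h. - A * (inverse (a * b) * (a * (- snd h) + (- fst h) * b) * inverse (a * b)) + 0 / (a * b)) =
     (\<lambda>h. A / (a * b) / a * fst h + A / (a * b) / b * snd h)"
    using ab by (simp add: fun_eq_iff field_simps)
  finally show ?thesis unfolding a_def b_def .
qed

text \<open>
  The function \<open>g\<close> enters only through its values on the torus, and \<open>z\<close> only through the Cauchy kernel,
  whose derivative is jointly continuous. Hence one may differentiate under the integral even if \<open>g\<close> is
  merely continuous; this is what makes the integral an extension device.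
\<close>

lemma torus_integral_holomorphic:
  assumes r: "r > 0" and g: "continuous_on (sphere (fst c) r \<times> sphere (snd c) r) g"
  shows "holomorphic2_on (torus_integral c r g) (ball (fst c) r \<times> ball (snd c) r)"
  unfolding holomorphic2_on_def
proof
  let ?U = "ball (fst c) r \<times> ball (snd c) r" and ?B = "cbox (0, 0) (1, 1) :: (real \<times> real) set"
  fix z assume z: "z \<in> ?U"
  define dK where "dK = (\<lambda>z st.
     (blinfun_mult_right (torus_kernel c r g z st / (circle_pt (fst c) r (fst st) - fst z)) o\<^sub>L fst_blinfun) +
     (blinfun_mult_right (torus_kernel c r g z st / (circle_pt (snd c) r (snd st) - snd z)) o\<^sub>L snd_blinfun)
       :: (complex \<times> complex) \<Rightarrow>\<^sub>L complex)"
  have contg: "continuous_on (?U \<times> ?B) (\<lambda>(z, st). g (circle_pt (fst c) r (fst st), circle_pt (snd c) r (snd st)))"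
    unfolding case_prod_beta
    by (rule continuous_on_compose2[OF g])
      (auto intro!: continuous_intros simp: circle_pt_sphere r)
  have contK: "continuous_on (?U \<times> ?B) (\<lambda>(z, st). torus_kernel c r g z st)"
    unfolding torus_kernel_def Let_def case_prod_beta
    using contg[unfolded case_prod_beta] circle_pt_neq[OF r]
    by (intro continuous_intros) (auto simp: mem_Times_iff)
  have contd: "continuous_on (?U \<times> ?B) (\<lambda>(z, st). dK z st)"
    unfolding dK_def case_prod_beta
    using contK[unfolded case_prod_beta] circle_pt_neq[OF r]
    by (intro continuous_intros bounded_linear.continuous_on[OF bounded_linear_blinfun_mult_right])
      (auto simp: mem_Times_iff)
  have der: "((\<lambda>z. torus_kernel c r g z st) has_derivative blinfun_apply (dK w st)) (at w within ?U)"
    if w: "w \<in> ?U" for w st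
  proof -
    have ne: "circle_pt (fst c) r (fst st) \<noteq> fst w" "circle_pt (snd c) r (snd st) \<noteq> snd w"
      using w circle_pt_neq[OF r] by (auto simp: mem_Times_iff)
    have "blinfun_apply (dK w st) = (\<lambda>h. torus_kernel c r g w st / (circle_pt (fst c) r (fst st) - fst w) * fst h
        + torus_kernel c r g w st / (circle_pt (snd c) r (snd st) - snd w) * snd h)"
      by (simp add: dK_def blinfun.add_left fun_eq_iff)
    then show ?thesis
      using cauchy_kernel_has_derivative[OF ne] by (simp only: torus_kernel_def Let_def)
  qed
  have "((\<lambda>z. integral ?B (torus_kernel c r g z)) has_derivative integral ?B (dK z)) (at z within ?U)"
  proof (rule leibniz_rule[OF der _ contd z])
    show "torus_kernel c r g w integrable_on ?B" if "w \<in> ?U" for w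
      by (rule integrable_continuous[OF torus_kernel_continuous[OF r g that]])
  qed (auto intro: convex_Times)
  then have D: "(torus_integral c r g has_derivative integral ?B (dK z)) (at z)"
    using z by (simp add: torus_integral_def[abs_def] at_within_open[OF _ open_Times])
  have int: "dK z integrable_on ?B"
  proof (rule integrable_continuous)
    have "continuous_on ?B (\<lambda>st. (z, st))" by (intro continuous_intros)
    from continuous_on_compose2[OF contd this] z show "continuous_on ?B (dK z)" by force
  qed
  have "blinfun_apply (dK z st) (k * fst h, k * snd h) = k * blinfun_apply (dK z st) h" for st k h
    by (simp add: dK_def blinfun.add_left algebra_simps)
  then have lin: "blinfun_apply (integral ?B (dK z)) (k * fst h, k * snd h) = k * blinfun_apply (integral ?B (dK z)) h" for k h
    by (simp only: blinfun_apply_integral[OF int] integral_mult_right)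
  define A where "A = blinfun_apply (integral ?B (dK z))"
  have "A h = A (1, 0) * fst h + A (0, 1) * snd h" for h
  proof -
    have "A h = A ((fst h * fst (1, 0 :: complex), fst h * snd (1 :: complex, 0)) +
        (snd h * fst (0, 1 :: complex), snd h * snd (0 :: complex, 1)))"
      by simp
    also have "\<dots> = fst h * A (1, 0) + snd h * A (0, 1)"
      unfolding A_def blinfun.add_right lin ..
    finally show ?thesis by (simp add: mult.commute)
  qed
  then have "A = (\<lambda>h. A (1, 0) * fst h + A (0, 1) * snd h)" by blast
  from has_derivative_eq_rhs[OF D[folded A_def] this]
  show "\<exists>a b. (torus_integral c r g has_derivative (\<lambda>h. a * fst h + b * snd h)) (at z)"
    by blast
qed

lemma torus_integral_iterated:
  assumes r: "r > 0" and g: "continuous_on (sphere (fst c) r \<times> sphere (snd c) r) g"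
    and z: "z \<in> ball (fst c) r \<times> ball (snd c) r"
    and inner: "\<And>s. integral (cbox 0 1) (\<lambda>t. g (circle_pt (fst c) r s, circle_pt (snd c) r t) *
        (circle_pt (snd c) r t - snd c) / (circle_pt (snd c) r t - snd z)) = k (circle_pt (fst c) r s)"
  shows "torus_integral c r g z = integral (cbox 0 1) (\<lambda>s. k (circle_pt (fst c) r s) *
        (circle_pt (fst c) r s - fst c) / (circle_pt (fst c) r s - fst z))"
proof -
  have "torus_integral c r g z = integral (cbox 0 1) (\<lambda>s. integral (cbox 0 1) (\<lambda>t. torus_kernel c r g z (s, t)))"
    unfolding torus_integral_def
    by (rule integral_prod_continuous[OF torus_kernel_continuous[OF r g z]])
  also have "\<dots> = integral (cbox 0 1) (\<lambda>s. k (circle_pt (fst c) r s) *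
        (circle_pt (fst c) r s - fst c) / (circle_pt (fst c) r s - fst z))"
  proof (rule integral_cong)
    fix s
    have "torus_kernel c r g z (s, t) = (circle_pt (fst c) r s - fst c) / (circle_pt (fst c) r s - fst z) *
       (g (circle_pt (fst c) r s, circle_pt (snd c) r t) *
        (circle_pt (snd c) r t - snd c) / (circle_pt (snd c) r t - snd z))" for t
      by (simp add: torus_kernel_def Let_def)
    then show "integral (cbox 0 1) (\<lambda>t. torus_kernel c r g z (s, t)) = k (circle_pt (fst c) r s) *
        (circle_pt (fst c) r s - fst c) / (circle_pt (fst c) r s - fst z)"
      by (simp only: integral_mult_right inner) simp
  qed
  finally show ?thesis .
qed

lemma polydisc_nbhd:
  assumes "open U" "c \<in> U"
  obtains r :: real where "r > 0" "cball (fst c) r \<times> cball (snd c) r \<subseteq> U"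
proof -
  obtain e where e: "e > 0" "cball c e \<subseteq> U" using assms open_contains_cball by blast
  have "cball (fst c) (e/2) \<times> cball (snd c) (e/2) \<subseteq> cball c e"
  proof
    fix z assume "z \<in> cball (fst c) (e/2) \<times> cball (snd c) (e/2)"
    then have "dist (fst c) (fst z) + dist (snd c) (snd z) \<le> e" by (auto simp: mem_Times_iff)
    moreover have "dist c z \<le> dist (fst c) (fst z) + dist (snd c) (snd z)"
      by (metis dist_prod_def sqrt_sum_squares_le_sum zero_le_dist prod.collapse dist_Pair_Pair)
    ultimately show "z \<in> cball c e" by simp
  qed
  then show ?thesis using that[of "e/2"] e by auto
qed

text \<open>
  The torus around \<open>c\<close> avoids \<open>c\<close>, so the torus integral of \<open>f\<close> is defined and holomorphic on the
  whole bidisc; on every line that misses \<open>c\<close> Cauchy's formula in one variable gives back \<open>f\<close>.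
\<close>

lemma hartogs_removable_point:
  assumes U: "open U" and c: "c \<in> U" and f: "holomorphic2_on f (U - {c})"
  shows "\<exists>F. holomorphic2_on F U \<and> (\<forall>z\<in>U - {c}. F z = f z)"
proof -
  obtain r where r: "r > 0" and sub: "cball (fst c) r \<times> cball (snd c) r \<subseteq> U"
    using polydisc_nbhd[OF U c] .
  let ?B = "ball (fst c) r \<times> ball (snd c) r"
  let ?T = "torus_integral c r f"
  have "sphere (fst c) r \<times> sphere (snd c) r \<subseteq> U - {c}" using sub r by (force simp: mem_Times_iff)
  then have g: "continuous_on (sphere (fst c) r \<times> sphere (snd c) r) f"
    using continuous_on_subset holomorphic2_on_continuous[OF f] by blast
  note hol = torus_integral_holomorphic[OF r g]
  have slice2: "\<lbrakk>x \<noteq> fst c; x \<in> cball (fst c) r\<rbrakk> \<Longrightarrow> (\<lambda>y. f (x, y)) holomorphic_on cball (snd c) r" for x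
    by (rule holomorphic2_on_slice_snd[OF f]) (use sub in \<open>auto simp: prod_eq_iff mem_Times_iff\<close>)
  have slice1: "\<lbrakk>y \<noteq> snd c; y \<in> cball (snd c) r\<rbrakk> \<Longrightarrow> (\<lambda>x. f (x, y)) holomorphic_on cball (fst c) r" for y
    by (rule holomorphic2_on_slice_fst[OF f]) (use sub in \<open>auto simp: prod_eq_iff mem_Times_iff\<close>)
  have off: "?T z = f z" if z: "z \<in> ?B" and ne: "snd z \<noteq> snd c" for z
  proof -
    have "?T z = integral (cbox 0 1) (\<lambda>s. f (circle_pt (fst c) r s, snd z) *
        (circle_pt (fst c) r s - fst c) / (circle_pt (fst c) r s - fst z))"
    proof (rule torus_integral_iterated[OF r g z])
      fix s
      have h: "(\<lambda>y. f (circle_pt (fst c) r s, y)) holomorphic_on cball (snd c) r"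
        using slice2 circle_pt_neq[OF r, of "fst c" "fst c" s] circle_pt_sphere[OF r, of "fst c" s] r by auto
      show "integral (cbox 0 1) (\<lambda>t. f (circle_pt (fst c) r s, circle_pt (snd c) r t) *
          (circle_pt (snd c) r t - snd c) / (circle_pt (snd c) r t - snd z)) = f (circle_pt (fst c) r s, snd z)"
        by (rule cauchy_circle_pt[of _ _ "\<lambda>y. f (circle_pt (fst c) r s, y)"])
          (use z holomorphic_on_imp_continuous_on[OF h] holomorphic_on_subset[OF h ball_subset_cball] in auto)
    qed
    also have "\<dots> = f (fst z, snd z)"
    proof -
      have h: "(\<lambda>x. f (x, snd z)) holomorphic_on cball (fst c) r" using slice1 ne z by auto
      show ?thesis
        by (rule cauchy_circle_pt[of _ _ "\<lambda>x. f (x, snd z)"])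
          (use z holomorphic_on_imp_continuous_on[OF h] holomorphic_on_subset[OF h ball_subset_cball] in auto)
    qed
    finally show ?thesis by simp
  qed
  \<comment> \<open>On the line through \<open>c\<close> where the outer Cauchy formula meets the puncture, continuity decides.\<close>
  have T: "?T z = f z" if z: "z \<in> ?B - {c}" for z
  proof (cases "snd z = snd c")
    case False then show ?thesis using off z by blast
  next
    case True
    then have x: "fst z \<noteq> fst c" using z by (auto simp: prod_eq_iff)
    have zB: "fst z \<in> ball (fst c) r" "snd c \<in> ball (snd c) r" using z r by auto
    have "(\<lambda>y. ?T (fst z, y)) holomorphic_on ball (snd c) r"
      by (rule holomorphic2_on_slice_snd[OF hol]) (use z in auto)
    moreover have "(\<lambda>y. f (fst z, y)) holomorphic_on ball (snd c) r"
      using slice2[OF x] z holomorphic_on_subset[OF _ ball_subset_cball] by auto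
    ultimately have "(\<lambda>y. ?T (fst z, y) - f (fst z, y)) holomorphic_on ball (snd c) r"
      by (rule holomorphic_on_diff)
    then have "isCont (\<lambda>y. ?T (fst z, y) - f (fst z, y)) (snd c)"
      using zB continuous_on_eq_continuous_at[OF open_ball] holomorphic_on_imp_continuous_on by blast
    then have 1: "((\<lambda>y. ?T (fst z, y) - f (fst z, y)) \<longlongrightarrow> ?T (fst z, snd c) - f (fst z, snd c)) (at (snd c))"
      by (simp add: isCont_def)
    have "\<forall>\<^sub>F y in at (snd c). y \<in> ball (snd c) r \<and> y \<noteq> snd c"
      using eventually_at_in_open[of "ball (snd c) r" "snd c"] zB by simp
    then have "\<forall>\<^sub>F y in at (snd c). 0 = ?T (fst z, y) - f (fst z, y)"
      by eventually_elim (use off zB in auto)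
    then have 2: "((\<lambda>y. ?T (fst z, y) - f (fst z, y)) \<longlongrightarrow> 0) (at (snd c))"
      by (rule Lim_transform_eventually[OF tendsto_const])
    from tendsto_unique[OF _ 1 2] True show ?thesis by (metis diff_eq_eq add_0 prod.collapse trivial_limit_at)
  qed
  define F where "F z = (if z = c then ?T c else f z)" for z
  have "holomorphic2_on F U"
  proof (rule holomorphic2_on_local)
    fix z assume z: "z \<in> U"
    show "\<exists>V g. open V \<and> z \<in> V \<and> holomorphic2_on g V \<and> (\<forall>w\<in>V. g w = F w)"
    proof (cases "z = c")
      case True
      then show ?thesis
        by (intro exI[of _ ?B] exI[of _ ?T]) (use T hol r in \<open>auto simp: F_def open_Times mem_Times_iff\<close>)
    next
      case False
      then show ?thesis
        by (intro exI[of _ "U - {c}"] exI[of _ f]) (use f z U in \<open>auto simp: F_def open_Diff\<close>)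
    qed
  qed
  then show ?thesis by (intro exI[of _ F]) (auto simp: F_def)
qed

text \<open>
  The quotient is the torus integral of \<open>f z / (fst z - fst c)\<close>: the denominator has no zero on the
  torus, and the Cauchy formulas at \<open>z\<close> and at the zero line identify it off this line.
\<close>

lemma divide_by_coordinate:
  assumes U: "open U" and c: "c \<in> U" and f: "holomorphic2_on f U"
    and van: "\<And>z. z \<in> U \<Longrightarrow> fst z = fst c \<Longrightarrow> f z = 0"
  shows "\<exists>V h. open V \<and> c \<in> V \<and> V \<subseteq> U \<and> holomorphic2_on h V \<and> (\<forall>z\<in>V. f z = (fst z - fst c) * h z)"
proof -
  obtain r where r: "r > 0" and sub: "cball (fst c) r \<times> cball (snd c) r \<subseteq> U"
    using polydisc_nbhd[OF U c] .
  let ?B = "ball (fst c) r \<times> ball (snd c) r"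
  let ?g = "\<lambda>z. f z / (fst z - fst c)"
  let ?T = "torus_integral c r ?g"
  have "sphere (fst c) r \<times> sphere (snd c) r \<subseteq> U" using sub by (force simp: mem_Times_iff)
  then have "continuous_on (sphere (fst c) r \<times> sphere (snd c) r) f"
    using continuous_on_subset holomorphic2_on_continuous[OF f] by blast
  then have g: "continuous_on (sphere (fst c) r \<times> sphere (snd c) r) ?g"
    by (intro continuous_intros) (use r in auto)
  have h2: "(\<lambda>y. f (x, y)) holomorphic_on cball (snd c) r" if "x \<in> cball (fst c) r" for x
    by (rule holomorphic2_on_slice_snd[OF f]) (use sub that in auto)
  have h1: "(\<lambda>x. f (x, y)) holomorphic_on cball (fst c) r" if "y \<in> cball (snd c) r" for y
    by (rule holomorphic2_on_slice_fst[OF f]) (use sub that in auto)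
  have "f z = (fst z - fst c) * ?T z" if z: "z \<in> ?B" for z
  proof -
    let ?p = "circle_pt (fst c) r"
    have ne: "?p s \<noteq> fst c" "?p s \<noteq> fst z" for s using circle_pt_neq[OF r] z r by auto
    have T: "?T z = integral (cbox 0 1) (\<lambda>s. (f (?p s, snd z) / (?p s - fst c)) *
        (?p s - fst c) / (?p s - fst z))"
    proof (rule torus_integral_iterated[OF r g z])
      fix s
      have "(\<lambda>y. f (?p s, y)) holomorphic_on cball (snd c) r" 
        by (rule h2) (use circle_pt_sphere[OF r] in auto)
      then have h: "(\<lambda>y. ?g (?p s, y)) holomorphic_on cball (snd c) r"
        by (auto intro!: holomorphic_intros simp: ne)
      show "integral (cbox 0 1) (\<lambda>t. ?g (?p s, circle_pt (snd c) r t) *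
          (circle_pt (snd c) r t - snd c) / (circle_pt (snd c) r t - snd z)) = f (?p s, snd z) / (?p s - fst c)"
        using cauchy_circle_pt[of _ _ "\<lambda>y. ?g (?p s, y)", OF holomorphic_on_imp_continuous_on[OF h]
           holomorphic_on_subset[OF h ball_subset_cball]] z by auto
    qed
    have h: "(\<lambda>x. f (x, snd z)) holomorphic_on cball (fst c) r" using h1 z by auto
    have cauchy: "integral (cbox 0 1) (\<lambda>s. f (?p s, snd z) * (?p s - fst c) / (?p s - x)) = f (x, snd z)"
      if "x \<in> ball (fst c) r" for x
      using cauchy_circle_pt[of _ _ "\<lambda>x. f (x, snd z)", OF holomorphic_on_imp_continuous_on[OF h]
           holomorphic_on_subset[OF h ball_subset_cball]] that by auto
    have int: "(\<lambda>s. f (?p s, snd z) * (?p s - fst c) / (?p s - x)) integrable_on cbox 0 1"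
      if "x \<in> ball (fst c) r" for x
    proof (rule integrable_continuous)
      have "continuous_on (cbox 0 1) (\<lambda>s. f (?p s, snd z))"
        by (rule continuous_on_compose2[OF holomorphic_on_imp_continuous_on[OF h]])
          (use circle_pt_sphere[OF r] in \<open>auto intro!: continuous_intros\<close>)
      then show "continuous_on (cbox 0 1) (\<lambda>s. f (?p s, snd z) * (?p s - fst c) / (?p s - x))"
        by (intro continuous_intros) (use circle_pt_neq[OF r that] in auto)
    qed
    have "(fst z - fst c) * ?T z = integral (cbox 0 1) (\<lambda>s. f (?p s, snd z) * (?p s - fst c) / (?p s - fst z)
         - f (?p s, snd z) * (?p s - fst c) / (?p s - fst c))"
      unfolding T integral_mult_right[symmetric]
      by (rule integral_cong) (use ne in \<open>simp add: divide_simps, simp add: algebra_simps\<close>)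
    also have "\<dots> = f (fst z, snd z) - f (fst c, snd z)"
    proof -
      have m: "fst c \<in> ball (fst c) r" "fst z \<in> ball (fst c) r" using z r by auto
      show ?thesis unfolding integral_diff[OF int[OF m(2)] int[OF m(1)]] cauchy[OF m(1)] cauchy[OF m(2)] ..
    qed
    also have "f (fst c, snd z) = 0" by (rule van) (use z sub r in auto)
    finally show ?thesis by simp
  qed
  moreover have "?B \<subseteq> U" using sub by (force simp: mem_Times_iff)
  ultimately show ?thesis
    by (intro exI[of _ ?B] exI[of _ ?T])
      (use torus_integral_holomorphic[OF r g] r in \<open>auto simp: open_Times mem_Times_iff\<close>)
qed

section \<open>Complex surfaces given by an atlas\<close>

text \<open>
  Near \<open>z\<close> the parametrization \<open>\<psi>\<close> factors through \<open>\<theta>\<close> by a holomorphic map. This pointwise notion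
  composes, so that one may pass through intermediate patches.
\<close>

definition trans_at ::
  "(complex \<times> complex) set \<Rightarrow> (complex \<times> complex \<Rightarrow> 'a) \<Rightarrow>
   (complex \<times> complex) set \<Rightarrow> (complex \<times> complex \<Rightarrow> 'a) \<Rightarrow> complex \<times> complex \<Rightarrow> bool" where
  "trans_at D \<psi> E \<theta> z \<longleftrightarrow>
     (\<exists>U \<tau>1 \<tau>2. open U \<and> z \<in> U \<and> U \<subseteq> D \<and> holomorphic2_on \<tau>1 U \<and> holomorphic2_on \<tau>2 U \<and>
        (\<forall>w\<in>U. (\<tau>1 w, \<tau>2 w) \<in> E \<and> \<theta> (\<tau>1 w, \<tau>2 w) = \<psi> w))"

definition complex_atlas :: "'a atlas2 \<Rightarrow> bool" where
  "complex_atlas A \<longleftrightarrow>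
     (\<forall>(D, \<psi>)\<in>A. open D \<and> inj_on \<psi> D) \<and>
     (\<forall>(D, \<psi>)\<in>A. \<forall>(E, \<theta>)\<in>A. \<forall>z\<in>D. \<psi> z \<in> \<theta> ` E \<longrightarrow> trans_at D \<psi> E \<theta> z)"

lemma trans_at_refl:
  assumes "open D" "z \<in> D" "D \<subseteq> E"
  shows "trans_at D \<psi> E \<psi> z"
  unfolding trans_at_def
  using assms holomorphic2_on_fst holomorphic2_on_snd
  by (intro exI[of _ D] exI[of _ fst] exI[of _ snd]) auto

lemma trans_at_trans:
  assumes 1: "trans_at D \<psi> E \<theta> z" and 2: "trans_at E \<theta> F \<omega> z'"
    and z': "z' \<in> E" "\<theta> z' = \<psi> z" and inj: "inj_on \<theta> E"
  shows "trans_at D \<psi> F \<omega> z"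
proof -
  obtain U \<tau>1 \<tau>2 where U: "open U" "z \<in> U" "U \<subseteq> D" "holomorphic2_on \<tau>1 U" "holomorphic2_on \<tau>2 U"
    "\<And>w. w \<in> U \<Longrightarrow> (\<tau>1 w, \<tau>2 w) \<in> E" "\<And>w. w \<in> U \<Longrightarrow> \<theta> (\<tau>1 w, \<tau>2 w) = \<psi> w"
    using 1 unfolding trans_at_def by blast
  obtain V \<sigma>1 \<sigma>2 where V: "open V" "z' \<in> V" "V \<subseteq> E" "holomorphic2_on \<sigma>1 V" "holomorphic2_on \<sigma>2 V"
    "\<And>w. w \<in> V \<Longrightarrow> (\<sigma>1 w, \<sigma>2 w) \<in> F" "\<And>w. w \<in> V \<Longrightarrow> \<omega> (\<sigma>1 w, \<sigma>2 w) = \<theta> w"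
    using 2 unfolding trans_at_def by blast
  have z: "(\<tau>1 z, \<tau>2 z) = z'" using inj U(2,6,7) z' by (metis inj_onD)
  let ?T = "\<lambda>w. (\<tau>1 w, \<tau>2 w)"
  define W where "W = U \<inter> ?T -` V"
  have "continuous_on U ?T"
    using U holomorphic2_on_continuous by (intro continuous_intros) blast+
  then have W: "open W" using U(1) V(1) by (auto simp: W_def intro: continuous_open_preimage)
  have "holomorphic2_on (\<lambda>w. \<sigma>1 (\<tau>1 w, \<tau>2 w)) W" "holomorphic2_on (\<lambda>w. \<sigma>2 (\<tau>1 w, \<tau>2 w)) W"
    by (rule holomorphic2_on_compose[of _ _ _ _ V]; use U(4,5) V(4,5) in \<open>auto simp: W_def intro: holomorphic2_on_subset\<close>)+
  then show ?thesis unfolding trans_at_def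
    using W U V z
    by (intro exI[of _ W] exI[of _ "\<lambda>w. \<sigma>1 (\<tau>1 w, \<tau>2 w)"] exI[of _ "\<lambda>w. \<sigma>2 (\<tau>1 w, \<tau>2 w)"])
      (auto simp: W_def)
qed

locale surface =
  fixes A :: "'a atlas2"
  assumes atlas: "complex_atlas A"
begin

abbreviation X :: "'a cspace" where "X \<equiv> surface_of_atlas A"

lemma openin_iff: "openin (ctop X) W \<longleftrightarrow> atlas_open A W"
  by (simp add: surface_of_atlas_def topology_inverse' istopology_atlas_open)

lemma hol_iff: "hol X W f \<longleftrightarrow> openin (ctop X) W \<and> (\<forall>(D, \<psi>)\<in>A. holomorphic2_on (f \<circ> \<psi>) {z \<in> D. \<psi> z \<in> W})"
  unfolding openin_iff by (simp add: surface_of_atlas_def)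

lemma chart_dom: "(D, \<psi>) \<in> A \<Longrightarrow> open D" and chart_inj: "(D, \<psi>) \<in> A \<Longrightarrow> inj_on \<psi> D"
  using atlas unfolding complex_atlas_def by auto

lemma chart_trans:
  "(D, \<psi>) \<in> A \<Longrightarrow> (E, \<theta>) \<in> A \<Longrightarrow> z \<in> D \<Longrightarrow> \<psi> z \<in> \<theta> ` E \<Longrightarrow> trans_at D \<psi> E \<theta> z"
  using atlas unfolding complex_atlas_def by fast

lemma open_vimage: "openin (ctop X) W \<Longrightarrow> (D, \<psi>) \<in> A \<Longrightarrow> open {z \<in> D. \<psi> z \<in> W}"
  unfolding openin_iff atlas_open_def by fast

lemma topspace_X: "topspace (ctop X) = (\<Union>(D, \<psi>)\<in>A. \<psi> ` D)"
proof -
  have "atlas_open A (\<Union>(D, \<psi>)\<in>A. \<psi> ` D)"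
    unfolding atlas_open_def
  proof (intro conjI ballI, simp, clarify)
    fix D \<psi> assume D: "(D, \<psi>) \<in> A"
    then have "{z \<in> D. \<psi> z \<in> (\<Union>(D, \<psi>)\<in>A. \<psi> ` D)} = D" by fast
    then show "open {z \<in> D. \<psi> z \<in> (\<Union>(D, \<psi>)\<in>A. \<psi> ` D)}" using chart_dom[OF D] by simp
  qed
  moreover have "topspace (ctop X) \<subseteq> (\<Union>(D, \<psi>)\<in>A. \<psi> ` D)"
    using openin_topspace[of "ctop X"] unfolding openin_iff atlas_open_def by blast
  ultimately show ?thesis using openin_subset[of "ctop X"] unfolding openin_iff by blast
qed

lemma chart_at:
  assumes "x \<in> topspace (ctop X)"
  obtains D \<psi> z where "(D, \<psi>) \<in> A" "z \<in> D" "\<psi> z = x"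
  using assms unfolding topspace_X by blast

text \<open>
  Injectivity of \<open>\<psi>\<close> is essential: it forces a transition map that takes a point into the image of \<open>U\<close>
  to take values in \<open>U\<close> itself.
\<close>

lemma chart_open:
  assumes D: "(D, \<psi>) \<in> A" and U: "open U" "U \<subseteq> D"
  shows "openin (ctop X) (\<psi> ` U)"
  unfolding openin_iff atlas_open_def
proof (intro conjI)
  show "\<psi> ` U \<subseteq> (\<Union>(D, \<psi>)\<in>A. \<psi> ` D)" using D U by blast
  show "\<forall>(E, \<theta>)\<in>A. open {z \<in> E. \<theta> z \<in> \<psi> ` U}"
  proof clarify
    fix E \<theta> assume E: "(E, \<theta>) \<in> A"
    show "open {z \<in> E. \<theta> z \<in> \<psi> ` U}"
    proof (subst open_subopen, clarify)
      fix z w assume z: "z \<in> E" and w: "w \<in> U" "\<theta> z = \<psi> w"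
      have "trans_at E \<theta> D \<psi> z" using chart_trans[OF E D z] w U by auto
      then obtain V \<tau>1 \<tau>2 where V: "open V" "z \<in> V" "V \<subseteq> E" "holomorphic2_on \<tau>1 V" "holomorphic2_on \<tau>2 V"
        "\<And>w. w \<in> V \<Longrightarrow> (\<tau>1 w, \<tau>2 w) \<in> D" "\<And>w. w \<in> V \<Longrightarrow> \<psi> (\<tau>1 w, \<tau>2 w) = \<theta> w"
        unfolding trans_at_def by blast
      have "(\<tau>1 z, \<tau>2 z) = w" using chart_inj[OF D] V(2,6,7) w U by (metis inj_onD subsetD)
      moreover have "continuous_on V (\<lambda>w. (\<tau>1 w, \<tau>2 w))"
        using V holomorphic2_on_continuous by (intro continuous_intros) blast+
      then have "open (V \<inter> (\<lambda>w. (\<tau>1 w, \<tau>2 w)) -` U)" using V(1) U(1) by (auto intro: continuous_open_preimage)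
      ultimately show "\<exists>T. open T \<and> z \<in> T \<and> T \<subseteq> {z \<in> E. \<theta> z \<in> \<psi> ` U}"
        using V w by (intro exI[of _ "V \<inter> (\<lambda>w. (\<tau>1 w, \<tau>2 w)) -` U"]) (force simp: image_iff)
    qed
  qed
qed

lemma openin_finite_diff:
  assumes "openin (ctop X) W" "finite S"
  shows "openin (ctop X) (W - S)"
proof -
  have "openin (ctop X) (W - {x})" if W: "openin (ctop X) W" for W x
    unfolding openin_iff atlas_open_def
  proof (intro conjI)
    show "W - {x} \<subseteq> (\<Union>(D, \<psi>)\<in>A. \<psi> ` D)" using W unfolding openin_iff atlas_open_def by blast
    show "\<forall>(D, \<psi>)\<in>A. open {z \<in> D. \<psi> z \<in> W - {x}}"
    proof clarify
      fix D \<psi> assume D: "(D, \<psi>) \<in> A"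
      have "finite (\<psi> -` {x} \<inter> D)" by (rule finite_vimage_IntI) (use chart_inj[OF D] in auto)
      then have "closed {z \<in> D. \<psi> z = x}" by (intro finite_imp_closed) (simp add: vimage_def Int_def conj_commute)
      moreover have "{z \<in> D. \<psi> z \<in> W - {x}} = {z \<in> D. \<psi> z \<in> W} - {z \<in> D. \<psi> z = x}" by auto
      ultimately show "open {z \<in> D. \<psi> z \<in> W - {x}}" using open_vimage[OF W D] by (simp add: open_Diff)
    qed
  qed
  note single = this
  from assms(2) show ?thesis
  proof (induction S rule: finite_induct)
    case empty
    show ?case using assms(1) by simp
  next
    case (insert x S)
    have eq: "W - insert x S = (W - S) - {x}" by blast
    show ?case unfolding eq by (rule single[OF insert.IH])
  qed
qed

subsection \<open>The sheaf of holomorphic functions\<close>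

lemma hol_openin: "hol X W f \<Longrightarrow> openin (ctop X) W"
  by (simp add: hol_iff)

lemma hol_chartD: "hol X W f \<Longrightarrow> (D, \<psi>) \<in> A \<Longrightarrow> holomorphic2_on (f \<circ> \<psi>) {z \<in> D. \<psi> z \<in> W}"
  unfolding hol_iff by fast

lemma holI:
  assumes "openin (ctop X) W" "\<And>D \<psi>. (D, \<psi>) \<in> A \<Longrightarrow> holomorphic2_on (f \<circ> \<psi>) {z \<in> D. \<psi> z \<in> W}"
  shows "hol X W f"
  unfolding hol_iff using assms by fast

lemma hol_subset:
  assumes "hol X W f" "openin (ctop X) V" "V \<subseteq> W"
  shows "hol X V f"
  by (rule holI[OF assms(2)], rule holomorphic2_on_subset[OF hol_chartD[OF assms(1)]]) (use assms(3) in auto)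

lemma hol_local:
  assumes "\<And>x. x \<in> W \<Longrightarrow> \<exists>V g. x \<in> V \<and> V \<subseteq> W \<and> hol X V g \<and> (\<forall>y\<in>V. g y = f y)"
  shows "hol X W f"
  unfolding hol_iff
proof (intro conjI)
  show "openin (ctop X) W"
  proof (rule openin_subopen[THEN iffD2], rule ballI)
    fix x assume "x \<in> W"
    from assms[OF this] obtain V g where "x \<in> V" "V \<subseteq> W" "hol X V g" by blast
    then show "\<exists>T. openin (ctop X) T \<and> x \<in> T \<and> T \<subseteq> W" using hol_openin[of V g] by blast
  qed
  show "\<forall>(D, \<psi>)\<in>A. holomorphic2_on (f \<circ> \<psi>) {z \<in> D. \<psi> z \<in> W}"
  proof clarify
    fix D \<psi> assume D: "(D, \<psi>) \<in> A"
    show "holomorphic2_on (f \<circ> \<psi>) {z \<in> D. \<psi> z \<in> W}"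
    proof (rule holomorphic2_on_local, clarify)
      fix a b assume ab: "(a, b) \<in> D" "\<psi> (a, b) \<in> W"
      obtain V g where V: "\<psi> (a, b) \<in> V" "V \<subseteq> W" "hol X V g" "\<forall>y\<in>V. g y = f y" using assms[OF ab(2)] by blast
      show "\<exists>U g. open U \<and> (a, b) \<in> U \<and> holomorphic2_on g U \<and> (\<forall>w\<in>U. g w = (f \<circ> \<psi>) w)"
        using open_vimage[OF hol_openin[OF V(3)] D] hol_chartD[OF V(3) D] ab V
        by (intro exI[of _ "{z \<in> D. \<psi> z \<in> V}"] exI[of _ "g \<circ> \<psi>"]) auto
    qed
  qed
qed

lemma hol_cong_imp:
  assumes "hol X W f" "\<And>x. x \<in> W \<Longrightarrow> f x = g x"
  shows "hol X W g"
  by (rule hol_local) (use assms in \<open>auto intro!: exI[of _ W] exI[of _ f]\<close>)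

lemma hol_const:
  assumes "openin (ctop X) W"
  shows "hol X W (\<lambda>x. c)"
  by (rule holI[OF assms]) (simp add: comp_def holomorphic2_on_const)

lemma hol_mult:
  assumes "hol X W f" "hol X W g"
  shows "hol X W (\<lambda>x. f x * g x)"
  by (rule holI[OF hol_openin[OF assms(1)]])
    (use holomorphic2_on_mult[OF hol_chartD[OF assms(1)] hol_chartD[OF assms(2)]] in \<open>simp add: comp_def\<close>)

lemma hol_add:
  assumes "hol X W f" "hol X W g"
  shows "hol X W (\<lambda>x. f x + g x)"
  by (rule holI[OF hol_openin[OF assms(1)]])
    (use holomorphic2_on_add[OF hol_chartD[OF assms(1)] hol_chartD[OF assms(2)]] in \<open>simp add: comp_def\<close>)

lemma hol_diff:
  assumes "hol X W f" "hol X W g"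
  shows "hol X W (\<lambda>x. f x - g x)"
  using hol_add[OF assms(1) hol_mult[OF hol_const[OF hol_openin[OF assms(1)], of "- 1"] assms(2)]] by simp

lemma hol_inverse:
  assumes "hol X W f" "\<And>x. x \<in> W \<Longrightarrow> f x \<noteq> 0"
  shows "hol X W (\<lambda>x. inverse (f x))"
proof (rule holI[OF hol_openin[OF assms(1)]])
  fix D \<psi> assume "(D, \<psi>) \<in> A"
  from holomorphic2_on_inverse[OF hol_chartD[OF assms(1) this]] assms(2)
  show "holomorphic2_on ((\<lambda>x. inverse (f x)) \<circ> \<psi>) {z \<in> D. \<psi> z \<in> W}" by (simp add: comp_def)
qed

lemma openin_nonzero:
  assumes f: "hol X W f"
  shows "openin (ctop X) {y \<in> W. f y \<noteq> 0}"
  unfolding openin_iff atlas_open_def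
proof (intro conjI)
  show "{y \<in> W. f y \<noteq> 0} \<subseteq> (\<Union>(D, \<psi>)\<in>A. \<psi> ` D)"
    using hol_openin[OF f] unfolding openin_iff atlas_open_def by blast
  show "\<forall>(D, \<psi>)\<in>A. open {z \<in> D. \<psi> z \<in> {y \<in> W. f y \<noteq> 0}}"
  proof clarify
    fix D \<psi> assume D: "(D, \<psi>) \<in> A"
    have "open ({z \<in> D. \<psi> z \<in> W} \<inter> (f \<circ> \<psi>) -` (- {0}))"
      using holomorphic2_on_continuous[OF hol_chartD[OF f D]] open_vimage[OF hol_openin[OF f] D]
      by (auto intro: continuous_open_preimage)
    then show "open {z \<in> D. \<psi> z \<in> {y \<in> W. f y \<noteq> 0}}" by (simp add: vimage_def Int_def conj_ac)
  qed
qed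

text \<open>
  By compatibility, holomorphy on the image of a patch may be tested in this patch alone.
\<close>

lemma hol_chart:
  assumes D: "(D, \<psi>) \<in> A" and U: "open U" "U \<subseteq> D" and f: "holomorphic2_on (f \<circ> \<psi>) U"
  shows "hol X (\<psi> ` U) f"
  unfolding hol_iff
proof (intro conjI chart_open[OF D U], clarify)
  fix E \<theta> assume E: "(E, \<theta>) \<in> A"
  show "holomorphic2_on (f \<circ> \<theta>) {z \<in> E. \<theta> z \<in> \<psi> ` U}"
  proof (rule holomorphic2_on_local)
    fix z assume "z \<in> {z \<in> E. \<theta> z \<in> \<psi> ` U}"
    then have z: "z \<in> E" "\<theta> z \<in> \<psi> ` U" by auto
    have "trans_at E \<theta> D \<psi> z" using chart_trans[OF E D z(1)] z(2) U by auto
    then obtain V \<tau>1 \<tau>2 where V: "open V" "z \<in> V" "V \<subseteq> E" "holomorphic2_on \<tau>1 V" "holomorphic2_on \<tau>2 V"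
      "\<And>w. w \<in> V \<Longrightarrow> (\<tau>1 w, \<tau>2 w) \<in> D" "\<And>w. w \<in> V \<Longrightarrow> \<psi> (\<tau>1 w, \<tau>2 w) = \<theta> w"
      unfolding trans_at_def by blast
    define V' where "V' = V \<inter> {z \<in> E. \<theta> z \<in> \<psi> ` U}"
    have T: "(\<tau>1 w, \<tau>2 w) \<in> U" if "w \<in> V'" for w
    proof -
      from that obtain u where u: "u \<in> U" "\<theta> w = \<psi> u" "w \<in> V" by (auto simp: V'_def)
      then have "(\<tau>1 w, \<tau>2 w) = u" using chart_inj[OF D] V(6,7) U by (metis inj_onD subsetD)
      then show ?thesis using u by simp
    qed
    have "holomorphic2_on (\<lambda>w. (f \<circ> \<psi>) (\<tau>1 w, \<tau>2 w)) V'"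
      by (rule holomorphic2_on_compose[OF _ _ f T]) (use V(4,5) in \<open>auto simp: V'_def intro: holomorphic2_on_subset\<close>)
    moreover have "open V'"
      unfolding V'_def using V(1) open_vimage[OF chart_open[OF D U] E] by (rule open_Int)
    ultimately show "\<exists>U g. open U \<and> z \<in> U \<and> holomorphic2_on g U \<and> (\<forall>w\<in>U. g w = (f \<circ> \<theta>) w)"
      using V z by (intro exI[of _ V'] exI[of _ "\<lambda>w. (f \<circ> \<psi>) (\<tau>1 w, \<tau>2 w)"]) (auto simp: V'_def)
  qed
qed

lemma hol_chartI:
  assumes D: "(D, \<psi>) \<in> A" and U: "open U" "U \<subseteq> D" and f: "holomorphic2_on f U"
  shows "hol X (\<psi> ` U) (f \<circ> inv_into D \<psi>)"
proof (rule hol_chart[OF D U])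
  have "holomorphic2_on (f \<circ> inv_into D \<psi> \<circ> \<psi>) U \<longleftrightarrow> holomorphic2_on f U"
    by (rule holomorphic2_on_cong[OF U(1)]) (use U chart_inj[OF D] in \<open>auto simp: inv_into_f_f\<close>)
  then show "holomorphic2_on (f \<circ> inv_into D \<psi> \<circ> \<psi>) U" using f by blast
qed

lemma hol_unitD: "hol_unit X W u \<Longrightarrow> hol X W u" "hol_unit X W u \<Longrightarrow> x \<in> W \<Longrightarrow> u x \<noteq> 0"
  by (auto simp: hol_unit_def)

lemma hol_unit_openin: "hol_unit X W f \<Longrightarrow> openin (ctop X) W"
  by (auto simp: hol_unit_def hol_openin)

lemma hol_unit_const: "openin (ctop X) W \<Longrightarrow> c \<noteq> 0 \<Longrightarrow> hol_unit X W (\<lambda>x. c)"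
  by (simp add: hol_unit_def hol_const)

lemma hol_unit_mult: "hol_unit X W f \<Longrightarrow> hol_unit X W g \<Longrightarrow> hol_unit X W (\<lambda>x. f x * g x)"
  by (simp add: hol_unit_def hol_mult)

lemma hol_unit_inverse: "hol_unit X W f \<Longrightarrow> hol_unit X W (\<lambda>x. inverse (f x))"
  by (simp add: hol_unit_def hol_inverse)

lemma hol_unit_divide: "hol_unit X W f \<Longrightarrow> hol_unit X W g \<Longrightarrow> hol_unit X W (\<lambda>x. f x / g x)"
  by (simp add: divide_inverse hol_unit_mult hol_unit_inverse)

lemma hol_unit_powi:
  assumes "hol_unit X W f"
  shows "hol_unit X W (\<lambda>x. f x powi k)"
proof -
  have n: "hol_unit X W (\<lambda>x. f x ^ n)" for n
    by (induction n) (auto intro: hol_unit_const hol_unit_mult assms hol_unit_openin[OF assms])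
  show ?thesis
    using n[of "nat k"] hol_unit_inverse[OF n[of "nat (- k)"]]
    by (cases "k \<ge> 0") (simp_all add: power_int_def power_inverse)
qed

lemma hol_unit_prod:
  assumes "openin (ctop X) W" "\<And>i. i \<in> I \<Longrightarrow> hol_unit X W (f i)"
  shows "hol_unit X W (\<lambda>x. \<Prod>i\<in>I. f i x)"
  using assms(2)
  by (induction I rule: infinite_finite_induct) (auto intro: hol_unit_const hol_unit_mult assms(1))

lemma hol_unit_subset: "hol_unit X W f \<Longrightarrow> openin (ctop X) V \<Longrightarrow> V \<subseteq> W \<Longrightarrow> hol_unit X V f"
  by (auto simp: hol_unit_def intro: hol_subset)

lemma hol_unit_local:
  assumes "\<And>x. x \<in> W \<Longrightarrow> \<exists>V g. x \<in> V \<and> V \<subseteq> W \<and> hol_unit X V g \<and> (\<forall>y\<in>V. g y = f y)"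
  shows "hol_unit X W f"
  unfolding hol_unit_def
proof (intro conjI ballI hol_local)
  show "\<exists>V g. x \<in> V \<and> V \<subseteq> W \<and> hol X V g \<and> (\<forall>y\<in>V. g y = f y)" if "x \<in> W" for x
    using assms[OF that] by (auto simp: hol_unit_def)
  show "f x \<noteq> 0" if "x \<in> W" for x using assms[OF that] by (metis hol_unit_def)
qed

end

section \<open>Functions on a dense open set and their extensions\<close>

text \<open>
  In the application \<open>N\<close> is the complement of the boundary curves. Meromorphic functions and sections
  are holomorphic there, and by density everything may be compared on \<open>N\<close>.
\<close>

locale dense_surface = surface A for A :: "'a atlas2" +
  fixes N :: "'a set"
  assumes N_open: "openin (ctop X) N"
    and N_dense: "\<And>W. openin (ctop X) W \<Longrightarrow> W \<noteq> {} \<Longrightarrow> W \<inter> N \<noteq> {}"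
begin

lemma eq_of_eq_on_dense:
  assumes "hol X W f" "hol X W g" "\<And>y. y \<in> W \<inter> N \<Longrightarrow> f y = g y" "x \<in> W"
  shows "f x = g x"
proof (rule ccontr)
  assume "f x \<noteq> g x"
  have "openin (ctop X) {y \<in> W. f y - g y \<noteq> 0}"
    by (rule openin_nonzero[OF hol_diff]) (use assms in auto)
  from N_dense[OF this] \<open>f x \<noteq> g x\<close> assms show False by auto
qed

lemma dense_closure: "W \<inter> N \<subseteq> M \<Longrightarrow> openin (ctop X) W \<Longrightarrow> W \<subseteq> (ctop X) closure_of M"
proof
  fix x assume M: "W \<inter> N \<subseteq> M" and W: "openin (ctop X) W" and x: "x \<in> W"
  show "x \<in> (ctop X) closure_of M"
    unfolding in_closure_of
  proof (intro conjI allI impI)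
    show "x \<in> topspace (ctop X)" using openin_subset[OF W] x by auto
    fix T assume "x \<in> T \<and> openin (ctop X) T"
    then show "\<exists>y. y \<in> M \<and> y \<in> T" using N_dense[OF openin_Int[OF W, of T]] x M by blast
  qed
qed

lemma interior_of_avoiding_dense: "S \<inter> N = {} \<Longrightarrow> (ctop X) interior_of S = {}"
  using N_dense[OF openin_interior_of, of S] interior_of_subset[of "ctop X" S] by blast

text \<open>
  Two local extensions of \<open>g\<close> agree on the dense set \<open>N\<close> and hence wherever both are defined.
\<close>

lemma glue:
  assumes W: "openin (ctop X) W"
    and loc: "\<And>x. x \<in> W \<Longrightarrow> \<exists>V u. x \<in> V \<and> hol X V u \<and> (\<forall>y\<in>V \<inter> N. u y = g y)"
  shows "\<exists>u. hol X W u \<and> (\<forall>y\<in>W \<inter> N. u y = g y)"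
proof -
  define P where "P x c \<longleftrightarrow> (\<exists>V u. x \<in> V \<and> hol X V u \<and> (\<forall>y\<in>V \<inter> N. u y = g y) \<and> u x = c)" for x c
  define u where "u x = (SOME c. P x c)" for x
  have uniq: "c = c'" if "P x c" "P x c'" for x c c'
  proof -
    obtain V v where V: "x \<in> V" "hol X V v" "\<forall>y\<in>V \<inter> N. v y = g y" "v x = c"
      using \<open>P x c\<close> unfolding P_def by blast
    obtain V' v' where V': "x \<in> V'" "hol X V' v'" "\<forall>y\<in>V' \<inter> N. v' y = g y" "v' x = c'"
      using \<open>P x c'\<close> unfolding P_def by blast
    have op: "openin (ctop X) (V \<inter> V')" using V V' hol_openin by blast
    have "v x = v' x"
      by (rule eq_of_eq_on_dense[of "V \<inter> V'"])
        (use V V' hol_subset[OF V(2) op] hol_subset[OF V'(2) op] in auto)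
    then show ?thesis using V V' by simp
  qed
  have eq: "u x = v x" if "x \<in> V" "hol X V v" "\<forall>y\<in>V \<inter> N. v y = g y" for x V v
  proof -
    have "P x (v x)" using that unfolding P_def by blast
    then show ?thesis unfolding u_def by (metis someI uniq)
  qed
  have "hol X W u"
  proof (rule hol_local)
    fix x assume x: "x \<in> W"
    obtain V v where V: "x \<in> V" "hol X V v" "\<forall>y\<in>V \<inter> N. v y = g y" using loc[OF x] by blast
    have "hol X (V \<inter> W) v" by (rule hol_subset[OF V(2)]) (use hol_openin[OF V(2)] W in auto)
    then show "\<exists>V g. x \<in> V \<and> V \<subseteq> W \<and> hol X V g \<and> (\<forall>y\<in>V. g y = u y)"
      using eq[OF _ V(2,3)] x V(1) by (intro exI[of _ "V \<inter> W"] exI[of _ v]) auto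
  qed
  moreover have "u y = g y" if y: "y \<in> W \<inter> N" for y
  proof -
    obtain V v where V: "y \<in> V" "hol X V v" "\<forall>y\<in>V \<inter> N. v y = g y" using loc y by blast
    then show ?thesis using eq[OF V] y by simp
  qed
  ultimately show ?thesis by blast
qed

text \<open>The values of \<open>g\<close> off \<open>N\<close> are irrelevant, and by density the extension is unique.\<close>

definition unit_ext :: "('a \<Rightarrow> complex) \<Rightarrow> 'a \<Rightarrow> bool" where
  "unit_ext g x \<longleftrightarrow> (\<exists>V u. x \<in> V \<and> hol_unit X V u \<and> (\<forall>y\<in>V \<inter> N. u y = g y))"

lemma unit_glue:
  assumes W: "openin (ctop X) W" and loc: "\<And>x. x \<in> W \<Longrightarrow> unit_ext g x"
  shows "\<exists>u. hol_unit X W u \<and> (\<forall>y\<in>W \<inter> N. u y = g y)"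
proof -
  obtain u where u: "hol X W u" "\<forall>y\<in>W \<inter> N. u y = g y"
    using glue[OF W, of g] loc unfolding unit_ext_def hol_unit_def by blast
  have "u x \<noteq> 0" if x: "x \<in> W" for x
  proof -
    obtain V v where V: "x \<in> V" "hol_unit X V v" "\<forall>y\<in>V \<inter> N. v y = g y"
      using loc[OF x] unfolding unit_ext_def by blast
    have op: "openin (ctop X) (V \<inter> W)" using hol_unit_openin[OF V(2)] W by blast
    have "u x = v x"
      by (rule eq_of_eq_on_dense[of "V \<inter> W"])
        (use hol_subset[OF u(1) op] hol_subset[OF hol_unitD(1)[OF V(2)] op] u V x in auto)
    then show ?thesis using V by (auto simp: hol_unit_def)
  qed
  then show ?thesis using u by (auto simp: hol_unit_def)
qed

lemma unit_extI: "hol_unit X V u \<Longrightarrow> x \<in> V \<Longrightarrow> (\<And>y. y \<in> V \<inter> N \<Longrightarrow> u y = g y) \<Longrightarrow> unit_ext g x"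
  unfolding unit_ext_def by blast

lemma unit_ext_mult:
  assumes "unit_ext f x" "unit_ext g x"
  shows "unit_ext (\<lambda>y. f y * g y) x"
proof -
  obtain V u where V: "x \<in> V" "hol_unit X V u" "\<forall>y\<in>V \<inter> N. u y = f y"
    using assms unfolding unit_ext_def by blast
  obtain V' u' where V': "x \<in> V'" "hol_unit X V' u'" "\<forall>y\<in>V' \<inter> N. u' y = g y"
    using assms unfolding unit_ext_def by blast
  have op: "openin (ctop X) (V \<inter> V')" using V V' hol_unit_openin by blast
  show ?thesis
    by (rule unit_extI[OF hol_unit_mult[OF hol_unit_subset[OF V(2) op] hol_unit_subset[OF V'(2) op]]])
      (use V V' in auto)
qed

lemma unit_ext_inverse: "unit_ext f x \<Longrightarrow> unit_ext (\<lambda>y. inverse (f y)) x"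
  unfolding unit_ext_def using hol_unit_inverse by (metis (no_types, lifting))

lemma unit_ext_divide: "unit_ext f x \<Longrightarrow> unit_ext g x \<Longrightarrow> unit_ext (\<lambda>y. f y / g y) x"
  unfolding divide_inverse by (intro unit_ext_mult unit_ext_inverse)

lemma unit_ext_cong:
  assumes "unit_ext f x" "openin (ctop X) V" "x \<in> V" "\<And>y. y \<in> V \<inter> N \<Longrightarrow> f y = g y"
  shows "unit_ext g x"
proof -
  obtain V' u where V': "x \<in> V'" "hol_unit X V' u" "\<forall>y\<in>V' \<inter> N. u y = f y"
    using assms unfolding unit_ext_def by blast
  have "openin (ctop X) (V' \<inter> V)" using V' assms hol_unit_openin by blast
  from unit_extI[OF hol_unit_subset[OF V'(2) this]] show ?thesis using V' assms by auto
qed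

text \<open>
  Hartogs' theorem applies to the extension on the punctured neighbourhood and to its inverse; the
  product of the two extensions is \<open>1\<close> by continuity. The value of \<open>g\<close> at \<open>x\<close> has to be free,
  hence \<open>x \<notin> N\<close>.
\<close>

lemma unit_ext_off_point:
  assumes W: "openin (ctop X) W" "x \<in> W" and xN: "x \<notin> N" and loc: "\<And>y. y \<in> W - {x} \<Longrightarrow> unit_ext g y"
  shows "unit_ext g x"
proof -
  have W': "openin (ctop X) (W - {x})" using openin_finite_diff[OF W(1)] by simp
  obtain u where u: "hol_unit X (W - {x}) u" "\<And>y. y \<in> (W - {x}) \<inter> N \<Longrightarrow> u y = g y"
    using unit_glue[OF W' loc] by blast
  obtain D \<psi> z where D: "(D, \<psi>) \<in> A" "z \<in> D" "\<psi> z = x" using chart_at openin_subset W by blast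
  define U where "U = {z \<in> D. \<psi> z \<in> W}"
  have U: "open U" "U \<subseteq> D" "z \<in> U" using open_vimage[OF W(1) D(1)] W D by (auto simp: U_def)
  have ne: "\<psi> w \<noteq> x" if "w \<in> U - {z}" for w using that chart_inj[OF D(1)] D U by (metis Diff_iff inj_onD singletonI subsetD)
  have U': "{z \<in> D. \<psi> z \<in> W - {x}} = U - {z}" using D ne by (auto simp: U_def)
  have h: "holomorphic2_on (u \<circ> \<psi>) (U - {z})" "holomorphic2_on ((\<lambda>y. inverse (u y)) \<circ> \<psi>) (U - {z})"
    using hol_chartD[OF hol_unitD(1)[OF u(1)] D(1)] hol_chartD[OF hol_unitD(1)[OF hol_unit_inverse[OF u(1)]] D(1)]
    unfolding U' by auto
  obtain F where F: "holomorphic2_on F U" "\<forall>w\<in>U - {z}. F w = (u \<circ> \<psi>) w"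
    using hartogs_removable_point[OF U(1,3) h(1)] by blast
  obtain G where G: "holomorphic2_on G U" "\<forall>w\<in>U - {z}. G w = ((\<lambda>y. inverse (u y)) \<circ> \<psi>) w"
    using hartogs_removable_point[OF U(1,3) h(2)] by blast
  have u0: "u (\<psi> w) \<noteq> 0" if "w \<in> U - {z}" for w
    using hol_unitD(2)[OF u(1), of "\<psi> w"] ne[OF that] that by (auto simp: U_def)
  have "continuous_on U (\<lambda>w. F w * G w)"
    by (intro continuous_intros holomorphic2_on_continuous F G)
  then have "isCont (\<lambda>w. F w * G w) z" using U by (simp add: continuous_on_eq_continuous_at)
  then have 1: "((\<lambda>w. F w * G w) \<longlongrightarrow> F z * G z) (at z)" by (simp add: isCont_def)
  have "\<forall>\<^sub>F w in at z. w \<in> U \<and> w \<noteq> z" using eventually_at_in_open[of U z] U by simp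
  then have "\<forall>\<^sub>F w in at z. 1 = F w * G w"
    by eventually_elim (use F(2) G(2) u0 in auto)
  then have 2: "((\<lambda>w. F w * G w) \<longlongrightarrow> 1) (at z)" by (rule Lim_transform_eventually[OF tendsto_const])
  from tendsto_unique[OF trivial_limit_at 1 2] have Fz: "F z \<noteq> 0" by auto
  have F0: "F w \<noteq> 0" if "w \<in> U" for w using Fz F(2) u0 that by (cases "w = z") auto
  have inv: "inv_into D \<psi> (\<psi> w) = w" if "w \<in> U" for w
    using that U chart_inj[OF D(1)] by (auto simp: inv_into_f_f)
  have "hol_unit X (\<psi> ` U) (F \<circ> inv_into D \<psi>)"
    unfolding hol_unit_def using hol_chartI[OF D(1) U(1,2) F(1)] F0 inv by auto
  then show ?thesis
  proof (rule unit_extI)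
    show "x \<in> \<psi> ` U" using U D by auto
    show "(F \<circ> inv_into D \<psi>) y = g y" if y: "y \<in> \<psi> ` U \<inter> N" for y
    proof -
      obtain w where w: "w \<in> U" "y = \<psi> w" using y by blast
      then have wz: "w \<in> U - {z}" using xN y D(3) by blast
      have "u y = g y" by (rule u(2)) (use wz ne[OF wz] w y in \<open>auto simp: U_def\<close>)
      then show ?thesis using F(2) wz w(2) inv[OF w(1)] by simp
    qed
  qed
qed

lemma unit_ext_off_finite:
  assumes W: "openin (ctop X) W" and S: "finite S" "S \<inter> N = {}"
    and loc: "\<And>y. y \<in> W - S \<Longrightarrow> unit_ext g y" and x: "x \<in> W"
  shows "unit_ext g x"
proof (cases "x \<in> S")
  case True
  show ?thesis
  proof (rule unit_ext_off_point)
    show "openin (ctop X) (W - (S - {x}))" using openin_finite_diff[OF W] S by simp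
  qed (use x loc True S in auto)
qed (use x loc in auto)

end

section \<open>Line bundles and their fibre coordinates\<close>

lemma is_line_bundleD:
  assumes "is_line_bundle Y L"
  shows "\<And>e. e \<in> total_space L \<Longrightarrow> proj L e \<in> topspace (ctop Y)"
    and "\<And>x. x \<in> topspace (ctop Y) \<Longrightarrow> \<exists>U \<phi>. (U, \<phi>) \<in> coords L \<and> x \<in> U"
    and "\<And>U \<phi>. (U, \<phi>) \<in> coords L \<Longrightarrow> openin (ctop Y) U"
    and "\<And>U \<phi> x. (U, \<phi>) \<in> coords L \<Longrightarrow> x \<in> U \<Longrightarrow> bij_betw \<phi> {e \<in> total_space L. proj L e = x} UNIV"
    and "\<And>U \<phi> V \<eta>. (U, \<phi>) \<in> coords L \<Longrightarrow> (V, \<eta>) \<in> coords L \<Longrightarrow>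
      \<exists>g. hol_unit Y (U \<inter> V) g \<and>
            (\<forall>e\<in>total_space L. proj L e \<in> U \<inter> V \<longrightarrow> \<eta> e = g (proj L e) * \<phi> e)"
proof -
  note * = assms[unfolded is_line_bundle_def]
  show "proj L e \<in> topspace (ctop Y)" if "e \<in> total_space L" for e
    using *[THEN conjunct1] that by blast
  show "\<exists>U \<phi>. (U, \<phi>) \<in> coords L \<and> x \<in> U" if "x \<in> topspace (ctop Y)" for x
    using *[THEN conjunct2, THEN conjunct1] that by force
  note 3 = bspec[OF *[THEN conjunct2, THEN conjunct2, THEN conjunct1]]
  note 4 = bspec[OF *[THEN conjunct2, THEN conjunct2, THEN conjunct2]]
  show "openin (ctop Y) U" if "(U, \<phi>) \<in> coords L" for U \<phi>
    using 3[OF that] by simp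
  show "bij_betw \<phi> {e \<in> total_space L. proj L e = x} UNIV" if "(U, \<phi>) \<in> coords L" "x \<in> U" for U \<phi> x
    using 3[OF that(1)] that(2) by simp
  show "\<exists>g. hol_unit Y (U \<inter> V) g \<and> (\<forall>e\<in>total_space L. proj L e \<in> U \<inter> V \<longrightarrow> \<eta> e = g (proj L e) * \<phi> e)"
    if "(U, \<phi>) \<in> coords L" "(V, \<eta>) \<in> coords L" for U \<phi> V \<eta>
    using bspec[OF 4[OF that(1), unfolded prod.case] that(2)] by simp
qed

lemma is_line_bundleI:
  assumes "\<And>e. e \<in> total_space L \<Longrightarrow> proj L e \<in> topspace (ctop Y)"
    and "\<And>x. x \<in> topspace (ctop Y) \<Longrightarrow> \<exists>U \<phi>. (U, \<phi>) \<in> coords L \<and> x \<in> U"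
    and "\<And>U \<phi>. (U, \<phi>) \<in> coords L \<Longrightarrow> openin (ctop Y) U"
    and "\<And>U \<phi> x. (U, \<phi>) \<in> coords L \<Longrightarrow> x \<in> U \<Longrightarrow> bij_betw \<phi> {e \<in> total_space L. proj L e = x} UNIV"
    and "\<And>U \<phi> V \<eta>. (U, \<phi>) \<in> coords L \<Longrightarrow> (V, \<eta>) \<in> coords L \<Longrightarrow>
      \<exists>g. hol_unit Y (U \<inter> V) g \<and>
            (\<forall>e\<in>total_space L. proj L e \<in> U \<inter> V \<longrightarrow> \<eta> e = g (proj L e) * \<phi> e)"
  shows "is_line_bundle Y L"
  unfolding is_line_bundle_def
proof (intro conjI)
  show "topspace (ctop Y) \<subseteq> \<Union> (fst ` coords L)" using assms(2) by fastforce
  show "proj L ` total_space L \<subseteq> topspace (ctop Y)" using assms(1) by blast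
  show "\<forall>(U, \<phi>)\<in>coords L. openin (ctop Y) U \<and> (\<forall>x\<in>U. bij_betw \<phi> {e \<in> total_space L. proj L e = x} UNIV)"
    by (clarify, intro conjI ballI; rule assms(3) assms(4))
  show "\<forall>(U, \<phi>)\<in>coords L. \<forall>(V, \<eta>)\<in>coords L. \<exists>g. hol_unit Y (U \<inter> V) g \<and>
            (\<forall>e\<in>total_space L. proj L e \<in> U \<inter> V \<longrightarrow> \<eta> e = g (proj L e) * \<phi> e)"
    by (intro ballI, clarify, rule assms(5))
qed

lemma fibre_coordD:
  "fibre_coord Y L W \<phi> \<Longrightarrow> openin (ctop Y) W"
  "fibre_coord Y L W \<phi> \<Longrightarrow> (V, \<eta>) \<in> coords L \<Longrightarrow>
    \<exists>g. hol_unit Y (W \<inter> V) g \<and>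
            (\<forall>e\<in>total_space L. proj L e \<in> W \<inter> V \<longrightarrow> \<phi> e = g (proj L e) * \<eta> e)"
  unfolding fibre_coord_def by (simp, drule conjunct2, drule (1) bspec, simp)

lemma fibre_coordI:
  assumes "openin (ctop Y) W"
    "\<And>V \<eta>. (V, \<eta>) \<in> coords L \<Longrightarrow>
    \<exists>g. hol_unit Y (W \<inter> V) g \<and>
            (\<forall>e\<in>total_space L. proj L e \<in> W \<inter> V \<longrightarrow> \<phi> e = g (proj L e) * \<eta> e)"
  shows "fibre_coord Y L W \<phi>"
  unfolding fibre_coord_def by (rule conjI[OF assms(1)], clarify, rule assms(2))

lemma bij_betw_times_complex: "c \<noteq> (0::complex) \<Longrightarrow> bij ((*) c)"
  by (rule o_bij[of "\<lambda>y. y / c"]) (auto simp: fun_eq_iff)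

context surface
begin

lemma fibre_coord_of_coords:
  assumes L: "is_line_bundle X L" and U: "(U, \<phi>) \<in> coords L"
  shows "fibre_coord X L U \<phi>"
proof (rule fibre_coordI)
  show "openin (ctop X) U" by (rule is_line_bundleD(3)[OF L U])
  fix V \<eta> assume V: "(V, \<eta>) \<in> coords L"
  show "\<exists>g. hol_unit X (U \<inter> V) g \<and> (\<forall>e\<in>total_space L. proj L e \<in> U \<inter> V \<longrightarrow> \<phi> e = g (proj L e) * \<eta> e)"
    using is_line_bundleD(5)[OF L V U] by (simp add: Int_commute)
qed

lemma fibre_coord_bij:
  assumes L: "is_line_bundle X L" and W: "fibre_coord X L W \<phi>" and x: "x \<in> W"
  shows "bij_betw \<phi> {e \<in> total_space L. proj L e = x} UNIV"
proof -
  have "x \<in> topspace (ctop X)" using openin_subset[OF fibre_coordD(1)[OF W]] x by auto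
  from is_line_bundleD(2)[OF L this] obtain U \<eta> where U: "(U, \<eta>) \<in> coords L" "x \<in> U" by blast
  from fibre_coordD(2)[OF W U(1)] obtain g where g: "hol_unit X (W \<inter> U) g"
    "\<forall>e\<in>total_space L. proj L e \<in> W \<inter> U \<longrightarrow> \<phi> e = g (proj L e) * \<eta> e" by blast
  have "g x \<noteq> 0" using hol_unitD(2)[OF g(1)] x U by blast
  from bij_betw_trans[OF is_line_bundleD(4)[OF L U] bij_betw_times_complex[OF this]]
  have "bij_betw ((*) (g x) \<circ> \<eta>) {e \<in> total_space L. proj L e = x} UNIV" .
  moreover have "((*) (g x) \<circ> \<eta>) e = \<phi> e" if "e \<in> {e \<in> total_space L. proj L e = x}" for e
    using g(2) that x U by auto
  ultimately show ?thesis using bij_betw_cong by blast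
qed

lemma fibre_coord_surj:
  assumes "is_line_bundle X L" "fibre_coord X L W \<phi>" "x \<in> W"
  obtains e where "e \<in> total_space L" "proj L e = x" "\<phi> e = c"
  using fibre_coord_bij[OF assms] unfolding bij_betw_def by (metis (mono_tags, lifting) UNIV_I imageE mem_Collect_eq)

lemma fibre_coord_inj:
  assumes "is_line_bundle X L" "fibre_coord X L W \<phi>" "proj L e \<in> W"
    "e \<in> total_space L" "e' \<in> total_space L" "proj L e' = proj L e" "\<phi> e = \<phi> e'"
  shows "e = e'"
  using fibre_coord_bij[OF assms(1-3)] assms(4-7) unfolding bij_betw_def inj_on_def by blast

lemma fibre_coord_subset:
  assumes W: "fibre_coord X L W \<phi>" and V: "openin (ctop X) V" "V \<subseteq> W"
  shows "fibre_coord X L V \<phi>"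
proof (rule fibre_coordI[OF V(1)])
  fix U \<eta> assume U: "(U, \<eta>) \<in> coords L"
  from fibre_coordD(2)[OF W U] obtain g where g: "hol_unit X (W \<inter> U) g"
    "\<forall>e\<in>total_space L. proj L e \<in> W \<inter> U \<longrightarrow> \<phi> e = g (proj L e) * \<eta> e" by blast
  have "openin (ctop X) (V \<inter> (W \<inter> U))" using V(1) hol_unit_openin[OF g(1)] by blast
  moreover have "V \<inter> (W \<inter> U) = V \<inter> U" using V by blast
  ultimately have "hol_unit X (V \<inter> U) g" using hol_unit_subset[OF g(1), of "V \<inter> U"] V by auto
  then show "\<exists>g. hol_unit X (V \<inter> U) g \<and> (\<forall>e\<in>total_space L. proj L e \<in> V \<inter> U \<longrightarrow> \<phi> e = g (proj L e) * \<eta> e)"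
    using g(2) V by blast
qed

lemma fibre_coord_scale:
  assumes W: "fibre_coord X L W \<phi>" and u: "hol_unit X W u"
  shows "fibre_coord X L W (\<lambda>e. u (proj L e) * \<phi> e)"
proof (rule fibre_coordI[OF fibre_coordD(1)[OF W]])
  fix U \<eta> assume U: "(U, \<eta>) \<in> coords L"
  from fibre_coordD(2)[OF W U] obtain g where g: "hol_unit X (W \<inter> U) g"
    "\<forall>e\<in>total_space L. proj L e \<in> W \<inter> U \<longrightarrow> \<phi> e = g (proj L e) * \<eta> e" by blast
  have "hol_unit X (W \<inter> U) u" by (rule hol_unit_subset[OF u hol_unit_openin[OF g(1)]]) blast
  from hol_unit_mult[OF this g(1)]
  show "\<exists>g. hol_unit X (W \<inter> U) g \<and> (\<forall>e\<in>total_space L. proj L e \<in> W \<inter> U \<longrightarrow> u (proj L e) * \<phi> e = g (proj L e) * \<eta> e)"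
    using g(2) by (intro exI[of _ "\<lambda>x. u x * g x"]) (auto simp: mult.assoc)
qed

text \<open>
  The transition function to a coordinate \<open>\<eta>\<close> is the value of \<open>\<phi>\<close> at the vector with \<open>\<eta> = 1\<close>; near each
  point it is the transition function of the local model \<open>\<phi>'\<close>.
\<close>

lemma fibre_coord_local:
  assumes L: "is_line_bundle X L"
    and W: "openin (ctop X) W"
    and loc: "\<And>x. x \<in> W \<Longrightarrow> \<exists>V \<phi>'. x \<in> V \<and> fibre_coord X L V \<phi>' \<and>
      (\<forall>e\<in>total_space L. proj L e \<in> V \<inter> W \<longrightarrow> \<phi> e = \<phi>' e)"
  shows "fibre_coord X L W \<phi>"
proof (rule fibre_coordI[OF W])
  fix U \<eta> assume U: "(U, \<eta>) \<in> coords L"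
  note fU = fibre_coord_of_coords[OF L U]
  have "\<forall>x\<in>U. \<exists>e. e \<in> total_space L \<and> proj L e = x \<and> \<eta> e = 1"
  proof
    fix x assume "x \<in> U"
    from fibre_coord_surj[OF L fU this, of 1] show "\<exists>e. e \<in> total_space L \<and> proj L e = x \<and> \<eta> e = 1" by blast
  qed
  then obtain f where f: "\<And>x. x \<in> U \<Longrightarrow> f x \<in> total_space L" "\<And>x. x \<in> U \<Longrightarrow> proj L (f x) = x"
    "\<And>x. x \<in> U \<Longrightarrow> \<eta> (f x) = 1" by metis
  have "hol_unit X (W \<inter> U) (\<lambda>x. \<phi> (f x)) \<and>
    (\<forall>e\<in>total_space L. proj L e \<in> W \<inter> U \<longrightarrow> \<phi> e = \<phi> (f (proj L e)) * \<eta> e)"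
  proof (intro conjI hol_unit_local ballI impI)
    fix x assume x: "x \<in> W \<inter> U"
    then obtain V \<phi>' where V: "x \<in> V" "fibre_coord X L V \<phi>'"
      "\<forall>e\<in>total_space L. proj L e \<in> V \<inter> W \<longrightarrow> \<phi> e = \<phi>' e" using loc by blast
    from fibre_coordD(2)[OF V(2) U] obtain g where g: "hol_unit X (V \<inter> U) g"
    "\<forall>e\<in>total_space L. proj L e \<in> V \<inter> U \<longrightarrow> \<phi>' e = g (proj L e) * \<eta> e" by blast
    have "openin (ctop X) (V \<inter> U \<inter> W)" using hol_unit_openin[OF g(1)] W by blast
    from hol_unit_subset[OF g(1) this] have "hol_unit X (V \<inter> U \<inter> W) g" by blast
    moreover have "g y = \<phi> (f y)" if "y \<in> V \<inter> U \<inter> W" for y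
    proof -
      have "\<phi> (f y) = \<phi>' (f y)" using V(3) f that by auto
      also have "\<dots> = g y * 1" using g(2) f that by auto
      finally show ?thesis by simp
    qed
    ultimately show "\<exists>V g. x \<in> V \<and> V \<subseteq> W \<inter> U \<and> hol_unit X V g \<and> (\<forall>y\<in>V. g y = \<phi> (f y))"
      using x V(1) by (intro exI[of _ "V \<inter> U \<inter> W"] exI[of _ g]) blast
  next
    fix e assume e: "e \<in> total_space L" "proj L e \<in> W \<inter> U"
    then obtain V \<phi>' where V: "proj L e \<in> V" "fibre_coord X L V \<phi>'"
      "\<forall>e\<in>total_space L. proj L e \<in> V \<inter> W \<longrightarrow> \<phi> e = \<phi>' e" using loc by blast
    from fibre_coordD(2)[OF V(2) U] obtain g where g: "hol_unit X (V \<inter> U) g"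
    "\<forall>e\<in>total_space L. proj L e \<in> V \<inter> U \<longrightarrow> \<phi>' e = g (proj L e) * \<eta> e" by blast
    have "\<phi> e = g (proj L e) * \<eta> e" using V g e by auto
    moreover have "\<phi> (f (proj L e)) = g (proj L e)" using V g e f by auto
    ultimately show "\<phi> e = \<phi> (f (proj L e)) * \<eta> e" by simp
  qed
  then show "\<exists>g. hol_unit X (W \<inter> U) g \<and> (\<forall>e\<in>total_space L. proj L e \<in> W \<inter> U \<longrightarrow> \<phi> e = g (proj L e) * \<eta> e)"
    by blast
qed

text \<open>
  Locally both coordinates are compared with one member of \<open>coords L\<close>; the quotients fit together,
  because they are determined by the fibres.
\<close>

lemma fibre_coord_ratio:
  assumes L: "is_line_bundle X L" and W: "fibre_coord X L W \<phi>" and W': "fibre_coord X L W' \<phi>'"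
  shows "\<exists>g. hol_unit X (W \<inter> W') g \<and> (\<forall>e\<in>total_space L. proj L e \<in> W \<inter> W' \<longrightarrow> \<phi>' e = g (proj L e) * \<phi> e)"
proof -
  have "\<forall>x\<in>W. \<exists>e. e \<in> total_space L \<and> proj L e = x \<and> \<phi> e = 1"
  proof
    fix x assume "x \<in> W"
    from fibre_coord_surj[OF L W this, of 1] show "\<exists>e. e \<in> total_space L \<and> proj L e = x \<and> \<phi> e = 1" by blast
  qed
  then obtain f where f: "\<And>x. x \<in> W \<Longrightarrow> f x \<in> total_space L" "\<And>x. x \<in> W \<Longrightarrow> proj L (f x) = x"
    "\<And>x. x \<in> W \<Longrightarrow> \<phi> (f x) = 1" by metis
  have loc: "\<exists>V g. x \<in> V \<and> V \<subseteq> W \<inter> W' \<and> hol_unit X V g \<and>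
      (\<forall>e\<in>total_space L. proj L e \<in> V \<longrightarrow> \<phi>' e = g (proj L e) * \<phi> e)" if x: "x \<in> W \<inter> W'" for x
  proof -
    have "x \<in> topspace (ctop X)" using openin_subset[OF fibre_coordD(1)[OF W]] x by auto
    from is_line_bundleD(2)[OF L this] obtain U \<eta> where U: "(U, \<eta>) \<in> coords L" "x \<in> U" by blast
    from fibre_coordD(2)[OF W U(1)] obtain g where g: "hol_unit X (W \<inter> U) g"
      "\<forall>e\<in>total_space L. proj L e \<in> W \<inter> U \<longrightarrow> \<phi> e = g (proj L e) * \<eta> e" by blast
    from fibre_coordD(2)[OF W' U(1)] obtain g' where g': "hol_unit X (W' \<inter> U) g'"
      "\<forall>e\<in>total_space L. proj L e \<in> W' \<inter> U \<longrightarrow> \<phi>' e = g' (proj L e) * \<eta> e" by blast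
    let ?V = "(W \<inter> U) \<inter> (W' \<inter> U)"
    have op: "openin (ctop X) ?V" using hol_unit_openin[OF g(1)] hol_unit_openin[OF g'(1)] by blast
    have "hol_unit X ?V (\<lambda>x. g' x / g x)"
      by (rule hol_unit_divide[OF hol_unit_subset[OF g'(1) op] hol_unit_subset[OF g(1) op]]) blast+
    moreover have "\<phi>' e = g' (proj L e) / g (proj L e) * \<phi> e" if "e \<in> total_space L" "proj L e \<in> ?V" for e
      using g(2) g'(2) that hol_unitD(2)[OF g(1), of "proj L e"] by auto
    ultimately show ?thesis
      using x U by (intro exI[of _ ?V] exI[of _ "\<lambda>x. g' x / g x"]) blast
  qed
  have "hol_unit X (W \<inter> W') (\<lambda>x. \<phi>' (f x))"
  proof (rule hol_unit_local)
    fix x assume "x \<in> W \<inter> W'"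
    from loc[OF this] obtain V g where V: "x \<in> V" "V \<subseteq> W \<inter> W'" "hol_unit X V g"
      "\<forall>e\<in>total_space L. proj L e \<in> V \<longrightarrow> \<phi>' e = g (proj L e) * \<phi> e" by blast
    moreover have "g y = \<phi>' (f y)" if "y \<in> V" for y using V(2,4) f[of y] that by auto
    ultimately show "\<exists>V g. x \<in> V \<and> V \<subseteq> W \<inter> W' \<and> hol_unit X V g \<and> (\<forall>y\<in>V. g y = \<phi>' (f y))" by blast
  qed
  moreover have "\<phi>' e = \<phi>' (f (proj L e)) * \<phi> e" if e: "e \<in> total_space L" "proj L e \<in> W \<inter> W'" for e
  proof -
    from loc[OF e(2)] obtain V g where V: "proj L e \<in> V" "V \<subseteq> W \<inter> W'" "hol_unit X V g"
      "\<forall>e\<in>total_space L. proj L e \<in> V \<longrightarrow> \<phi>' e = g (proj L e) * \<phi> e" by blast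
    have "\<phi>' (f (proj L e)) = g (proj L e)" using V(1,2,4) f[of "proj L e"] e by auto
    then show ?thesis using V e by auto
  qed
  ultimately show ?thesis by blast
qed

lemma trivial_bundle_simps:
  "total_space (trivial_bundle Y) = topspace (ctop Y) \<times> UNIV" "proj (trivial_bundle Y) = fst"
  "coords (trivial_bundle Y) = {(topspace (ctop Y), snd)}"
  by (simp_all add: trivial_bundle_def)

lemma trivial_fibre_coord:
  assumes W: "fibre_coord X (trivial_bundle X) W \<phi>"
  shows "\<exists>g. hol_unit X W g \<and> (\<forall>x\<in>W. \<forall>c. \<phi> (x, c) = g x * c)"
proof -
  have "(topspace (ctop X), snd) \<in> coords (trivial_bundle X)" by (simp add: trivial_bundle_simps)
  from fibre_coordD(2)[OF W this] obtain g where g: "hol_unit X (W \<inter> topspace (ctop X)) g"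
    "\<forall>e\<in>total_space (trivial_bundle X). proj (trivial_bundle X) e \<in> W \<inter> topspace (ctop X) \<longrightarrow>
       \<phi> e = g (proj (trivial_bundle X) e) * snd e" by blast
  have "W \<inter> topspace (ctop X) = W" using openin_subset[OF fibre_coordD(1)[OF W]] by blast
  then show ?thesis using g by (intro exI[of _ g]) (auto simp: trivial_bundle_simps)
qed

lemma trivial_fibre_coord_snd:
  assumes "openin (ctop X) W"
  shows "fibre_coord X (trivial_bundle X) W snd"
proof (rule fibre_coordI[OF assms])
  fix V \<eta> assume "(V, \<eta>) \<in> coords (trivial_bundle X)"
  then have V: "V = topspace (ctop X)" "\<eta> = snd" by (auto simp: trivial_bundle_simps)
  have "openin (ctop X) (W \<inter> V)" unfolding V by (rule openin_Int[OF assms openin_topspace])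
  from hol_unit_const[OF this, of 1]
  show "\<exists>g. hol_unit X (W \<inter> V) g \<and> (\<forall>e\<in>total_space (trivial_bundle X).
     proj (trivial_bundle X) e \<in> W \<inter> V \<longrightarrow> snd e = g (proj (trivial_bundle X) e) * \<eta> e)"
    using V by (intro exI[of _ "\<lambda>x. 1"]) auto
qed

subsection \<open>Restriction to subsets\<close>

lemma topspace_crestrict: "topspace (ctop (crestrict Y C)) = topspace (ctop Y) \<inter> C"
  by (simp add: crestrict_def)

lemma hol_crestrict:
  assumes "hol X W f"
  shows "hol (crestrict X C) (W \<inter> C) f"
  using assms hol_openin[OF assms] by (auto simp: crestrict_def openin_subtopology)

lemma hol_unit_crestrict: "hol_unit X W f \<Longrightarrow> hol_unit (crestrict X C) (W \<inter> C) f"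
  by (simp add: hol_unit_def hol_crestrict)

lemma hol_of_crestrict_open:
  assumes C: "openin (ctop X) C" and f: "hol (crestrict X C) V f"
  shows "hol X V f"
proof (rule hol_local)
  fix x assume x: "x \<in> V"
  have V: "V \<subseteq> C" using f by (auto simp: crestrict_def openin_subtopology)
  obtain W F where W: "x \<in> W" "hol X W F" "W \<inter> C \<subseteq> V" "\<forall>y\<in>W \<inter> C. F y = f y"
    using f x by (auto simp: crestrict_def)
  have "openin (ctop X) (W \<inter> C)" using hol_openin[OF W(2)] C by blast
  from hol_subset[OF W(2) this] show "\<exists>V' g. x \<in> V' \<and> V' \<subseteq> V \<and> hol X V' g \<and> (\<forall>y\<in>V'. g y = f y)"
    using W x V by (intro exI[of _ "W \<inter> C"] exI[of _ F]) auto
qed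

lemma bundle_restrict_simps:
  "total_space (bundle_restrict L C) = {e \<in> total_space L. proj L e \<in> C}"
  "proj (bundle_restrict L C) = proj L"
  "coords (bundle_restrict L C) = (\<lambda>(U, \<phi>). (U \<inter> C, \<phi>)) ` coords L"
  by (simp_all add: bundle_restrict_def)

lemma is_line_bundle_restrict:
  assumes L: "is_line_bundle X L"
  shows "is_line_bundle (crestrict X C) (bundle_restrict L C)"
proof (rule is_line_bundleI)
  show "proj (bundle_restrict L C) e \<in> topspace (ctop (crestrict X C))" if "e \<in> total_space (bundle_restrict L C)" for e
    using is_line_bundleD(1)[OF L] that by (auto simp: bundle_restrict_simps topspace_crestrict)
  show "\<exists>U \<phi>. (U, \<phi>) \<in> coords (bundle_restrict L C) \<and> x \<in> U" if "x \<in> topspace (ctop (crestrict X C))" for x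
    using is_line_bundleD(2)[OF L] that by (force simp: bundle_restrict_simps topspace_crestrict)
  show "openin (ctop (crestrict X C)) U" if "(U, \<phi>) \<in> coords (bundle_restrict L C)" for U \<phi>
    using is_line_bundleD(3)[OF L] that by (auto simp: bundle_restrict_simps crestrict_def openin_subtopology)
  show "bij_betw \<phi> {e \<in> total_space (bundle_restrict L C). proj (bundle_restrict L C) e = x} UNIV"
    if U: "(U, \<phi>) \<in> coords (bundle_restrict L C)" "x \<in> U" for U \<phi> x
  proof -
    obtain U' where "(U', \<phi>) \<in> coords L" "U = U' \<inter> C" using U by (auto simp: bundle_restrict_simps)
    moreover have "{e \<in> total_space (bundle_restrict L C). proj (bundle_restrict L C) e = x} =
        {e \<in> total_space L. proj L e = x}" using U calculation by (auto simp: bundle_restrict_simps)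
    ultimately show ?thesis using is_line_bundleD(4)[OF L] U by simp
  qed
  show "\<exists>g. hol_unit (crestrict X C) (U \<inter> V) g \<and> (\<forall>e\<in>total_space (bundle_restrict L C).
      proj (bundle_restrict L C) e \<in> U \<inter> V \<longrightarrow> \<eta> e = g (proj (bundle_restrict L C) e) * \<phi> e)"
    if UV': "(U, \<phi>) \<in> coords (bundle_restrict L C)" "(V, \<eta>) \<in> coords (bundle_restrict L C)" for U \<phi> V \<eta>
  proof -
    obtain U' where U: "(U', \<phi>) \<in> coords L" "U = U' \<inter> C" using UV'(1) by (auto simp: bundle_restrict_simps)
    obtain V' where V: "(V', \<eta>) \<in> coords L" "V = V' \<inter> C" using UV'(2) by (auto simp: bundle_restrict_simps)
    note UV = U V
    from is_line_bundleD(5)[OF L UV(1,3)] obtain g where g: "hol_unit X (U' \<inter> V') g"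
      "\<forall>e\<in>total_space L. proj L e \<in> U' \<inter> V' \<longrightarrow> \<eta> e = g (proj L e) * \<phi> e" by blast
    have "U \<inter> V = (U' \<inter> V') \<inter> C" using UV by blast
    then show ?thesis using hol_unit_crestrict[OF g(1), of C] g(2)
      by (intro exI[of _ g]) (auto simp: bundle_restrict_simps)
  qed
qed

lemma is_line_bundle_trivial_restrict: "is_line_bundle (crestrict X C) (trivial_bundle (crestrict X C))"
proof (rule is_line_bundleI)
  let ?Y = "crestrict X C"
  show "\<exists>g. hol_unit ?Y (U \<inter> V) g \<and> (\<forall>e\<in>total_space (trivial_bundle ?Y).
      proj (trivial_bundle ?Y) e \<in> U \<inter> V \<longrightarrow> \<eta> e = g (proj (trivial_bundle ?Y) e) * \<phi> e)"
    if "(U, \<phi>) \<in> coords (trivial_bundle ?Y)" "(V, \<eta>) \<in> coords (trivial_bundle ?Y)" for U \<phi> V \<eta>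
  proof -
    have "hol_unit X (topspace (ctop X)) (\<lambda>x. 1)" by (rule hol_unit_const) auto
    from hol_unit_crestrict[OF this, of C] that show ?thesis
      by (intro exI[of _ "\<lambda>x. 1"]) (auto simp: trivial_bundle_simps topspace_crestrict)
  qed
  show "bij_betw \<phi> {e \<in> total_space (trivial_bundle ?Y). proj (trivial_bundle ?Y) e = x} UNIV"
    if "(U, \<phi>) \<in> coords (trivial_bundle ?Y)" "x \<in> U" for U \<phi> x
    using that by (intro bij_betwI[of _ _ _ "\<lambda>c. (x, c)"]) (auto simp: trivial_bundle_simps)
qed (auto simp: trivial_bundle_simps)

text \<open>
  A fibre coordinate that is defined near all of \<open>C\<close> is a trivialization over \<open>C\<close>.
\<close>

lemma bundle_iso_restrict:
  assumes L: "is_line_bundle X L" and W: "fibre_coord X L W \<phi>" and C: "C \<subseteq> W"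
  shows "bundle_iso (crestrict X C) (bundle_restrict L C) (trivial_bundle (crestrict X C)) (\<lambda>e. (proj L e, \<phi> e))"
proof -
  have top: "topspace (ctop X) \<inter> C = C" using openin_subset[OF fibre_coordD(1)[OF W]] C by blast
  have "bij_betw (\<lambda>e. (proj L e, \<phi> e)) {e \<in> total_space L. proj L e \<in> C} (C \<times> UNIV)"
    unfolding bij_betw_def
  proof
    show "inj_on (\<lambda>e. (proj L e, \<phi> e)) {e \<in> total_space L. proj L e \<in> C}"
      using fibre_coord_inj[OF L W] C by (intro inj_onI) auto
    show "(\<lambda>e. (proj L e, \<phi> e)) ` {e \<in> total_space L. proj L e \<in> C} = C \<times> UNIV"
    proof (intro equalityI subsetI)
      fix p assume "p \<in> C \<times> (UNIV :: complex set)"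
      then obtain x c where p: "p = (x, c)" "x \<in> C" by blast
      then obtain e where "e \<in> total_space L" "proj L e = x" "\<phi> e = c"
        using fibre_coord_surj[OF L W, of x c] C by blast
      then show "p \<in> (\<lambda>e. (proj L e, \<phi> e)) ` {e \<in> total_space L. proj L e \<in> C}" using p by force
    qed auto
  qed
  moreover have "fibre_coord (crestrict X C) (bundle_restrict L C) (topspace (ctop (crestrict X C))) (snd \<circ> (\<lambda>e. (proj L e, \<phi> e)))"
  proof (rule fibre_coordI)
    fix V \<eta> assume "(V, \<eta>) \<in> coords (bundle_restrict L C)"
    then obtain V' where V: "(V', \<eta>) \<in> coords L" "V = V' \<inter> C" by (auto simp: bundle_restrict_simps)
    from fibre_coordD(2)[OF W V(1)] obtain g where g: "hol_unit X (W \<inter> V') g"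
      "\<forall>e\<in>total_space L. proj L e \<in> W \<inter> V' \<longrightarrow> \<phi> e = g (proj L e) * \<eta> e" by blast
    have "topspace (ctop (crestrict X C)) \<inter> V = (W \<inter> V') \<inter> C" using V C top by (auto simp: topspace_crestrict)
    then show "\<exists>g. hol_unit (crestrict X C) (topspace (ctop (crestrict X C)) \<inter> V) g \<and> (\<forall>e\<in>total_space (bundle_restrict L C).
       proj (bundle_restrict L C) e \<in> topspace (ctop (crestrict X C)) \<inter> V \<longrightarrow>
       (snd \<circ> (\<lambda>e. (proj L e, \<phi> e))) e = g (proj (bundle_restrict L C) e) * \<eta> e)"
      using hol_unit_crestrict[OF g(1), of C] g(2) by (intro exI[of _ g]) (auto simp: bundle_restrict_simps)
  qed simp
  ultimately show ?thesis
    unfolding bundle_iso_def using is_line_bundle_restrict[OF L] is_line_bundle_trivial_restrict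
    by (auto simp: trivial_bundle_simps bundle_restrict_simps topspace_crestrict top)
qed

lemma fibre_coord_of_restricted_iso:
  assumes L: "is_line_bundle X L" and C: "openin (ctop X) C"
    and iso: "bundle_iso (crestrict X C) (bundle_restrict L C) (trivial_bundle (crestrict X C)) \<iota>"
  shows "fibre_coord X L C (snd \<circ> \<iota>)"
proof (rule fibre_coordI[OF C])
  fix V \<eta> assume V: "(V, \<eta>) \<in> coords L"
  have top: "topspace (ctop (crestrict X C)) = C" using openin_subset[OF C] by (auto simp: topspace_crestrict)
  have "fibre_coord (crestrict X C) (bundle_restrict L C) C (snd \<circ> \<iota>)"
    using iso by (auto simp: bundle_iso_def trivial_bundle_simps top)
  moreover have "(V \<inter> C, \<eta>) \<in> coords (bundle_restrict L C)" using V by (force simp: bundle_restrict_simps)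
  ultimately obtain g where g: "hol_unit (crestrict X C) (C \<inter> (V \<inter> C)) g"
    "\<forall>e\<in>total_space (bundle_restrict L C). proj (bundle_restrict L C) e \<in> C \<inter> (V \<inter> C) \<longrightarrow>
        (snd \<circ> \<iota>) e = g (proj (bundle_restrict L C) e) * \<eta> e"
    using fibre_coordD(2) by blast
  have eq: "C \<inter> (V \<inter> C) = C \<inter> V" by blast
  have "hol_unit X (C \<inter> V) g" using g(1) hol_of_crestrict_open[OF C] unfolding eq by (auto simp: hol_unit_def)
  then show "\<exists>g. hol_unit X (C \<inter> V) g \<and> (\<forall>e\<in>total_space L. proj L e \<in> C \<inter> V \<longrightarrow> (snd \<circ> \<iota>) e = g (proj L e) * \<eta> e)"
    using g(2) by (auto simp: bundle_restrict_simps)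
qed

end

section \<open>Divisors and local equations\<close>

context surface
begin

lemma analytic_subset_closed:
  assumes "analytic_subset X Z"
  shows "closedin (ctop X) Z"
  unfolding closedin_def
proof (intro conjI)
  show "Z \<subseteq> topspace (ctop X)" using assms by (simp add: analytic_subset_def)
  show "openin (ctop X) (topspace (ctop X) - Z)"
  proof (rule openin_subopen[THEN iffD2], rule ballI)
    fix x assume x: "x \<in> topspace (ctop X) - Z"
    then obtain W F where W: "x \<in> W" "\<forall>f\<in>F. hol X W f" "Z \<inter> W = {y \<in> W. \<forall>f\<in>F. f y = 0}"
      using assms unfolding analytic_subset_def by blast
    then obtain f where f: "f \<in> F" "f x \<noteq> 0" using x by blast
    have "openin (ctop X) {y \<in> W. f y \<noteq> 0}" using openin_nonzero W f by blast
    moreover have "{y \<in> W. f y \<noteq> 0} \<subseteq> topspace (ctop X) - Z"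
      using W f openin_subset[OF calculation] by blast
    ultimately show "\<exists>T. openin (ctop X) T \<and> x \<in> T \<and> T \<subseteq> topspace (ctop X) - Z"
      using W f by blast
  qed
qed

lemma prime_divisor_closed: "prime_divisor X C \<Longrightarrow> closedin (ctop X) C"
  unfolding prime_divisor_def irreducible_subset_def using analytic_subset_closed by blast

lemma local_equationD:
  assumes "local_equation X C W l"
  shows "hol X W l"
    and "V \<subseteq> W \<Longrightarrow> hol X V g \<Longrightarrow> (\<forall>y\<in>V \<inter> C. g y = 0) \<longleftrightarrow> (\<exists>h. hol X V h \<and> (\<forall>y\<in>V. g y = l y * h y))"
  using assms unfolding local_equation_def by simp_all

lemma local_equation_subset:
  assumes "local_equation X C W l" "openin (ctop X) V" "V \<subseteq> W"
  shows "local_equation X C V l"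
  unfolding local_equation_def
proof (intro conjI allI impI)
  show "hol X V l" using hol_subset[OF local_equationD(1)[OF assms(1)] assms(2,3)] .
  show "(\<forall>y\<in>V' \<inter> C. g y = 0) \<longleftrightarrow> (\<exists>h. hol X V' h \<and> (\<forall>y\<in>V'. g y = l y * h y))"
    if "V' \<subseteq> V" "hol X V' g" for V' g
    by (rule local_equationD(2)[OF assms(1) _ that(2)]) (use that assms(3) in auto)
qed

text \<open>
  Off \<open>C\<close> the constant \<open>1\<close> vanishes on the empty set \<open>(V - C) \<inter> C\<close>, so it is divisible by \<open>l\<close>.
\<close>

lemma local_equation_nonzero:
  assumes l: "local_equation X C V l" and C: "closedin (ctop X) C" and y: "y \<in> V" "y \<notin> C"
  shows "l y \<noteq> 0"
proof -
  have "hol X V l" using l by (simp add: local_equation_def)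
  then have op: "openin (ctop X) (V - C)" using C hol_openin by blast
  have "hol X (V - C) (\<lambda>y. 1)" by (rule hol_const[OF op])
  moreover have "V - C \<subseteq> V" "\<forall>y\<in>(V - C) \<inter> C. (1 :: complex) = 0" by auto
  ultimately obtain h where "\<forall>y\<in>V - C. 1 = l y * h y"
    using local_equationD(2)[OF l, of "V - C" "\<lambda>y. 1"] by blast
  then show ?thesis using y by force
qed

end

context dense_surface
begin

text \<open>
  Each of the two generators divides the other; the product of the quotients is \<open>1\<close> on the dense set
  \<open>N\<close>, where the generators do not vanish.
\<close>

lemma local_equation_ratio:
  assumes l: "local_equation X C V l" and l': "local_equation X C V' l'"
    and C: "closedin (ctop X) C" "C \<inter> N = {}"
  shows "\<exists>u. hol_unit X (V \<inter> V') u \<and> (\<forall>y\<in>V \<inter> V'. l' y = u y * l y)"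
proof -
  let ?V = "V \<inter> V'"
  have op: "openin (ctop X) ?V"
    using hol_openin[OF local_equationD(1)[OF l]] hol_openin[OF local_equationD(1)[OF l']] by (rule openin_Int)
  have m: "local_equation X C ?V l" "local_equation X C ?V l'"
    using local_equation_subset[OF l op] local_equation_subset[OF l' op] by auto
  note h = m[THEN local_equationD(1)]
  have van: "\<forall>y\<in>?V \<inter> C. k y = 0" if "local_equation X C ?V k" for k
  proof -
    have "\<exists>h. hol X ?V h \<and> (\<forall>y\<in>?V. k y = k y * h y)"
      using hol_const[OF op, of 1] by (intro exI[of _ "\<lambda>y. 1"]) simp
    then show ?thesis using local_equationD(2)[OF that order_refl local_equationD(1)[OF that]] by simp
  qed
  have "\<exists>h. hol X ?V h \<and> (\<forall>y\<in>?V. l' y = l y * h y)"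
    using local_equationD(2)[OF m(1) order_refl h(2)] van[OF m(2)] by simp
  then obtain u where u: "hol X ?V u" "\<forall>y\<in>?V. l' y = l y * u y" by blast
  have "\<exists>h. hol X ?V h \<and> (\<forall>y\<in>?V. l y = l' y * h y)"
    using local_equationD(2)[OF m(2) order_refl h(1)] van[OF m(1)] by simp
  then obtain v where v: "hol X ?V v" "\<forall>y\<in>?V. l y = l' y * v y" by blast
  have "u y * v y = 1" if y: "y \<in> ?V" for y
  proof (rule eq_of_eq_on_dense[OF hol_mult[OF u(1) v(1)] hol_const[OF op] _ y])
    fix z assume z: "z \<in> ?V \<inter> N"
    then have "l z \<noteq> 0" using local_equation_nonzero[OF m(1) C(1)] C(2) by blast
    moreover have "l z = l z * (u z * v z)" using u(2) v(2) z by (metis IntE mult.assoc)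
    ultimately show "u z * v z = 1" by simp
  qed
  then have "hol_unit X ?V u" using u(1) unfolding hol_unit_def by (metis mult_zero_left zero_neq_one)
  then show ?thesis using u(2) by (auto simp: mult.commute)
qed

text \<open>
  For functions, the conditions of being a frame and of having order \<open>k\<close> become statements about
  \<open>f\<close> alone, because the fibre coordinates of the trivial bundle are the units times \<open>snd\<close>.
\<close>

lemma unit_ext_of_frame:
  assumes fr: "frame_at X (trivial_bundle X) M (\<lambda>x. (x, f x)) x"
    and W: "openin (ctop X) W" "x \<in> W" "W \<inter> N \<subseteq> M"
  shows "unit_ext f x"
proof -
  obtain V \<phi> u where V: "x \<in> V" "fibre_coord X (trivial_bundle X) V \<phi>" "hol_unit X V u"
    "\<forall>y\<in>V \<inter> M. \<phi> (y, f y) = u y" using fr unfolding frame_at_def by blast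
  obtain g where g: "hol_unit X V g" "\<forall>x\<in>V. \<forall>c. \<phi> (x, c) = g x * c" using trivial_fibre_coord[OF V(2)] by blast
  have op: "openin (ctop X) (V \<inter> W)" using hol_unit_openin[OF g(1)] W by blast
  have "hol_unit X (V \<inter> W) (\<lambda>y. u y / g y)"
    by (rule hol_unit_divide[OF hol_unit_subset[OF V(3) op] hol_unit_subset[OF g(1) op]]) auto
  then show ?thesis
  proof (rule unit_extI)
    show "u y / g y = f y" if y: "y \<in> V \<inter> W \<inter> N" for y
    proof -
      have "g y \<noteq> 0" using hol_unitD(2)[OF g(1)] y by blast
      moreover have "g y * f y = u y" using V(4) g(2) y W(3) by (metis IntE IntI subsetD)
      ultimately show ?thesis by (simp add: field_simps)
    qed
  qed (use V W in auto)
qed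

lemma unit_ext_of_order:
  assumes fr: "order_at X (trivial_bundle X) M (\<lambda>x. (x, f x)) C k x"
    and W: "openin (ctop X) W" "x \<in> W" "W \<inter> N \<subseteq> M" and C: "closedin (ctop X) C" "C \<inter> N = {}"
  shows "\<exists>V l. x \<in> V \<and> local_equation X C V l \<and> unit_ext (\<lambda>y. f y / l y powi k) x"
proof -
  obtain V \<phi> l u where V: "x \<in> V" "fibre_coord X (trivial_bundle X) V \<phi>" "local_equation X C V l" "hol_unit X V u"
    "\<forall>y\<in>V \<inter> M. \<phi> (y, f y) = u y * l y powi k" using fr unfolding order_at_def by blast
  obtain g where g: "hol_unit X V g" "\<forall>x\<in>V. \<forall>c. \<phi> (x, c) = g x * c" using trivial_fibre_coord[OF V(2)] by blast
  have op: "openin (ctop X) (V \<inter> W)" using hol_unit_openin[OF g(1)] W by blast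
  have "hol_unit X (V \<inter> W) (\<lambda>y. u y / g y)"
    by (rule hol_unit_divide[OF hol_unit_subset[OF V(4) op] hol_unit_subset[OF g(1) op]]) auto
  then have "unit_ext (\<lambda>y. f y / l y powi k) x"
  proof (rule unit_extI)
    show "u y / g y = f y / l y powi k" if y: "y \<in> V \<inter> W \<inter> N" for y
    proof -
      have "g y \<noteq> 0" using hol_unitD(2)[OF g(1)] y by blast
      moreover have "l y \<noteq> 0" using local_equation_nonzero[OF V(3) C(1)] C(2) y by blast
      moreover have "g y * f y = u y * l y powi k" using V(5) g(2) y W(3) by (metis IntE IntI subsetD)
      ultimately show ?thesis by (simp add: divide_simps mult.commute)
    qed
  qed (use V W in auto)
  then show ?thesis using V by blast
qed

lemma divisor_key:
  assumes "D \<in> divisors X" "supp D \<inter> N = {}" "C \<in> Poly_Mapping.keys D"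
  shows "closedin (ctop X) C" "C \<inter> N = {}" "C \<subseteq> supp D"
  using assms prime_divisor_closed unfolding divisors_def supp_def by blast+

text \<open>Both functions have the same order along each curve, up to finitely many points, which are removable.\<close>

lemma fun_divisor_ratio:
  assumes f: "fun_has_divisor_on X W M f D" "W \<inter> N \<subseteq> M"
    and f': "fun_has_divisor_on X W' M' f' D" "W' \<inter> N \<subseteq> M'"
    and D: "supp D \<inter> N = {}"
  shows "\<exists>u. hol_unit X (W \<inter> W') u \<and> (\<forall>y\<in>W \<inter> W' \<inter> N. u y = f' y / f y)"
proof (rule unit_glue)
  note F = f(1)[unfolded fun_has_divisor_on_def has_divisor_on_def]
  note F' = f'(1)[unfolded fun_has_divisor_on_def has_divisor_on_def]
  have Ddiv: "D \<in> divisors X" using F by blast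
  have W: "openin (ctop X) W" "openin (ctop X) W'" using F F' by blast+
  show op: "openin (ctop X) (W \<inter> W')" using W by blast
  let ?tr = "trivial_bundle X"
  \<comment> \<open>The points of the support at which the order is not controlled.\<close>
  define bad where "bad V M h = (\<Union>C\<in>Poly_Mapping.keys D.
    {x \<in> C \<inter> V. \<not> order_at X ?tr M (\<lambda>x. (x, h x)) C (Poly_Mapping.lookup D C) x})" for V M and h :: "'a \<Rightarrow> complex"
  have fin: "finite (bad W M f)" "finite (bad W' M' f')"
    unfolding bad_def using F F' by (intro finite_UN_I finite_keys; blast)+
  have off: "bad V M h \<inter> N = {}" for V M h using divisor_key(2)[OF Ddiv D] unfolding bad_def by blast
  have frame: "unit_ext f x" "unit_ext f' x" if "x \<in> W \<inter> W' - supp D" for x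
    using unit_ext_of_frame[of M f x W] unit_ext_of_frame[of M' f' x W'] that F F' f(2) f'(2) W by blast+
  have loc: "unit_ext (\<lambda>y. f' y / f y) x" if x: "x \<in> W \<inter> W' - (bad W M f \<union> bad W' M' f')" for x
  proof (cases "x \<in> supp D")
    case False
    then show ?thesis using unit_ext_divide frame x by blast
  next
    case True
    then obtain C where C: "C \<in> Poly_Mapping.keys D" "x \<in> C" by (auto simp: supp_def)
    note K = divisor_key[OF Ddiv D C(1)]
    let ?k = "Poly_Mapping.lookup D C"
    have "order_at X ?tr M (\<lambda>x. (x, f x)) C ?k x" "order_at X ?tr M' (\<lambda>x. (x, f' x)) C ?k x"
      using x C unfolding bad_def by blast+
    then obtain V l V' l' where V: "x \<in> V" "local_equation X C V l" "unit_ext (\<lambda>y. f y / l y powi ?k) x"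
      "x \<in> V'" "local_equation X C V' l'" "unit_ext (\<lambda>y. f' y / l' y powi ?k) x"
      using unit_ext_of_order[of M f C ?k x W] unit_ext_of_order[of M' f' C ?k x W'] W f(2) f'(2) K x by blast
    obtain u where u: "hol_unit X (V \<inter> V') u" "\<forall>y\<in>V \<inter> V'. l' y = u y * l y"
      using local_equation_ratio[OF V(2,5) K(1,2)] by blast
    have "unit_ext (\<lambda>y. u y powi ?k) x" by (rule unit_extI[OF hol_unit_powi[OF u(1)]]) (use V in auto)
    from unit_ext_mult[OF this unit_ext_divide[OF V(6,3)]]
    show ?thesis
    proof (rule unit_ext_cong)
      show "openin (ctop X) (V \<inter> V')" by (rule hol_unit_openin[OF u(1)])
      fix y assume y: "y \<in> V \<inter> V' \<inter> N"
      have "l y \<noteq> 0" "l' y \<noteq> 0" 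
        using local_equation_nonzero[OF V(2) K(1)] local_equation_nonzero[OF V(5) K(1)] K(2) y by blast+
      moreover have "u y = l' y / l y" using u(2) y calculation by simp
      ultimately show "u y powi ?k * (f' y / l' y powi ?k / (f y / l y powi ?k)) = f' y / f y"
        by (simp add: power_int_divide_distrib)
    qed (use V in auto)
  qed
  show "unit_ext (\<lambda>y. f' y / f y) x" if "x \<in> W \<inter> W'" for x
    by (rule unit_ext_off_finite[OF op, of "bad W M f \<union> bad W' M' f'", OF _ _ loc that]) (use fin off in auto)
qed

text \<open>
  In the next three lemmas \<open>s\<close> is a unit times \<open>f\<close> in some fibre coordinate of \<open>L\<close> near \<open>x\<close>; then \<open>s\<close>
  inherits the behaviour of \<open>f\<close> at \<open>x\<close>.
\<close>

lemma meromorphic_transfer: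
  assumes "meromorphic_at X (trivial_bundle X) M (\<lambda>x. (x, f x)) x"
    and V: "x \<in> V" "fibre_coord X L V \<phi>" "hol_unit X V u" "\<And>y. y \<in> V \<inter> N \<Longrightarrow> \<phi> (s y) = u y * f y"
    and M: "V \<inter> N \<subseteq> M"
  shows "meromorphic_at X L N s x"
proof -
  obtain V0 \<phi>0 a b where V0: "x \<in> V0" "fibre_coord X (trivial_bundle X) V0 \<phi>0" "hol X V0 a" "hol X V0 b"
    "(ctop X) interior_of {y \<in> V0. b y = 0} = {}" "\<forall>y\<in>V0 \<inter> M. b y * \<phi>0 (y, f y) = a y"
    using assms(1) unfolding meromorphic_at_def by blast
  obtain g where g: "hol_unit X V0 g" "\<forall>x\<in>V0. \<forall>c. \<phi>0 (x, c) = g x * c" using trivial_fibre_coord[OF V0(2)] by blast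
  let ?V = "V \<inter> V0"
  have op: "openin (ctop X) ?V" using hol_unit_openin[OF g(1)] hol_unit_openin[OF V(3)] by blast
  have "hol X ?V (\<lambda>y. a y * (u y / g y))"
    by (intro hol_mult hol_unitD(1)[OF hol_unit_divide] hol_subset[OF V0(3) op] hol_unit_subset[OF V(3) op]
      hol_unit_subset[OF g(1) op]) auto
  moreover have "hol X ?V b" by (rule hol_subset[OF V0(4) op]) auto
  moreover have "(ctop X) interior_of {y \<in> ?V. b y = 0} = {}"
    using interior_of_mono[of "{y \<in> ?V. b y = 0}" "{y \<in> V0. b y = 0}" "ctop X"] V0(5) by blast
  moreover have "fibre_coord X L ?V \<phi>" by (rule fibre_coord_subset[OF V(2) op]) auto
  moreover have "b y * \<phi> (s y) = a y * (u y / g y)" if y: "y \<in> ?V \<inter> N" for y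
  proof -
    have "g y \<noteq> 0" using hol_unitD(2)[OF g(1)] y by blast
    moreover have "b y * (g y * f y) = a y" using V0(6) g(2) y M by (metis IntE IntI subsetD)
    ultimately show ?thesis using V(4) y by (simp add: field_simps)
  qed
  ultimately show ?thesis unfolding meromorphic_at_def using V(1) V0(1) by blast
qed

lemma frame_transfer:
  assumes "unit_ext f x"
    and V: "x \<in> V" "fibre_coord X L V \<phi>" "hol_unit X V u" "\<And>y. y \<in> V \<inter> N \<Longrightarrow> \<phi> (s y) = u y * f y"
  shows "frame_at X L N s x"
proof -
  obtain V0 v where v: "x \<in> V0" "hol_unit X V0 v" "\<forall>y\<in>V0 \<inter> N. v y = f y" using assms(1) unfolding unit_ext_def by blast
  have op: "openin (ctop X) (V \<inter> V0)" using hol_unit_openin[OF v(2)] hol_unit_openin[OF V(3)] by blast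
  have "hol_unit X (V \<inter> V0) (\<lambda>y. u y * v y)"
    by (rule hol_unit_mult[OF hol_unit_subset[OF V(3) op] hol_unit_subset[OF v(2) op]]) auto
  moreover have "fibre_coord X L (V \<inter> V0) \<phi>" by (rule fibre_coord_subset[OF V(2) op]) auto
  ultimately show ?thesis unfolding frame_at_def
    using v V by (intro exI[of _ "V \<inter> V0"] exI[of _ \<phi>] exI[of _ "\<lambda>y. u y * v y"]) auto
qed

lemma order_transfer:
  assumes "order_at X (trivial_bundle X) M (\<lambda>x. (x, f x)) C k x"
    and V: "x \<in> V" "fibre_coord X L V \<phi>" "hol_unit X V u" "\<And>y. y \<in> V \<inter> N \<Longrightarrow> \<phi> (s y) = u y * f y"
    and M: "V \<inter> N \<subseteq> M"
  shows "order_at X L N s C k x"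
proof -
  obtain V0 \<phi>0 l v where V0: "x \<in> V0" "fibre_coord X (trivial_bundle X) V0 \<phi>0" "local_equation X C V0 l" "hol_unit X V0 v"
    "\<forall>y\<in>V0 \<inter> M. \<phi>0 (y, f y) = v y * l y powi k"
    using assms(1) unfolding order_at_def by blast
  obtain g where g: "hol_unit X V0 g" "\<forall>x\<in>V0. \<forall>c. \<phi>0 (x, c) = g x * c" using trivial_fibre_coord[OF V0(2)] by blast
  let ?V = "V \<inter> V0"
  have op: "openin (ctop X) ?V" using hol_unit_openin[OF g(1)] hol_unit_openin[OF V(3)] by blast
  have "hol_unit X ?V (\<lambda>y. v y * (u y / g y))"
    by (intro hol_unit_mult hol_unit_divide hol_unit_subset[OF V0(4) op] hol_unit_subset[OF V(3) op]
      hol_unit_subset[OF g(1) op]) auto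
  moreover have "local_equation X C ?V l" by (rule local_equation_subset[OF V0(3) op]) auto
  moreover have "fibre_coord X L ?V \<phi>" by (rule fibre_coord_subset[OF V(2) op]) auto
  moreover have "\<phi> (s y) = v y * (u y / g y) * l y powi k" if y: "y \<in> ?V \<inter> N" for y
  proof -
    have "g y \<noteq> 0" using hol_unitD(2)[OF g(1)] y by blast
    moreover have "g y * f y = v y * l y powi k" using V0(5) g(2) y M by (metis IntE IntI subsetD)
    ultimately show ?thesis using V(4) y by (simp add: field_simps)
  qed
  ultimately show ?thesis unfolding order_at_def using V(1) V0(1) by blast
qed

text \<open>
  Monomials are given on \<open>N\<close>, but a local equation of \<open>D\<close> must be holomorphic off the whole support
  of \<open>D\<close>. There the function extends as a unit, and all identities extend by density.
\<close>

lemma fun_has_divisor_on_extend: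
  assumes g: "fun_has_divisor_on X W (W \<inter> N) g D" and D: "supp D \<inter> N = {}"
  shows "\<exists>f. (\<forall>y\<in>W \<inter> N. f y = g y) \<and> (W, f) \<in> local_equations X D"
proof -
  note G = g[unfolded fun_has_divisor_on_def has_divisor_on_def]
  have W: "openin (ctop X) W" and Ddiv: "D \<in> divisors X" using G by blast+
  have "closedin (ctop X) (supp D)"
    unfolding supp_def using divisor_key(1)[OF Ddiv D] by (intro closedin_Union) auto
  then have op: "openin (ctop X) (W - supp D)" using W by blast
  have frame: "frame_at X (trivial_bundle X) (W \<inter> N) (\<lambda>x. (x, g x)) x" if "x \<in> W - supp D" for x
    using G that by blast
  have "unit_ext g x" if x: "x \<in> W - supp D" for x
    by (rule unit_ext_of_frame[OF frame[OF x] W]) (use x in auto)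
  from unit_glue[OF op this] obtain f where f: "hol_unit X (W - supp D) f"
    "\<forall>y\<in>(W - supp D) \<inter> N. f y = g y" by blast
  have fg: "f y = g y" if "y \<in> W \<inter> N" for y using f(2) that D by blast
  let ?tr = "trivial_bundle X" and ?M = "W - supp D"
  have "fun_has_divisor_on X W ?M f D"
    unfolding fun_has_divisor_on_def has_divisor_on_def
  proof (intro conjI ballI)
    show "D \<in> divisors X" "openin (ctop X) W" "?M \<subseteq> W" using Ddiv W by auto
    show "W \<subseteq> (ctop X) closure_of ?M" by (rule dense_closure[OF _ W]) (use D in auto)
    show "hol_section X ?tr ?M (\<lambda>x. (x, f x))"
      unfolding hol_section_def trivial_bundle_simps
    proof (intro conjI op)
      have "hol X (?M \<inter> topspace (ctop X)) f"
        by (rule hol_subset[OF hol_unitD(1)[OF f(1)]]) (use op in auto)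
      then show "\<forall>(V, \<eta>)\<in>{(topspace (ctop X), snd)}. hol X (?M \<inter> V) (\<eta> \<circ> (\<lambda>x. (x, f x)))"
        by (simp add: comp_def)
    qed (use openin_subset[OF W] in auto)
    show "frame_at X ?tr ?M (\<lambda>x. (x, f x)) x" if "x \<in> ?M" for x
      unfolding frame_at_def using that f(1) trivial_fibre_coord_snd[OF op]
      by (intro exI[of _ ?M] exI[of _ snd] exI[of _ f]) auto
    show "meromorphic_at X ?tr ?M (\<lambda>x. (x, f x)) x" if x: "x \<in> W" for x
    proof -
      obtain V \<phi> a b where V: "x \<in> V" "fibre_coord X ?tr V \<phi>" "hol X V a" "hol X V b"
        "(ctop X) interior_of {y \<in> V. b y = 0} = {}" "\<forall>y\<in>V \<inter> (W \<inter> N). b y * \<phi> (y, g y) = a y"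
        using G x unfolding meromorphic_at_def by blast
      obtain h where h: "hol_unit X V h" "\<forall>x\<in>V. \<forall>c. \<phi> (x, c) = h x * c" using trivial_fibre_coord[OF V(2)] by blast
      have op': "openin (ctop X) (V \<inter> ?M)" using hol_openin[OF V(3)] op by blast
      have "b y * \<phi> (y, f y) = a y" if y: "y \<in> V \<inter> ?M" for y
      proof -
        have "hol X (V \<inter> ?M) (\<lambda>y. b y * (h y * f y))"
          by (intro hol_mult hol_subset[OF V(4) op'] hol_subset[OF hol_unitD(1)[OF h(1)] op']
             hol_subset[OF hol_unitD(1)[OF f(1)] op']) auto
        moreover have "hol X (V \<inter> ?M) a" by (rule hol_subset[OF V(3) op']) auto
        ultimately have "b y * (h y * f y) = a y"
          by (rule eq_of_eq_on_dense[OF _ _ _ y]) (use V(6) h(2) fg in auto)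
        then show ?thesis using h(2) y by auto
      qed
      then show ?thesis unfolding meromorphic_at_def using V by blast
    qed
    fix C assume C: "C \<in> Poly_Mapping.keys D"
    note K = divisor_key[OF Ddiv D C]
    let ?k = "Poly_Mapping.lookup D C"
    have "order_at X ?tr ?M (\<lambda>x. (x, f x)) C ?k x" if x: "order_at X ?tr (W \<inter> N) (\<lambda>x. (x, g x)) C ?k x" for x
    proof -
      obtain V \<phi> l u where V: "x \<in> V" "fibre_coord X ?tr V \<phi>" "local_equation X C V l" "hol_unit X V u"
        "\<forall>y\<in>V \<inter> (W \<inter> N). \<phi> (y, g y) = u y * l y powi ?k"
        using x unfolding order_at_def by blast
      obtain h where h: "hol_unit X V h" "\<forall>x\<in>V. \<forall>c. \<phi> (x, c) = h x * c" using trivial_fibre_coord[OF V(2)] by blast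
      have op': "openin (ctop X) (V \<inter> ?M)" using hol_unit_openin[OF V(4)] op by blast
      have le: "local_equation X C (V \<inter> ?M) l" by (rule local_equation_subset[OF V(3) op']) auto
      have "hol_unit X (V \<inter> ?M) l"
        unfolding hol_unit_def using local_equationD(1)[OF le] local_equation_nonzero[OF le K(1)] K(3) by blast
      note l = hol_unit_powi[OF this, of ?k]
      have "\<phi> (y, f y) = u y * l y powi ?k" if y: "y \<in> V \<inter> ?M" for y
      proof -
        have "hol X (V \<inter> ?M) (\<lambda>y. h y * f y)"
          by (intro hol_mult hol_subset[OF hol_unitD(1)[OF h(1)] op'] hol_subset[OF hol_unitD(1)[OF f(1)] op']) auto
        moreover have "hol X (V \<inter> ?M) (\<lambda>y. u y * l y powi ?k)"
          by (intro hol_mult hol_subset[OF hol_unitD(1)[OF V(4)] op'] hol_unitD(1)[OF l]) auto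
        ultimately have "h y * f y = u y * l y powi ?k"
          by (rule eq_of_eq_on_dense[OF _ _ _ y]) (use V(5) h(2) fg in auto)
        then show ?thesis using h(2) y by auto
      qed
      then show ?thesis unfolding order_at_def using V by blast
    qed
    then have "{x \<in> C \<inter> W. \<not> order_at X ?tr ?M (\<lambda>x. (x, f x)) C ?k x} \<subseteq>
       {x \<in> C \<inter> W. \<not> order_at X ?tr (W \<inter> N) (\<lambda>x. (x, g x)) C ?k x}" by blast
    then show "finite {x \<in> C \<inter> W. \<not> order_at X ?tr ?M (\<lambda>x. (x, f x)) C ?k x}"
      by (rule finite_subset) (use G C in blast)
  qed
  then show ?thesis using fg unfolding local_equations_def by blast
qed

end

section \<open>The line bundle of a divisor\<close>

text \<open>
  Finitely many local equations that cover the surface: finiteness keeps the set of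
  points finite at which the order of a section is not controlled.
\<close>

locale covered_divisor = dense_surface A N for A :: "'a atlas2" and N +
  fixes D :: "'a set \<Rightarrow>\<^sub>0 int" and \<K> :: "('a set \<times> ('a \<Rightarrow> complex)) set"
  assumes D_div: "D \<in> divisors X" and D_off: "supp D \<inter> N = {}"
    and K_finite: "finite \<K>" and K_sub: "\<K> \<subseteq> local_equations X D"
    and K_cover: "\<And>x. x \<in> topspace (ctop X) \<Longrightarrow> \<exists>(W, f)\<in>\<K>. x \<in> W"
begin

abbreviation LE :: "('a set \<times> ('a \<Rightarrow> complex)) set" where "LE \<equiv> local_equations X D"

lemma LE_divisor:
  assumes "(W, f) \<in> LE"
  shows "fun_has_divisor_on X W (W - supp D) f D"
  using assms by (simp add: local_equations_def)

lemma LE_open: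
  assumes "(W, f) \<in> LE"
  shows "openin (ctop X) W"
  using LE_divisor[OF assms] unfolding fun_has_divisor_on_def has_divisor_on_def by blast

lemma LE_N: "W \<inter> N \<subseteq> W - supp D" using D_off by blast

lemma LE_hol:
  assumes "(W, f) \<in> LE"
  shows "hol X (W - supp D) f"
proof -
  have "hol_section X (trivial_bundle X) (W - supp D) (\<lambda>x. (x, f x))"
    using LE_divisor[OF assms] unfolding fun_has_divisor_on_def has_divisor_on_def by blast
  then have "hol X ((W - supp D) \<inter> topspace (ctop X)) f"
    by (simp add: hol_section_def trivial_bundle_simps comp_def)
  moreover have "(W - supp D) \<inter> topspace (ctop X) = W - supp D"
    using openin_subset[OF LE_open[OF assms]] by blast
  ultimately show ?thesis by simp
qed

lemma LE_nonzero:
  assumes "(W, f) \<in> LE" "y \<in> W \<inter> N"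
  shows "f y \<noteq> 0"
proof -
  have "frame_at X (trivial_bundle X) (W - supp D) (\<lambda>x. (x, f x)) y"
    using LE_divisor[OF assms(1)] assms(2) D_off unfolding fun_has_divisor_on_def has_divisor_on_def by blast
  from unit_ext_of_frame[OF this LE_open[OF assms(1)] _ LE_N] assms(2)
  obtain V u where "y \<in> V" "hol_unit X V u" "\<forall>y\<in>V \<inter> N. u y = f y" unfolding unit_ext_def by blast
  then show ?thesis using hol_unitD(2)[of V u y] assms(2) by auto
qed

lemma LE_ratio:
  assumes f: "(W, f) \<in> LE" and f': "(W', f') \<in> LE"
  shows "\<exists>g. hol_unit X (W \<inter> W') g \<and> (\<forall>y\<in>W \<inter> W' - supp D. f' y = g y * f y)"
proof -
  obtain g where g: "hol_unit X (W \<inter> W') g" "\<forall>y\<in>W \<inter> W' \<inter> N. g y = f' y / f y"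
    using fun_divisor_ratio[OF LE_divisor[OF f] LE_N LE_divisor[OF f'] LE_N D_off] by blast
  have "f' y = g y * f y" if y: "y \<in> W \<inter> W' - supp D" for y
  proof (rule eq_of_eq_on_dense[OF _ _ _ y])
    have "openin (ctop X) ((W - supp D) \<inter> (W' - supp D))"
      using hol_openin[OF LE_hol[OF f]] hol_openin[OF LE_hol[OF f']] by blast
    moreover have "(W - supp D) \<inter> (W' - supp D) = W \<inter> W' - supp D" by blast
    ultimately have op: "openin (ctop X) (W \<inter> W' - supp D)" by simp
    show "hol X (W \<inter> W' - supp D) f'" by (rule hol_subset[OF LE_hol[OF f'] op]) auto
    show "hol X (W \<inter> W' - supp D) (\<lambda>y. g y * f y)"
      by (intro hol_mult hol_subset[OF hol_unitD(1)[OF g(1)] op] hol_subset[OF LE_hol[OF f] op]) auto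
    show "f' z = g z * f z" if z: "z \<in> (W \<inter> W' - supp D) \<inter> N" for z
      using g(2) LE_nonzero[OF f, of z] z by auto
  qed
  then show ?thesis using g(1) by blast
qed

text \<open>
  The transition function \<open>f' / f\<close> between two local equations of \<open>D\<close>, extended over the support.
\<close>

definition tr :: "'a set \<times> ('a \<Rightarrow> complex) \<Rightarrow> 'a set \<times> ('a \<Rightarrow> complex) \<Rightarrow> 'a \<Rightarrow> complex" where
  "tr p p' = (SOME g. hol_unit X (fst p \<inter> fst p') g \<and> (\<forall>y\<in>fst p \<inter> fst p' - supp D. snd p' y = g y * snd p y))"

lemma tr:
  assumes "(W, f) \<in> LE" "(W', f') \<in> LE"
  shows "hol_unit X (W \<inter> W') (tr (W, f) (W', f'))"
    "\<And>y. y \<in> W \<inter> W' - supp D \<Longrightarrow> f' y = tr (W, f) (W', f') y * f y"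
  using someI_ex[OF LE_ratio[OF assms]] unfolding tr_def by auto

text \<open>
  Any holomorphic function that relates the two local equations on the dense set computes \<open>tr\<close>.
\<close>

lemma tr_unique:
  assumes f: "(W, f) \<in> LE" and f': "(W', f') \<in> LE" and V: "openin (ctop X) V" "x \<in> V" "V \<subseteq> W \<inter> W'"
    and g: "hol X V g" "\<And>y. y \<in> V \<inter> N \<Longrightarrow> f' y = g y * f y"
  shows "g x = tr (W, f) (W', f') x"
proof (rule eq_of_eq_on_dense[OF g(1) _ _ V(2)])
  show "hol X V (tr (W, f) (W', f'))" by (rule hol_subset[OF hol_unitD(1)[OF tr(1)[OF f f']] V(1,3)])
  fix y assume y: "y \<in> V \<inter> N"
  have "f' y = tr (W, f) (W', f') y * f y" by (rule tr(2)[OF f f']) (use y V D_off in blast)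
  moreover have "f y \<noteq> 0" by (rule LE_nonzero[OF f]) (use y V in blast)
  ultimately show "g y = tr (W, f) (W', f') y" using g(2)[OF y] by auto
qed

lemma tr_cocycle:
  assumes 1: "(W1, f1) \<in> LE" and 2: "(W2, f2) \<in> LE" and 3: "(W3, f3) \<in> LE" and x: "x \<in> W1 \<inter> W2 \<inter> W3"
  shows "tr (W2, f2) (W3, f3) x * tr (W1, f1) (W2, f2) x = tr (W1, f1) (W3, f3) x"
proof (rule tr_unique[OF 1 3 _ x])
  show op: "openin (ctop X) (W1 \<inter> W2 \<inter> W3)" using LE_open 1 2 3 by blast
  show "hol X (W1 \<inter> W2 \<inter> W3) (\<lambda>x. tr (W2, f2) (W3, f3) x * tr (W1, f1) (W2, f2) x)"
    by (intro hol_mult hol_subset[OF hol_unitD(1)[OF tr(1)[OF 2 3]] op]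
      hol_subset[OF hol_unitD(1)[OF tr(1)[OF 1 2]] op]) auto
  show "f3 y = tr (W2, f2) (W3, f3) y * tr (W1, f1) (W2, f2) y * f1 y" if "y \<in> W1 \<inter> W2 \<inter> W3 \<inter> N" for y
  proof -
    have "y \<notin> supp D" using that D_off by blast
    then show ?thesis using tr(2)[OF 1 2, of y] tr(2)[OF 2 3, of y] that by simp
  qed
qed auto

lemma tr_self: "(W, f) \<in> LE \<Longrightarrow> x \<in> W \<Longrightarrow> tr (W, f) (W, f) x = 1"
  by (rule tr_unique[of W f W f W x "\<lambda>x. 1", symmetric]) (auto simp: LE_open hol_const)

abbreviation OD where "OD \<equiv> divisor_bundle X D"

lemma OD_proj: "proj OD = fst"
  by (simp add: divisor_bundle_def)

text \<open>
  With the transition functions at hand, the existential condition in the definition of the fibres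
  of \<open>\<O>(D)\<close> becomes an explicit linear relation.
\<close>

lemma OD_total: "(x, \<xi>) \<in> total_space OD \<longleftrightarrow> x \<in> topspace (ctop X) \<and>
    (\<forall>W f. \<not> ((W, f) \<in> LE \<and> x \<in> W) \<longrightarrow> \<xi> (W, f) = 0) \<and>
    (\<forall>W f W' f'. (W, f) \<in> LE \<and> (W', f') \<in> LE \<and> x \<in> W \<inter> W' \<longrightarrow>
       \<xi> (W', f') = tr (W, f) (W', f') x * \<xi> (W, f))"
proof -
  have "(\<exists>g. hol_unit X (W \<inter> W') g \<and> (\<forall>y\<in>W \<inter> W' - supp D. f' y = g y * f y) \<and> \<xi> (W', f') = g x * \<xi> (W, f))
     \<longleftrightarrow> \<xi> (W', f') = tr (W, f) (W', f') x * \<xi> (W, f)" (is "?l \<longleftrightarrow> ?r")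
    if f: "(W, f) \<in> LE" "(W', f') \<in> LE" "x \<in> W \<inter> W'" for W f W' f'
  proof
    assume ?l
    then obtain g where g: "hol_unit X (W \<inter> W') g" "\<forall>y\<in>W \<inter> W' - supp D. f' y = g y * f y"
      "\<xi> (W', f') = g x * \<xi> (W, f)" by blast
    have "g x = tr (W, f) (W', f') x"
      by (rule tr_unique[OF f(1,2) hol_unit_openin[OF g(1)] f(3) _ hol_unitD(1)[OF g(1)]]) (use g(2) D_off in auto)
    then show ?r using g(3) by simp
  next
    assume ?r
    then show ?l using tr[OF f(1,2)] by blast
  qed
  note key = this
  have "(x, \<xi>) \<in> total_space OD \<longleftrightarrow> x \<in> topspace (ctop X) \<and>
    (\<forall>W f. \<not> ((W, f) \<in> LE \<and> x \<in> W) \<longrightarrow> \<xi> (W, f) = 0) \<and>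
    (\<forall>(W, f)\<in>LE. \<forall>(W', f')\<in>LE. x \<in> W \<inter> W' \<longrightarrow> (\<exists>g. hol_unit X (W \<inter> W') g \<and>
       (\<forall>y\<in>W \<inter> W' - supp D. f' y = g y * f y) \<and> \<xi> (W', f') = g x * \<xi> (W, f)))"
    unfolding divisor_bundle_def by (simp only: line_bundle.simps mem_Collect_eq prod.case)
  also have "(\<forall>(W, f)\<in>LE. \<forall>(W', f')\<in>LE. x \<in> W \<inter> W' \<longrightarrow> (\<exists>g. hol_unit X (W \<inter> W') g \<and>
       (\<forall>y\<in>W \<inter> W' - supp D. f' y = g y * f y) \<and> \<xi> (W', f') = g x * \<xi> (W, f))) \<longleftrightarrow>
     (\<forall>(W, f)\<in>LE. \<forall>(W', f')\<in>LE. x \<in> W \<inter> W' \<longrightarrow> \<xi> (W', f') = tr (W, f) (W', f') x * \<xi> (W, f))"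
    using key by (intro ball_cong refl) (clarify, intro ball_cong refl, clarify, simp)
  also have "\<dots> \<longleftrightarrow> (\<forall>W f W' f'. (W, f) \<in> LE \<and> (W', f') \<in> LE \<and> x \<in> W \<inter> W' \<longrightarrow>
       \<xi> (W', f') = tr (W, f) (W', f') x * \<xi> (W, f))"
    by (simp add: Ball_def) blast
  finally show ?thesis .
qed

lemma OD_coords_iff: "(U, \<phi>) \<in> coords OD \<longleftrightarrow> (\<exists>f. (U, f) \<in> LE \<and> \<phi> = (\<lambda>(x, \<xi>). \<xi> (U, f)))"
  unfolding divisor_bundle_def by auto

text \<open>
  A vector of \<open>\<O>(D)\<close> is determined by one of its coordinates, and by the cocycle relation each value
  of this coordinate occurs.
\<close>

lemma OD_line_bundle: "is_line_bundle X OD"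
proof (rule is_line_bundleI)
  show "proj OD e \<in> topspace (ctop X)" if "e \<in> total_space OD" for e
    using that OD_total[of "fst e" "snd e"] by (simp add: OD_proj)
  show "\<exists>U \<phi>. (U, \<phi>) \<in> coords OD \<and> x \<in> U" if "x \<in> topspace (ctop X)" for x
  proof -
    obtain W f where "(W, f) \<in> LE" "x \<in> W" using K_cover[OF \<open>x \<in> topspace (ctop X)\<close>] K_sub by blast
    have "(W, \<lambda>(x, \<xi>). \<xi> (W, f)) \<in> coords OD"
      using \<open>(W, f) \<in> LE\<close> by (auto simp: OD_coords_iff)
    then show ?thesis using \<open>x \<in> W\<close> by blast
  qed
  show "openin (ctop X) U" if "(U, \<phi>) \<in> coords OD" for U \<phi>
    using that LE_open[of U] unfolding OD_coords_iff by blast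
  show "bij_betw \<phi> {e \<in> total_space OD. proj OD e = x} UNIV" if U: "(U, \<phi>) \<in> coords OD" "x \<in> U" for U \<phi> x
  proof -
    obtain f where f: "(U, f) \<in> LE" "\<phi> = (\<lambda>(x, \<xi>). \<xi> (U, f))" using U unfolding OD_coords_iff by blast
    define inv where "inv c = (x, \<lambda>p. if p \<in> LE \<and> x \<in> fst p then tr (U, f) p x * c else 0)" for c
    have x: "x \<in> topspace (ctop X)" using openin_subset[OF LE_open[OF f(1)]] U(2) by blast
    have "inv c \<in> total_space OD" for c
      unfolding inv_def OD_total
    proof (intro conjI allI impI)
      fix W' f' W'' f''
      assume W: "(W', f') \<in> LE \<and> (W'', f'') \<in> LE \<and> x \<in> W' \<inter> W''"
      have "tr (W', f') (W'', f'') x * tr (U, f) (W', f') x = tr (U, f) (W'', f'') x"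
        by (rule tr_cocycle) (use W f U in auto)
      then show "(if (W'', f'') \<in> LE \<and> x \<in> fst (W'', f'') then tr (U, f) (W'', f'') x * c else 0) =
        tr (W', f') (W'', f'') x * (if (W', f') \<in> LE \<and> x \<in> fst (W', f') then tr (U, f) (W', f') x * c else 0)"
        using W by auto
    qed (use x in auto)
    note invT = this
    show ?thesis
    proof (rule bij_betwI[of _ _ _ inv])
      show "inv \<in> UNIV \<rightarrow> {e \<in> total_space OD. proj OD e = x}"
        using invT by (simp add: OD_proj) (simp add: inv_def)
      show "\<phi> (inv c) = c" for c using f U tr_self by (simp add: inv_def)
      show "inv (\<phi> e) = e" if e: "e \<in> {e \<in> total_space OD. proj OD e = x}" for e
      proof -
        obtain \<xi> where \<xi>: "e = (x, \<xi>)" using e by (cases e) (simp add: OD_proj)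
        with e have "(x, \<xi>) \<in> total_space OD" by simp
        note T = this[unfolded OD_total]
        have "(if p \<in> LE \<and> x \<in> fst p then tr (U, f) p x * \<xi> (U, f) else 0) = \<xi> p" for p
        proof -
          obtain W' f' where p: "p = (W', f')" by (cases p)
          show ?thesis
          proof (cases "p \<in> LE \<and> x \<in> W'")
            case True
            then have "\<xi> (W', f') = tr (U, f) (W', f') x * \<xi> (U, f)" using T f(1) U(2) p by blast
            then show ?thesis using True p by simp
          next
            case False
            then have "\<xi> (W', f') = 0" using T p by blast
            then show ?thesis using False p by auto
          qed
        qed
        then show ?thesis by (simp add: inv_def f \<xi>)
      qed
    qed auto
  qed
  show "\<exists>g. hol_unit X (U \<inter> V) g \<and> (\<forall>e\<in>total_space OD. proj OD e \<in> U \<inter> V \<longrightarrow> \<eta> e = g (proj OD e) * \<phi> e)"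
    if UV: "(U, \<phi>) \<in> coords OD" "(V, \<eta>) \<in> coords OD" for U \<phi> V \<eta>
  proof -
    obtain f where f: "(U, f) \<in> LE" "\<phi> = (\<lambda>(x, \<xi>). \<xi> (U, f))" using UV unfolding OD_coords_iff by blast
    obtain f' where f': "(V, f') \<in> LE" "\<eta> = (\<lambda>(x, \<xi>). \<xi> (V, f'))" using UV unfolding OD_coords_iff by blast
    have "\<eta> e = tr (U, f) (V, f') (proj OD e) * \<phi> e" if "e \<in> total_space OD" "proj OD e \<in> U \<inter> V" for e
      using that f f' OD_total[of "fst e" "snd e"] by (simp add: split_beta OD_proj)
    then show ?thesis using tr(1)[OF f(1) f'(1)] by blast
  qed
qed

lemma OD_fibre_coord:
  assumes "(W, f) \<in> LE"
  shows "fibre_coord X OD W (\<lambda>(x, \<xi>). \<xi> (W, f))"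
  by (rule fibre_coord_of_coords[OF OD_line_bundle]) (use assms in \<open>auto simp: OD_coords_iff\<close>)

text \<open>
  A local equation of \<open>D\<close> that is defined near all of \<open>C\<close> gives a fibre coordinate of \<open>\<O>(D)\<close> there.
\<close>

lemma OD_trivial_on:
  assumes "(W, f) \<in> LE" "C \<subseteq> W"
  shows "trivial_on X OD C"
  unfolding trivial_on_def isomorphic_bundles_def
  using bundle_iso_restrict[OF OD_line_bundle OD_fibre_coord[OF assms(1)] assms(2)] by blast

section \<open>Sections with divisor D\<close>

text \<open>
  The local form of a section with divisor \<open>D\<close>. It is the condition that can be checked for the
  extensions of \<open>U\<close>, and it yields both \<open>div s = D\<close> and \<open>L \<cong> \<O>(D)\<close>.
\<close>

definition adapted :: "('a, 'e) line_bundle \<Rightarrow> ('a \<Rightarrow> 'e) \<Rightarrow> bool" where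
  "adapted L s \<longleftrightarrow> is_line_bundle X L \<and> (\<forall>y\<in>N. s y \<in> total_space L \<and> proj L (s y) = y) \<and>
     (\<forall>x\<in>topspace (ctop X). \<exists>W f V \<phi> u. (W, f) \<in> \<K> \<and> x \<in> V \<and> V \<subseteq> W \<and> fibre_coord X L V \<phi> \<and> hol_unit X V u \<and>
        (\<forall>y\<in>V \<inter> N. \<phi> (s y) = u y * f y))"

lemma adapted_at:
  assumes "adapted L s" "x \<in> topspace (ctop X)"
  obtains W f V \<phi> u where "(W, f) \<in> \<K>" "x \<in> V" "V \<subseteq> W" "fibre_coord X L V \<phi>" "hol_unit X V u"
    "\<And>y. y \<in> V \<inter> N \<Longrightarrow> \<phi> (s y) = u y * f y"
  using bspec[OF assms(1)[unfolded adapted_def, THEN conjunct2, THEN conjunct2] assms(2)] by blast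

lemma adapted_section: "adapted L s \<Longrightarrow> y \<in> N \<Longrightarrow> s y \<in> total_space L \<and> proj L (s y) = y"
  by (simp add: adapted_def)

lemma adapted_bundle: "adapted L s \<Longrightarrow> is_line_bundle X L"
  by (simp add: adapted_def)

lemma adapted_has_divisor:
  assumes a: "adapted L s"
  shows "has_divisor X L N s D"
  unfolding has_divisor_def has_divisor_on_def
proof (intro conjI ballI)
  show "D \<in> divisors X" by (rule D_div)
  show "N \<subseteq> topspace (ctop X)" by (rule openin_subset[OF N_open])
  show "topspace (ctop X) \<subseteq> (ctop X) closure_of N" by (rule dense_closure) auto
  show "hol_section X L N s"
    unfolding hol_section_def
  proof (intro conjI N_open ballI, goal_cases)
    case (1 y) then show ?case using adapted_section[OF a] by blast
  next
    case (2 y) then show ?case using adapted_section[OF a] by blast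
  next
    case (3 p)
    obtain U \<eta> where p: "p = (U, \<eta>)" by (cases p)
    then have U: "(U, \<eta>) \<in> coords L" using 3 by simp
    have "hol X (N \<inter> U) (\<eta> \<circ> s)"
    proof (rule hol_local)
      fix x assume x: "x \<in> N \<inter> U"
      then have "x \<in> topspace (ctop X)" using openin_subset[OF N_open] by blast
      from adapted_at[OF a this] obtain W f V \<phi> u where *: "(W, f) \<in> \<K>" "x \<in> V" "V \<subseteq> W" "fibre_coord X L V \<phi>"
        "hol_unit X V u" "\<And>y. y \<in> V \<inter> N \<Longrightarrow> \<phi> (s y) = u y * f y" by blast
      obtain g where g: "hol_unit X (V \<inter> U) g"
         "\<forall>e\<in>total_space L. proj L e \<in> V \<inter> U \<longrightarrow> \<eta> e = g (proj L e) * \<phi> e"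
        using fibre_coord_ratio[OF adapted_bundle[OF a] *(4) fibre_coord_of_coords[OF adapted_bundle[OF a] U]] by blast
      let ?V = "V \<inter> U \<inter> N"
      have op: "openin (ctop X) ?V" using hol_unit_openin[OF g(1)] N_open by blast
      have f: "(W, f) \<in> LE" using *(1) K_sub by blast
      have "hol X ?V (\<lambda>y. g y * (u y * f y))"
        by (intro hol_mult hol_subset[OF hol_unitD(1)[OF g(1)] op] hol_subset[OF hol_unitD(1)[OF *(5)] op]
          hol_subset[OF LE_hol[OF f] op]) (use *(3) D_off in auto)
      moreover have "g y * (u y * f y) = (\<eta> \<circ> s) y" if y: "y \<in> ?V" for y
        using g(2) *(6) adapted_section[OF a] y by auto
      ultimately show "\<exists>V g. x \<in> V \<and> V \<subseteq> N \<inter> U \<and> hol X V g \<and> (\<forall>y\<in>V. g y = (\<eta> \<circ> s) y)"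
        using *(2) x by (intro exI[of _ ?V] exI[of _ "\<lambda>y. g y * (u y * f y)"]) auto
    qed
    then show ?case using p by simp
  qed
  fix x assume x: "x \<in> topspace (ctop X)"
  from adapted_at[OF a this] obtain W f V \<phi> u where *: "(W, f) \<in> \<K>" "x \<in> V" "V \<subseteq> W" "fibre_coord X L V \<phi>"
      "hol_unit X V u" "\<And>y. y \<in> V \<inter> N \<Longrightarrow> \<phi> (s y) = u y * f y" by blast
  have f: "(W, f) \<in> LE" using *(1) K_sub by blast
  show "meromorphic_at X L N s x"
  proof (rule meromorphic_transfer[OF _ *(2,4,5,6)])
    show "meromorphic_at X (trivial_bundle X) (W - supp D) (\<lambda>x. (x, f x)) x"
      using LE_divisor[OF f] *(2,3) unfolding fun_has_divisor_on_def has_divisor_on_def by blast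
  qed (use *(3) D_off in auto)
next
  fix x assume x: "x \<in> topspace (ctop X) - supp D"
  then have "x \<in> topspace (ctop X)" by blast
  from adapted_at[OF a this] obtain W f V \<phi> u where *: "(W, f) \<in> \<K>" "x \<in> V" "V \<subseteq> W" "fibre_coord X L V \<phi>"
      "hol_unit X V u" "\<And>y. y \<in> V \<inter> N \<Longrightarrow> \<phi> (s y) = u y * f y" by blast
  have f: "(W, f) \<in> LE" using *(1) K_sub by blast
  have "frame_at X (trivial_bundle X) (W - supp D) (\<lambda>x. (x, f x)) x"
    using LE_divisor[OF f] *(2,3) x unfolding fun_has_divisor_on_def has_divisor_on_def by blast
  from unit_ext_of_frame[OF this LE_open[OF f] _ LE_N] *(2,3) have "unit_ext f x" by blast
  from frame_transfer[OF this *(2,4,5,6)] show "frame_at X L N s x" .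
next
  fix C assume C: "C \<in> Poly_Mapping.keys D"
  let ?k = "Poly_Mapping.lookup D C"
  let ?bad = "\<Union>(W, f)\<in>\<K>. {x \<in> C \<inter> W. \<not> order_at X (trivial_bundle X) (W - supp D) (\<lambda>x. (x, f x)) C ?k x}"
  have "finite {x \<in> C \<inter> W. \<not> order_at X (trivial_bundle X) (W - supp D) (\<lambda>x. (x, f x)) C ?k x}"
    if "(W, f) \<in> \<K>" for W f
    using LE_divisor[of W f] K_sub C that unfolding fun_has_divisor_on_def has_divisor_on_def by blast
  then have "finite ?bad" by (intro finite_UN_I K_finite) auto
  moreover have "{x \<in> C \<inter> topspace (ctop X). \<not> order_at X L N s C ?k x} \<subseteq> ?bad"
  proof
    fix x assume x: "x \<in> {x \<in> C \<inter> topspace (ctop X). \<not> order_at X L N s C ?k x}"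
    then have "x \<in> topspace (ctop X)" by blast
    from adapted_at[OF a this] obtain W f V \<phi> u where *: "(W, f) \<in> \<K>" "x \<in> V" "V \<subseteq> W" "fibre_coord X L V \<phi>"
      "hol_unit X V u" "\<And>y. y \<in> V \<inter> N \<Longrightarrow> \<phi> (s y) = u y * f y" by blast
    have "V \<inter> N \<subseteq> W - supp D" using *(3) D_off by blast
    with order_transfer[OF _ *(2,4,5,6)]
    have "order_at X (trivial_bundle X) (W - supp D) (\<lambda>x. (x, f x)) C ?k x \<Longrightarrow> order_at X L N s C ?k x" by blast
    then show "x \<in> ?bad" using x * by blast
  qed
  ultimately show "finite {x \<in> C \<inter> topspace (ctop X). \<not> order_at X L N s C ?k x}" by (rule finite_subset[rotated])
qed auto

text \<open>
  The condition \<open>\<psi> (s y) = f y\<close> determines \<open>\<psi>\<close>, because \<open>f\<close> does not vanish on \<open>N\<close>; so the local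
  solutions, obtained by rescaling, fit together.
\<close>

lemma adapted_coord:
  assumes a: "adapted L s" and f: "(W, f) \<in> LE"
  shows "\<exists>\<psi>. fibre_coord X L W \<psi> \<and> (\<forall>y\<in>W \<inter> N. \<psi> (s y) = f y)"
proof -
  note L = adapted_bundle[OF a]
  define Q where "Q V \<phi> \<longleftrightarrow> V \<subseteq> W \<and> fibre_coord X L V \<phi> \<and> (\<forall>y\<in>V \<inter> N. \<phi> (s y) = f y)" for V \<phi>
  have loc: "\<exists>V \<phi>. x \<in> V \<and> Q V \<phi>" if x: "x \<in> W" for x
  proof -
    have "x \<in> topspace (ctop X)" using openin_subset[OF LE_open[OF f]] x by blast
    from adapted_at[OF a this] obtain W0 f0 V \<phi> u where *: "(W0, f0) \<in> \<K>" "x \<in> V" "V \<subseteq> W0" "fibre_coord X L V \<phi>"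
      "hol_unit X V u" "\<And>y. y \<in> V \<inter> N \<Longrightarrow> \<phi> (s y) = u y * f0 y" by blast
    have f0: "(W0, f0) \<in> LE" using *(1) K_sub by blast
    let ?V = "V \<inter> W" and ?v = "tr (W0, f0) (W, f)"
    have op: "openin (ctop X) ?V" using hol_unit_openin[OF *(5)] LE_open[OF f] by blast
    have "hol_unit X ?V (\<lambda>y. ?v y / u y)"
      by (rule hol_unit_divide[OF hol_unit_subset[OF tr(1)[OF f0 f] op] hol_unit_subset[OF *(5) op]]) (use *(3) in auto)
    from fibre_coord_scale[OF fibre_coord_subset[OF *(4) op] this]
    have "fibre_coord X L ?V (\<lambda>e. ?v (proj L e) / u (proj L e) * \<phi> e)" by blast
    moreover have "?v (proj L (s y)) / u (proj L (s y)) * \<phi> (s y) = f y" if y: "y \<in> ?V \<inter> N" for y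
    proof -
      have "f y = ?v y * f0 y" by (rule tr(2)[OF f0 f]) (use y *(3) D_off in auto)
      moreover have "u y \<noteq> 0" using hol_unitD(2)[OF *(5)] y by blast
      ultimately show ?thesis using adapted_section[OF a] *(6) y by auto
    qed
    ultimately have "Q ?V (\<lambda>e. ?v (proj L e) / u (proj L e) * \<phi> e)" unfolding Q_def by blast
    then show ?thesis using *(2) x by blast
  qed
  have uniq: "\<phi> e = \<phi>' e" if Q: "Q V \<phi>" "Q V' \<phi>'" and e: "e \<in> total_space L" "proj L e \<in> V" "proj L e \<in> V'"
    for V \<phi> V' \<phi>' e
  proof -
    note Q' = Q[unfolded Q_def]
    obtain g where g: "hol_unit X (V \<inter> V') g"
       "\<forall>e\<in>total_space L. proj L e \<in> V \<inter> V' \<longrightarrow> \<phi>' e = g (proj L e) * \<phi> e"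
      using fibre_coord_ratio[OF L] Q' by blast
    have "g (proj L e) = 1"
    proof (rule eq_of_eq_on_dense[OF hol_unitD(1)[OF g(1)] hol_const[OF hol_unit_openin[OF g(1)]]])
      fix y assume y: "y \<in> V \<inter> V' \<inter> N"
      have "f y \<noteq> 0" by (rule LE_nonzero[OF f]) (use y Q' in blast)
      moreover have "f y = g y * f y" using g(2) Q' y adapted_section[OF a, of y] by auto
      ultimately show "g y = 1" by simp
    qed (use e in blast)
    then show ?thesis using g(2) e by simp
  qed
  define \<psi> where "\<psi> e = (SOME c. \<exists>V \<phi>. proj L e \<in> V \<and> Q V \<phi> \<and> c = \<phi> e)" for e
  have \<psi>: "\<psi> e = \<phi> e" if e: "e \<in> total_space L" "proj L e \<in> V" "Q V \<phi>" for e V \<phi>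
  proof -
    have "\<exists>V \<phi>. proj L e \<in> V \<and> Q V \<phi> \<and> \<psi> e = \<phi> e"
      unfolding \<psi>_def by (rule someI_ex) (use e in blast)
    then obtain V' \<phi>' where V': "proj L e \<in> V'" "Q V' \<phi>'" "\<psi> e = \<phi>' e" by blast
    then show ?thesis using uniq[OF V'(2) e(3) e(1) V'(1) e(2)] by simp
  qed
  have "fibre_coord X L W \<psi>"
  proof (rule fibre_coord_local[OF L LE_open[OF f]])
    fix x assume "x \<in> W"
    from loc[OF this] obtain V \<phi> where V: "x \<in> V" "Q V \<phi>" by blast
    then have "fibre_coord X L V \<phi>" unfolding Q_def by blast
    then show "\<exists>V \<phi>'. x \<in> V \<and> fibre_coord X L V \<phi>' \<and> (\<forall>e\<in>total_space L. proj L e \<in> V \<inter> W \<longrightarrow> \<psi> e = \<phi>' e)"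
      using V \<psi>[OF _ _ V(2)] by blast
  qed
  moreover have "\<psi> (s y) = f y" if y: "y \<in> W \<inter> N" for y
  proof -
    obtain V \<phi> where V: "y \<in> V" "Q V \<phi>" using loc y by blast
    have "\<psi> (s y) = \<phi> (s y)" by (rule \<psi>[OF _ _ V(2)]) (use adapted_section[OF a, of y] V y in auto)
    then show ?thesis using V y unfolding Q_def by auto
  qed
  ultimately show ?thesis by blast
qed

text \<open>
  Every local equation \<open>f\<close> of \<open>D\<close> has a fibre coordinate of \<open>L\<close> in which \<open>s\<close> equals \<open>f\<close>. These
  coordinates satisfy the same transition rules as those of \<open>\<O>(D)\<close>, so the family of all of them
  is a vector of \<open>\<O>(D)\<close>.
\<close>

lemma adapted_iso:
  assumes a: "adapted L s"
  shows "isomorphic_bundles X L OD"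
proof -
  note L = adapted_bundle[OF a]
  define \<psi> where "\<psi> p = (SOME \<psi>. fibre_coord X L (fst p) \<psi> \<and> (\<forall>y\<in>fst p \<inter> N. \<psi> (s y) = snd p y))" for p
  have \<psi>: "fibre_coord X L W (\<psi> (W, f))" "\<And>y. y \<in> W \<inter> N \<Longrightarrow> \<psi> (W, f) (s y) = f y" if f: "(W, f) \<in> LE" for W f
    using someI_ex[OF adapted_coord[OF a f]] by (simp_all add: \<psi>_def)
  define F where "F e = (proj L e, \<lambda>p. if p \<in> LE \<and> proj L e \<in> fst p then \<psi> p e else 0)" for e
  have trans: "\<psi> (W', f') e = tr (W, f) (W', f') (proj L e) * \<psi> (W, f) e"
    if f: "(W, f) \<in> LE" "(W', f') \<in> LE" and e: "e \<in> total_space L" "proj L e \<in> W \<inter> W'" for W f W' f' e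
  proof -
    obtain g where g: "hol_unit X (W \<inter> W') g"
       "\<forall>e\<in>total_space L. proj L e \<in> W \<inter> W' \<longrightarrow> \<psi> (W', f') e = g (proj L e) * \<psi> (W, f) e"
      using fibre_coord_ratio[OF L \<psi>(1)[OF f(1)] \<psi>(1)[OF f(2)]] by blast
    have "g (proj L e) = tr (W, f) (W', f') (proj L e)"
    proof (rule tr_unique[OF f hol_unit_openin[OF g(1)] e(2) order_refl hol_unitD(1)[OF g(1)]])
      fix y assume y: "y \<in> W \<inter> W' \<inter> N"
      then have "f' y = \<psi> (W', f') (s y)" using \<psi>(2)[OF f(2)] by simp
      also have "\<dots> = g y * \<psi> (W, f) (s y)" using g(2) adapted_section[OF a, of y] y by auto
      also have "\<psi> (W, f) (s y) = f y" using \<psi>(2)[OF f(1)] y by simp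
      finally show "f' y = g y * f y" .
    qed
    then show ?thesis using g(2) e by simp
  qed
  have FT: "F e \<in> total_space OD" if e: "e \<in> total_space L" for e
    unfolding F_def OD_total
  proof (intro conjI allI impI)
    fix W f W' f' assume W: "(W, f) \<in> LE \<and> (W', f') \<in> LE \<and> proj L e \<in> W \<inter> W'"
    then show "(if (W', f') \<in> LE \<and> proj L e \<in> fst (W', f') then \<psi> (W', f') e else 0) =
      tr (W, f) (W', f') (proj L e) * (if (W, f) \<in> LE \<and> proj L e \<in> fst (W, f) then \<psi> (W, f) e else 0)"
      using trans[of W f W' f' e] e by simp
  qed (use is_line_bundleD(1)[OF L e] in auto)
  have cover: "\<exists>W f. (W, f) \<in> LE \<and> x \<in> W" if "x \<in> topspace (ctop X)" for x
    using K_cover[OF that] K_sub by blast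
  have "bij_betw F (total_space L) (total_space OD)"
    unfolding bij_betw_def
  proof
    show "inj_on F (total_space L)"
    proof (rule inj_onI)
      fix e e' assume e: "e \<in> total_space L" "e' \<in> total_space L" "F e = F e'"
      obtain W f where W: "(W, f) \<in> LE" "proj L e \<in> W" using cover is_line_bundleD(1)[OF L e(1)] by blast
      have p: "proj L e' = proj L e" using e(3) by (simp add: F_def)
      have "snd (F e) (W, f) = snd (F e') (W, f)" using e(3) by simp
      then have "\<psi> (W, f) e = \<psi> (W, f) e'" using W p by (simp add: F_def)
      then show "e = e'" using fibre_coord_inj[OF L \<psi>(1)[OF W(1)] W(2) e(1,2) p] by blast
    qed
    show "F ` total_space L = total_space OD"
    proof (intro equalityI subsetI)
      fix d assume d: "d \<in> total_space OD"
      obtain x \<xi> where x: "d = (x, \<xi>)" by (cases d)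
      note T = d[unfolded x OD_total]
      obtain W f where W: "(W, f) \<in> LE" "x \<in> W" using cover[OF T[THEN conjunct1]] by blast
      obtain e where e: "e \<in> total_space L" "proj L e = x" "\<psi> (W, f) e = \<xi> (W, f)"
        by (rule fibre_coord_surj[OF L \<psi>(1)[OF W(1)] W(2)])
      note T2 = T[THEN conjunct2, THEN conjunct1, rule_format]
      note T3 = T[THEN conjunct2, THEN conjunct2, rule_format]
      have "(if p \<in> LE \<and> proj L e \<in> fst p then \<psi> p e else 0) = \<xi> p" for p
      proof (cases "p \<in> LE \<and> x \<in> fst p")
        case True
        obtain W' f' where p: "p = (W', f')" by (cases p)
        have "\<psi> p e = tr (W, f) p x * \<psi> (W, f) e" using trans[OF W(1), of W' f' e] True p e W by simp
        moreover have "\<xi> (W', f') = tr (W, f) (W', f') x * \<xi> (W, f)"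
          by (rule T3) (use W True[unfolded p fst_conv] in blast)
        ultimately show ?thesis using True e p by simp
      next
        case False
        obtain W' f' where p: "p = (W', f')" by (cases p)
        have "\<xi> (W', f') = 0" by (rule T2) (use False[unfolded p fst_conv] in blast)
        then show ?thesis using False e(2) p by auto
      qed
      then have "F e = d" by (simp add: F_def x e(2))
      then show "d \<in> F ` total_space L" using e(1) by blast
    qed (use FT in blast)
  qed
  moreover have "fibre_coord X L V (\<eta> \<circ> F)" if V: "(V, \<eta>) \<in> coords OD" for V \<eta>
  proof -
    obtain f where f: "(V, f) \<in> LE" "\<eta> = (\<lambda>(x, \<xi>). \<xi> (V, f))" using V unfolding OD_coords_iff by blast
    show ?thesis
    proof (rule fibre_coord_local[OF L LE_open[OF f(1)]])
      fix x assume "x \<in> V"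
      then show "\<exists>U \<phi>'. x \<in> U \<and> fibre_coord X L U \<phi>' \<and> (\<forall>e\<in>total_space L. proj L e \<in> U \<inter> V \<longrightarrow> (\<eta> \<circ> F) e = \<phi>' e)"
        using \<psi>(1)[OF f(1)] f by (intro exI[of _ V] exI[of _ "\<psi> (V, f)"]) (simp add: F_def)
    qed
  qed
  ultimately have "bundle_iso X L OD F"
    unfolding bundle_iso_def using L OD_line_bundle by (auto simp: F_def OD_proj)
  then show ?thesis unfolding isomorphic_bundles_def by blast
qed

section \<open>A copy of the line bundle with total space a product\<close>

definition sel :: "'a \<Rightarrow> 'a set \<times> ('a \<Rightarrow> complex)" where
  "sel x = (SOME p. p \<in> \<K> \<and> x \<in> fst p)"

lemma sel: "x \<in> topspace (ctop X) \<Longrightarrow> sel x \<in> \<K> \<and> x \<in> fst (sel x)"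
  unfolding sel_def by (rule someI_ex) (use K_cover in force)

lemma tr_nonzero:
  assumes "p \<in> LE" "p' \<in> LE" "x \<in> fst p \<inter> fst p'"
  shows "tr p p' x \<noteq> 0"
  using hol_unitD(2)[OF tr(1)[of "fst p" "snd p" "fst p'" "snd p'"]] assms by simp

lemma tr_cocycle':
  assumes "p \<in> LE" "p' \<in> LE" "p'' \<in> LE" "x \<in> fst p \<inter> fst p' \<inter> fst p''"
  shows "tr p' p'' x * tr p p' x = tr p p'' x"
  using tr_cocycle[of "fst p" "snd p" "fst p'" "snd p'" "fst p''" "snd p''" x] assms by simp

text \<open>
  A copy of \<open>\<O>(D)\<close> with total space \<open>X \<times> \<complex>\<close>: over \<open>x\<close> the second component is the coordinate
  with respect to the selected equation at \<open>x\<close>.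
\<close>

definition flat_bundle :: "('a, 'a \<times> complex) line_bundle" where
  "flat_bundle = \<lparr> total_space = topspace (ctop X) \<times> UNIV, proj = fst,
     coords = (\<lambda>p. (fst p, \<lambda>(x, c). tr (sel x) p x * c)) ` \<K> \<rparr>"

lemma flat_bundle_simps:
  "total_space flat_bundle = topspace (ctop X) \<times> UNIV" "proj flat_bundle = fst"
  "coords flat_bundle = (\<lambda>p. (fst p, \<lambda>(x, c). tr (sel x) p x * c)) ` \<K>"
  by (simp_all add: flat_bundle_def)

lemma flat_bundle_is_line_bundle: "is_line_bundle X flat_bundle"
proof (rule is_line_bundleI)
  have K: "p \<in> LE" if "p \<in> \<K>" for p using that K_sub by blast
  have op: "openin (ctop X) (fst p)" if "p \<in> \<K>" for p using LE_open[of "fst p" "snd p"] K[OF that] by simp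
  have sel': "x \<in> topspace (ctop X)" "sel x \<in> LE" "x \<in> fst (sel x)" if "p \<in> \<K>" "x \<in> fst p" for p x
    using openin_subset[OF op[OF that(1)]] that(2) sel[of x] K by blast+
  show "proj flat_bundle e \<in> topspace (ctop X)" if "e \<in> total_space flat_bundle" for e
    using that by (auto simp: flat_bundle_simps)
  show "\<exists>U \<phi>. (U, \<phi>) \<in> coords flat_bundle \<and> x \<in> U" if "x \<in> topspace (ctop X)" for x
    unfolding flat_bundle_simps using sel[OF that] by blast
  show "openin (ctop X) U" if "(U, \<phi>) \<in> coords flat_bundle" for U \<phi>
    using that op unfolding flat_bundle_simps by blast
  show "bij_betw \<phi> {e \<in> total_space flat_bundle. proj flat_bundle e = x} UNIV"
    if U: "(U, \<phi>) \<in> coords flat_bundle" "x \<in> U" for U \<phi> x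
  proof -
    obtain p where p: "p \<in> \<K>" "U = fst p" "\<phi> = (\<lambda>(x, c). tr (sel x) p x * c)"
      using U unfolding flat_bundle_simps by blast
    have x: "x \<in> fst p" using U p by simp
    note s = sel'[OF p(1) x]
    have n: "tr (sel x) p x \<noteq> 0" by (rule tr_nonzero[OF s(2) K[OF p(1)]]) (use s x in blast)
    show ?thesis
      by (rule bij_betwI[of _ _ _ "\<lambda>c. (x, c / tr (sel x) p x)"]) (use n s in \<open>auto simp: flat_bundle_simps p\<close>)
  qed
  show "\<exists>g. hol_unit X (U \<inter> V) g \<and> (\<forall>e\<in>total_space flat_bundle. proj flat_bundle e \<in> U \<inter> V \<longrightarrow>
      \<eta> e = g (proj flat_bundle e) * \<phi> e)"
    if UV: "(U, \<phi>) \<in> coords flat_bundle" "(V, \<eta>) \<in> coords flat_bundle" for U \<phi> V \<eta>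
  proof -
    obtain p where p: "p \<in> \<K>" "U = fst p" "\<phi> = (\<lambda>(x, c). tr (sel x) p x * c)"
      using UV unfolding flat_bundle_simps by blast
    obtain p' where p': "p' \<in> \<K>" "V = fst p'" "\<eta> = (\<lambda>(x, c). tr (sel x) p' x * c)"
      using UV unfolding flat_bundle_simps by blast
    have "hol_unit X (U \<inter> V) (tr p p')"
      using tr(1)[of "fst p" "snd p" "fst p'" "snd p'"] K p p' by simp
    moreover have "\<eta> e = tr p p' (proj flat_bundle e) * \<phi> e"
      if e: "e \<in> total_space flat_bundle" "proj flat_bundle e \<in> U \<inter> V" for e
    proof -
      obtain x c where x: "e = (x, c)" by (cases e)
      have xx: "x \<in> fst p" "x \<in> fst p'" using e p p' x by (auto simp: flat_bundle_simps)
      note s = sel'[OF p(1) xx(1)]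
      have "tr p p' x * tr (sel x) p x = tr (sel x) p' x"
        by (rule tr_cocycle'[OF s(2) K[OF p(1)] K[OF p'(1)]]) (use s xx in blast)
      then show ?thesis by (simp add: x p p' flat_bundle_simps mult.assoc[symmetric])
    qed
    ultimately show ?thesis by blast
  qed
qed

lemma flat_bundle_coord:
  assumes "p \<in> \<K>"
  shows "fibre_coord X flat_bundle (fst p) (\<lambda>(x, c). tr (sel x) p x * c)"
  by (rule fibre_coord_of_coords[OF flat_bundle_is_line_bundle]) (use assms in \<open>auto simp: flat_bundle_simps\<close>)

lemma flat_bundle_ratio:
  assumes "p \<in> \<K>" "p' \<in> \<K>" "x \<in> fst p \<inter> fst p'"
  shows "tr (sel x) p' x * c = tr p p' x * (tr (sel x) p x * c)"
proof -
  have K: "p \<in> LE" "p' \<in> LE" using assms K_sub by blast+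
  have "x \<in> topspace (ctop X)" using LE_open[of "fst p" "snd p"] K(1) assms(3) openin_subset by auto
  then have s: "sel x \<in> LE" "x \<in> fst (sel x)" using sel K_sub by blast+
  have "tr p p' x * tr (sel x) p x = tr (sel x) p' x"
    by (rule tr_cocycle'[OF s(1) K]) (use s assms in blast)
  then show ?thesis by (simp add: mult.assoc[symmetric])
qed

end

section \<open>Blowing up preserves complex surfaces\<close>

lemma complex_atlasI:
  assumes "\<And>D \<psi>. (D, \<psi>) \<in> A \<Longrightarrow> open D" "\<And>D \<psi>. (D, \<psi>) \<in> A \<Longrightarrow> inj_on \<psi> D"
    "\<And>D \<psi> E \<theta> z w. (D, \<psi>) \<in> A \<Longrightarrow> (E, \<theta>) \<in> A \<Longrightarrow> z \<in> D \<Longrightarrow> w \<in> E \<Longrightarrow> \<psi> z = \<theta> w \<Longrightarrow> trans_at D \<psi> E \<theta> z"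
  shows "complex_atlas A"
  unfolding complex_atlas_def
proof (intro conjI)
  show "\<forall>(D, \<psi>)\<in>A. open D \<and> inj_on \<psi> D" using assms(1,2) by auto
  show "\<forall>(D, \<psi>)\<in>A. \<forall>(E, \<theta>)\<in>A. \<forall>z\<in>D. \<psi> z \<in> \<theta> ` E \<longrightarrow> trans_at D \<psi> E \<theta> z"
  proof clarify
    fix D \<psi> E \<theta> a b c d
    assume "(D, \<psi>) \<in> A" "(E, \<theta>) \<in> A" "(a, b) \<in> D" "\<psi> (a, b) = \<theta> (c, d)" "(c, d) \<in> E"
    then show "trans_at D \<psi> E \<theta> (a, b)" using assms(3) by blast
  qed
qed

lemma complex_atlas_subset:
  assumes "complex_atlas B" "A \<subseteq> B"
  shows "complex_atlas A"
proof -
  interpret B: surface B by standard (rule assms(1))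
  show ?thesis
    by (rule complex_atlasI) (use assms(2) B.chart_dom B.chart_inj B.chart_trans in \<open>metis imageI subsetD\<close>)+
qed

lemma trans_atI:
  assumes "open U" "z \<in> U" "U \<subseteq> D" "holomorphic2_on \<tau>1 U" "holomorphic2_on \<tau>2 U"
    "\<And>w. w \<in> U \<Longrightarrow> (\<tau>1 w, \<tau>2 w) \<in> E" "\<And>w. w \<in> U \<Longrightarrow> \<theta> (\<tau>1 w, \<tau>2 w) = \<psi> w"
  shows "trans_at D \<psi> E \<theta> z"
  unfolding trans_at_def using assms by blast

lemma holomorphic2_on_divide:
  assumes "holomorphic2_on f D" "holomorphic2_on g D" "\<And>z. z \<in> D \<Longrightarrow> g z \<noteq> 0"
  shows "holomorphic2_on (\<lambda>z. f z / g z) D"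
  unfolding divide_inverse by (intro holomorphic2_on_mult holomorphic2_on_inverse assms)

lemmas holomorphic2_intros = holomorphic2_on_const holomorphic2_on_fst holomorphic2_on_snd
  holomorphic2_on_mult holomorphic2_on_divide holomorphic2_on_add

lemma open_fst_neq: "open {z :: complex \<times> complex. fst z \<noteq> 0}"
  and open_snd_neq: "open {z :: complex \<times> complex. snd z \<noteq> 0}"
  by (intro open_Collect_neq continuous_intros)+

context
  fixes B :: "'a atlas2" and K :: "(complex \<times> complex \<Rightarrow> 'a) set"
  assumes B: "complex_atlas B" and K: "\<And>\<kappa>. \<kappa> \<in> K \<Longrightarrow> (UNIV, \<kappa>) \<in> B" and finK: "finite K"
    and sep: "\<And>\<kappa> \<kappa>'. \<kappa> \<in> K \<Longrightarrow> \<kappa>' \<in> K \<Longrightarrow> centre \<kappa> \<in> range \<kappa>' \<Longrightarrow> \<kappa> = \<kappa>'"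
begin

private abbreviation off :: "(complex \<times> complex) set \<Rightarrow> (complex \<times> complex \<Rightarrow> 'a) \<Rightarrow> (complex \<times> complex) set" where
  "off D \<psi> \<equiv> {z \<in> D. \<psi> z \<notin> centre ` K}"

interpretation B: surface B by standard (rule B)

lemma off_open:
  assumes D: "(D, \<psi>) \<in> B"
  shows "open (off D \<psi>)"
proof -
  have "finite (\<psi> -` (centre ` K) \<inter> D)" by (rule finite_vimage_IntI) (use finK B.chart_inj[OF D] in auto)
  then have "closed (\<psi> -` (centre ` K) \<inter> D)" by (rule finite_imp_closed)
  moreover have "off D \<psi> = D - (\<psi> -` (centre ` K) \<inter> D)" by auto
  ultimately show ?thesis using B.chart_dom[OF D] by (simp add: open_Diff)
qed

lemma centre_iff:
  assumes "\<kappa> \<in> K"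
  shows "\<kappa> z \<in> centre ` K \<longleftrightarrow> z = (0, 0)"
proof
  assume "\<kappa> z \<in> centre ` K"
  then obtain \<kappa>' where k: "\<kappa>' \<in> K" "\<kappa> z = centre \<kappa>'" by auto
  then have "\<kappa>' = \<kappa>" using sep[of \<kappa>' \<kappa>] assms by (metis rangeI)
  then have "\<kappa> z = \<kappa> (0, 0)" using k by (simp add: centre_def)
  then show "z = (0, 0)" using injD[OF B.chart_inj[OF K[OF assms]]] by blast
qed (use assms in \<open>auto simp: centre_def\<close>)

lemma chart1_simps:
  "blowup_chart1 \<kappa> z = Exc c d \<longleftrightarrow> fst z = 0 \<and> c = centre \<kappa> \<and> d = Aff (snd z)"
  "blowup_chart1 \<kappa> z = Pt p \<longleftrightarrow> fst z \<noteq> 0 \<and> p = \<kappa> (fst z, fst z * snd z)"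
  by (auto simp: blowup_chart1_def split_beta)

lemma chart2_simps:
  "blowup_chart2 \<kappa> z = Exc c d \<longleftrightarrow> snd z = 0 \<and> c = centre \<kappa> \<and> d = aff_inv (fst z)"
  "blowup_chart2 \<kappa> z = Pt p \<longleftrightarrow> snd z \<noteq> 0 \<and> p = \<kappa> (fst z * snd z, snd z)"
  by (auto simp: blowup_chart2_def split_beta)

lemma aff_inv_eq: "aff_inv u = aff_inv v \<longleftrightarrow> u = v" "aff_inv u = Aff v \<longleftrightarrow> v \<noteq> 0 \<and> u = 1 / v"
  by (auto simp: aff_inv_def eq_divide_eq divide_eq_eq mult.commute)

lemma chart1_inj:
  assumes "\<kappa> \<in> K"
  shows "inj (blowup_chart1 \<kappa>)"
proof (rule injI)
  fix z w assume eq: "blowup_chart1 \<kappa> z = blowup_chart1 \<kappa> w"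
  show "z = w"
  proof (cases "blowup_chart1 \<kappa> w")
    case (Pt p)
    then have "\<kappa> (fst z, fst z * snd z) = \<kappa> (fst w, fst w * snd w)" "fst w \<noteq> 0"
      using eq chart1_simps(2)[of \<kappa> z p] chart1_simps(2)[of \<kappa> w p] by auto
    then show ?thesis using injD[OF B.chart_inj[OF K[OF assms]]] by (fastforce simp: prod_eq_iff)
  next
    case (Exc c d)
    then show ?thesis using eq chart1_simps(1)[of \<kappa> z c d] chart1_simps(1)[of \<kappa> w c d] by (auto simp: prod_eq_iff)
  qed
qed

lemma chart2_inj:
  assumes "\<kappa> \<in> K"
  shows "inj (blowup_chart2 \<kappa>)"
proof (rule injI)
  fix z w assume eq: "blowup_chart2 \<kappa> z = blowup_chart2 \<kappa> w"
  show "z = w"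
  proof (cases "blowup_chart2 \<kappa> w")
    case (Pt p)
    then have "\<kappa> (fst z * snd z, snd z) = \<kappa> (fst w * snd w, snd w)" "snd w \<noteq> 0"
      using eq chart2_simps(2)[of \<kappa> z p] chart2_simps(2)[of \<kappa> w p] by auto
    then show ?thesis using injD[OF B.chart_inj[OF K[OF assms]]] by (fastforce simp: prod_eq_iff)
  next
    case (Exc c d)
    then show ?thesis using eq chart2_simps(1)[of \<kappa> z c d] chart2_simps(1)[of \<kappa> w c d] 
      by (auto simp: prod_eq_iff aff_inv_eq)
  qed
qed

lemma trans_off:
  assumes D: "(D, \<psi>) \<in> B" and E: "(E, \<theta>) \<in> B" and z: "z \<in> off D \<psi>" "w \<in> off E \<theta>" "\<psi> z = \<theta> w"
  shows "trans_at (off D \<psi>) (Pt \<circ> \<psi>) (off E \<theta>) (Pt \<circ> \<theta>) z"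
proof -
  have "trans_at D \<psi> E \<theta> z" by (rule B.chart_trans[OF D E]) (use z in auto)
  then obtain U \<tau>1 \<tau>2 where U: "open U" "z \<in> U" "U \<subseteq> D" "holomorphic2_on \<tau>1 U" "holomorphic2_on \<tau>2 U"
    "\<And>w. w \<in> U \<Longrightarrow> (\<tau>1 w, \<tau>2 w) \<in> E" "\<And>w. w \<in> U \<Longrightarrow> \<theta> (\<tau>1 w, \<tau>2 w) = \<psi> w"
    unfolding trans_at_def by blast
  show ?thesis
    by (rule trans_atI[of "U \<inter> off D \<psi>" _ _ \<tau>1 \<tau>2])
      (use U z off_open[OF D] in \<open>auto elim: holomorphic2_on_subset\<close>)
qed

lemma trans_chart1_off:
  assumes k: "\<kappa> \<in> K" and z: "fst z \<noteq> 0"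
  shows "trans_at UNIV (blowup_chart1 \<kappa>) (off UNIV \<kappa>) (Pt \<circ> \<kappa>) z"
  by (rule trans_atI[of "{z. fst z \<noteq> 0}" _ _ fst "\<lambda>z. fst z * snd z"])
    (use z centre_iff[OF k] in \<open>auto intro!: holomorphic2_intros simp: open_fst_neq blowup_chart1_def\<close>)

lemma trans_chart2_off:
  assumes k: "\<kappa> \<in> K" and z: "snd z \<noteq> 0"
  shows "trans_at UNIV (blowup_chart2 \<kappa>) (off UNIV \<kappa>) (Pt \<circ> \<kappa>) z"
  by (rule trans_atI[of "{z. snd z \<noteq> 0}" _ _ "\<lambda>z. fst z * snd z" snd])
    (use z centre_iff[OF k] in \<open>auto intro!: holomorphic2_intros simp: open_snd_neq blowup_chart2_def\<close>)

lemma trans_off_chart1: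
  assumes k: "\<kappa> \<in> K" and z: "fst z \<noteq> 0"
  shows "trans_at (off UNIV \<kappa>) (Pt \<circ> \<kappa>) UNIV (blowup_chart1 \<kappa>) z"
  by (rule trans_atI[of "{z. fst z \<noteq> 0}" _ _ fst "\<lambda>z. snd z / fst z"])
    (use z centre_iff[OF k] in \<open>auto intro!: holomorphic2_intros simp: open_fst_neq blowup_chart1_def\<close>)

lemma trans_off_chart2:
  assumes k: "\<kappa> \<in> K" and z: "snd z \<noteq> 0"
  shows "trans_at (off UNIV \<kappa>) (Pt \<circ> \<kappa>) UNIV (blowup_chart2 \<kappa>) z"
  by (rule trans_atI[of "{z. snd z \<noteq> 0}" _ _ "\<lambda>z. fst z / snd z" snd])
    (use z centre_iff[OF k] in \<open>auto intro!: holomorphic2_intros simp: open_snd_neq blowup_chart2_def\<close>)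

lemma trans_chart1_chart2:
  assumes z: "snd z \<noteq> 0"
  shows "trans_at UNIV (blowup_chart1 \<kappa>) UNIV (blowup_chart2 \<kappa>) z"
  by (rule trans_atI[of "{z. snd z \<noteq> 0}" _ _ "\<lambda>z. 1 / snd z" "\<lambda>z. fst z * snd z"])
    (use z in \<open>auto intro!: holomorphic2_intros simp: open_snd_neq blowup_chart1_def blowup_chart2_def aff_inv_def\<close>)

lemma trans_chart2_chart1:
  assumes z: "fst z \<noteq> 0"
  shows "trans_at UNIV (blowup_chart2 \<kappa>) UNIV (blowup_chart1 \<kappa>) z"
  by (rule trans_atI[of "{z. fst z \<noteq> 0}" _ _ "\<lambda>z. fst z * snd z" "\<lambda>z. 1 / fst z"])
    (use z in \<open>auto intro!: holomorphic2_intros simp: open_fst_neq blowup_chart1_def blowup_chart2_def aff_inv_def\<close>)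

lemma blowup_atlas_cases:
  assumes "(E, \<theta>) \<in> blowup_atlas B K"
  obtains (off) D \<psi> where "(D, \<psi>) \<in> B" "E = off D \<psi>" "\<theta> = Pt \<circ> \<psi>"
  | (chart1) \<kappa> where "\<kappa> \<in> K" "E = UNIV" "\<theta> = blowup_chart1 \<kappa>"
  | (chart2) \<kappa> where "\<kappa> \<in> K" "E = UNIV" "\<theta> = blowup_chart2 \<kappa>"
  using assms unfolding blowup_atlas_def by auto

lemma blowup_inj:
  assumes "(E, \<theta>) \<in> blowup_atlas B K"
  shows "inj_on \<theta> E"
  using assms
proof (cases rule: blowup_atlas_cases)
  case (off D \<psi>)
  then show ?thesis using B.chart_inj[of D \<psi>] by (auto simp: inj_on_def)
qed (use chart1_inj chart2_inj in auto)

text \<open>Away from the exceptional curves every chart factors through a chart of the original surface.\<close>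

lemma blowup_to_off:
  assumes E: "(E, \<theta>) \<in> blowup_atlas B K" and z: "z \<in> E" "\<theta> z = Pt p"
  shows "\<exists>D \<psi> w. (D, \<psi>) \<in> B \<and> w \<in> off D \<psi> \<and> \<psi> w = p \<and> trans_at E \<theta> (off D \<psi>) (Pt \<circ> \<psi>) z \<and>
      trans_at (off D \<psi>) (Pt \<circ> \<psi>) E \<theta> w"
  using E
proof (cases rule: blowup_atlas_cases)
  case (off D \<psi>)
  then show ?thesis using z trans_off[of D \<psi> D \<psi> z z] by (intro exI[of _ D] exI[of _ \<psi>] exI[of _ z]) auto
next
  case (chart1 \<kappa>)
  then have f: "fst z \<noteq> 0" "p = \<kappa> (fst z, fst z * snd z)" using z chart1_simps(2)[of \<kappa> z p] by auto
  then show ?thesis using chart1 K[OF chart1(1)] centre_iff[OF chart1(1)] trans_chart1_off[OF chart1(1), of z]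
      trans_off_chart1[OF chart1(1), of "(fst z, fst z * snd z)"]
    by (intro exI[of _ UNIV] exI[of _ \<kappa>] exI[of _ "(fst z, fst z * snd z)"]) auto
next
  case (chart2 \<kappa>)
  then have f: "snd z \<noteq> 0" "p = \<kappa> (fst z * snd z, snd z)" using z chart2_simps(2)[of \<kappa> z p] by auto
  then show ?thesis using chart2 K[OF chart2(1)] centre_iff[OF chart2(1)] trans_chart2_off[OF chart2(1), of z]
      trans_off_chart2[OF chart2(1), of "(fst z * snd z, snd z)"]
    by (intro exI[of _ UNIV] exI[of _ \<kappa>] exI[of _ "(fst z * snd z, snd z)"]) auto
qed

lemma centre_inj: "\<kappa> \<in> K \<Longrightarrow> \<kappa>' \<in> K \<Longrightarrow> centre \<kappa> = centre \<kappa>' \<Longrightarrow> \<kappa> = \<kappa>'"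
  using sep[of \<kappa> \<kappa>'] by (simp add: centre_def)

text \<open>
  At a point that is not exceptional, all transitions factor through the original surface. An
  exceptional point lies only in the two patches over its own centre, between which the transition
  is \<open>(x, v) \<mapsto> (1 / v, x v)\<close>.
\<close>

lemma complex_atlas_blowup: "complex_atlas (blowup_atlas B K)"
proof (rule complex_atlasI)
  show "open E" if "(E, \<theta>) \<in> blowup_atlas B K" for E \<theta>
    using that by (cases rule: blowup_atlas_cases) (auto simp: off_open)
  show "inj_on \<theta> E" if "(E, \<theta>) \<in> blowup_atlas B K" for E \<theta> using blowup_inj[OF that] .
  fix D \<psi> E \<theta> z w
  assume D: "(D, \<psi>) \<in> blowup_atlas B K" and E: "(E, \<theta>) \<in> blowup_atlas B K"
    and z: "z \<in> D" and w: "w \<in> E" and eq: "\<psi> z = \<theta> w"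
  show "trans_at D \<psi> E \<theta> z"
  proof (cases "\<psi> z")
    case (Pt p)
    obtain D1 \<psi>1 z1 where 1: "(D1, \<psi>1) \<in> B" "z1 \<in> off D1 \<psi>1" "\<psi>1 z1 = p"
      "trans_at D \<psi> (off D1 \<psi>1) (Pt \<circ> \<psi>1) z"
      using blowup_to_off[OF D z Pt] by blast
    obtain E1 \<theta>1 w1 where 2: "(E1, \<theta>1) \<in> B" "w1 \<in> off E1 \<theta>1" "\<theta>1 w1 = p"
      "trans_at (off E1 \<theta>1) (Pt \<circ> \<theta>1) E \<theta> w1"
      using blowup_to_off[OF E w, of p] Pt eq by auto
    have inj: "inj_on (Pt \<circ> \<psi>1) (off D1 \<psi>1)" "inj_on (Pt \<circ> \<theta>1) (off E1 \<theta>1)"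
      using B.chart_inj[OF 1(1)] B.chart_inj[OF 2(1)] by (auto simp: inj_on_def)
    have "trans_at (off D1 \<psi>1) (Pt \<circ> \<psi>1) (off E1 \<theta>1) (Pt \<circ> \<theta>1) z1"
      by (rule trans_off[OF 1(1) 2(1) 1(2) 2(2)]) (use 1 2 in simp)
    from trans_at_trans[OF this 2(4) 2(2) _ inj(2)] 1 2
    have "trans_at (off D1 \<psi>1) (Pt \<circ> \<psi>1) E \<theta> z1" by simp
    from trans_at_trans[OF 1(4) this 1(2) _ inj(1)] 1 Pt show ?thesis by simp
  next
    case (Exc c d)
    show ?thesis using D
    proof (cases rule: blowup_atlas_cases)
      case (chart1 \<kappa>)
      note a = this
      show ?thesis using E
      proof (cases rule: blowup_atlas_cases)
        case (chart1 \<kappa>')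
        then have "\<kappa>' = \<kappa>" using a Exc eq centre_inj chart1_simps(1)[of \<kappa> z c d] chart1_simps(1)[of \<kappa>' w c d] by simp
        then show ?thesis using a chart1 trans_at_refl[of UNIV z UNIV] by simp
      next
        case (chart2 \<kappa>')
        then have "\<kappa>' = \<kappa>" "aff_inv (fst w) = Aff (snd z)"
          using a Exc eq centre_inj chart1_simps(1)[of \<kappa> z c d] chart2_simps(1)[of \<kappa>' w c d] by auto
        then show ?thesis using a chart2 trans_chart1_chart2[of z] by (simp add: aff_inv_eq)
      qed (use Exc eq in auto)
    next
      case (chart2 \<kappa>)
      note a = this
      show ?thesis using E
      proof (cases rule: blowup_atlas_cases)
        case (chart1 \<kappa>')
        then have "\<kappa>' = \<kappa>" "aff_inv (fst z) = Aff (snd w)"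
          using a Exc eq centre_inj chart2_simps(1)[of \<kappa> z c d] chart1_simps(1)[of \<kappa>' w c d] by auto
        then show ?thesis using a chart1 trans_chart2_chart1[of z] by (auto simp: aff_inv_eq)
      next
        case (chart2 \<kappa>')
        then have "\<kappa>' = \<kappa>" using a Exc eq centre_inj chart2_simps(1)[of \<kappa> z c d] chart2_simps(1)[of \<kappa>' w c d] by simp
        then show ?thesis using a chart2 trans_at_refl[of UNIV z UNIV] by simp
      qed (use Exc eq in auto)
    qed (use Exc in auto)
  qed
qed

end

section \<open>The atlas of the blown-up surface\<close>

text \<open>
  The charts of the projective line that occur as factors, including the one centred at \<open>1\<close>.
\<close>

definition line_charts :: "(complex \<Rightarrow> proj_line) set" where
  "line_charts = {Aff, aff_inv, \<lambda>y. Aff (1 + y)}"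

lemma line_charts_inj: "\<alpha> \<in> line_charts \<Longrightarrow> inj \<alpha>"
  by (auto simp: line_charts_def inj_def aff_inv_def field_simps split: if_splits)

lemma line_charts_trans:
  assumes "\<alpha> \<in> line_charts" "\<beta> \<in> line_charts" "\<alpha> x = \<beta> y"
  shows "\<exists>U \<tau>. open U \<and> x \<in> U \<and> \<tau> holomorphic_on U \<and> (\<forall>w\<in>U. \<beta> (\<tau> w) = \<alpha> w)"
proof -
  have *: ?thesis if "open U" "x \<in> U" "\<tau> holomorphic_on U" "\<And>w. w \<in> U \<Longrightarrow> \<beta> (\<tau> w) = \<alpha> w" for U \<tau>
    using that by blast
  have op: "open (- {0 :: complex})" "open (- {- 1 :: complex})" by auto
  consider "\<alpha> = \<beta>" | "\<alpha> = Aff" "\<beta> = aff_inv" | "\<alpha> = Aff" "\<beta> = (\<lambda>y. Aff (1 + y))"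
    | "\<alpha> = aff_inv" "\<beta> = Aff" | "\<alpha> = aff_inv" "\<beta> = (\<lambda>y. Aff (1 + y))"
    | "\<alpha> = (\<lambda>y. Aff (1 + y))" "\<beta> = Aff" | "\<alpha> = (\<lambda>y. Aff (1 + y))" "\<beta> = aff_inv"
    using assms(1,2) unfolding line_charts_def by auto
  then show ?thesis
  proof cases
    case 1
    show ?thesis by (rule *[of UNIV "\<lambda>w. w"]) (use 1 in auto)
  next
    case 2
    show ?thesis by (rule *[OF op(1), of "\<lambda>w. 1 / w"])
      (use 2 assms(3) in \<open>auto intro!: holomorphic_intros simp: aff_inv_def split: if_splits\<close>)
  next
    case 3
    show ?thesis by (rule *[of UNIV "\<lambda>w. w - 1"]) (use 3 in \<open>auto intro!: holomorphic_intros\<close>)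
  next
    case 4
    show ?thesis by (rule *[OF op(1), of "\<lambda>w. 1 / w"])
      (use 4 assms(3) in \<open>auto intro!: holomorphic_intros simp: aff_inv_def split: if_splits\<close>)
  next
    case 5
    show ?thesis by (rule *[OF op(1), of "\<lambda>w. 1 / w - 1"])
      (use 5 assms(3) in \<open>auto intro!: holomorphic_intros simp: aff_inv_def split: if_splits\<close>)
  next
    case 6
    show ?thesis by (rule *[of UNIV "\<lambda>w. 1 + w"]) (use 6 in \<open>auto intro!: holomorphic_intros\<close>)
  next
    case 7
    have ne: "1 + w \<noteq> 0" if "w \<in> - {- 1}" for w :: complex
      using that by (metis ComplD add_eq_0_iff insertI1)
    show ?thesis
    proof (rule *[OF op(2), of "\<lambda>w. 1 / (1 + w)"])
      show "x \<in> - {- 1}" using 7 assms(3) by (auto simp: aff_inv_def split: if_splits)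
      show "(\<lambda>w. 1 / (1 + w)) holomorphic_on - {- 1}" using ne by (auto intro!: holomorphic_intros)
      show "\<beta> (1 / (1 + w)) = \<alpha> w" if "w \<in> - {- 1}" for w using ne[OF that] 7 by (simp add: aff_inv_def)
    qed
  qed
qed

lemma holomorphic2_on_of_fst:
  assumes "f holomorphic_on U" "open U"
  shows "holomorphic2_on (\<lambda>z. f (fst z)) (U \<times> V)"
  unfolding holomorphic2_on_def
proof
  fix z assume z: "z \<in> U \<times> V"
  then have "(f has_derivative (*) (deriv f (fst z))) (at (fst z))"
    using holomorphic_derivI[OF assms, of "fst z" UNIV] by (auto simp: has_field_derivative_def)
  from has_derivative_compose[OF has_derivative_fst[OF has_derivative_ident] this]
  show "\<exists>a b. ((\<lambda>z. f (fst z)) has_derivative (\<lambda>h. a * fst h + b * snd h)) (at z)"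
    by (intro exI[of _ "deriv f (fst z)"] exI[of _ 0]) simp
qed

lemma holomorphic2_on_of_snd:
  assumes "f holomorphic_on V" "open V"
  shows "holomorphic2_on (\<lambda>z. f (snd z)) (U \<times> V)"
  unfolding holomorphic2_on_def
proof
  fix z assume z: "z \<in> U \<times> V"
  then have "(f has_derivative (*) (deriv f (snd z))) (at (snd z))"
    using holomorphic_derivI[OF assms, of "snd z" UNIV] by (auto simp: has_field_derivative_def)
  from has_derivative_compose[OF has_derivative_snd[OF has_derivative_ident] this]
  show "\<exists>a b. ((\<lambda>z. f (snd z)) has_derivative (\<lambda>h. a * fst h + b * snd h)) (at z)"
    by (intro exI[of _ 0] exI[of _ "deriv f (snd z)"]) simp
qed

definition product_atlas :: "(proj_line \<times> proj_line) atlas2" where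
  "product_atlas = {(UNIV, \<lambda>(x, y). (\<alpha> x, \<beta> y)) | \<alpha> \<beta>. \<alpha> \<in> line_charts \<and> \<beta> \<in> line_charts}"

lemma complex_atlas_product: "complex_atlas product_atlas"
proof (rule complex_atlasI)
  show "open D" if "(D, \<psi>) \<in> product_atlas" for D \<psi> using that by (auto simp: product_atlas_def)
  show "inj_on \<psi> D" if "(D, \<psi>) \<in> product_atlas" for D \<psi>
  proof -
    obtain \<alpha> \<beta> where D: "D = UNIV" "\<psi> = (\<lambda>(x, y). (\<alpha> x, \<beta> y))" "\<alpha> \<in> line_charts" "\<beta> \<in> line_charts"
      using \<open>(D, \<psi>) \<in> product_atlas\<close> by (auto simp: product_atlas_def)
    then show ?thesis using line_charts_inj[OF D(3)] line_charts_inj[OF D(4)] by (auto simp: inj_def)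
  qed
  fix D \<psi> E \<theta> z w
  assume D: "(D, \<psi>) \<in> product_atlas" and E: "(E, \<theta>) \<in> product_atlas" and eq: "\<psi> z = \<theta> w"
  obtain \<alpha> \<beta> where 1: "D = UNIV" "\<psi> = (\<lambda>(x, y). (\<alpha> x, \<beta> y))" "\<alpha> \<in> line_charts" "\<beta> \<in> line_charts"
    using D by (auto simp: product_atlas_def)
  obtain \<alpha>' \<beta>' where 2: "E = UNIV" "\<theta> = (\<lambda>(x, y). (\<alpha>' x, \<beta>' y))" "\<alpha>' \<in> line_charts" "\<beta>' \<in> line_charts"
    using E by (auto simp: product_atlas_def)
  have "\<alpha> (fst z) = \<alpha>' (fst w)" "\<beta> (snd z) = \<beta>' (snd w)" using eq 1 2 by (auto simp: split_beta)
  from line_charts_trans[OF 1(3) 2(3) this(1)] line_charts_trans[OF 1(4) 2(4) this(2)]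
  obtain U \<tau> V \<sigma> where *: "open U" "fst z \<in> U" "\<tau> holomorphic_on U" "\<forall>w\<in>U. \<alpha>' (\<tau> w) = \<alpha> w"
    "open V" "snd z \<in> V" "\<sigma> holomorphic_on V" "\<forall>w\<in>V. \<beta>' (\<sigma> w) = \<beta> w" by blast
  show "trans_at D \<psi> E \<theta> z"
    by (rule trans_atI[of "U \<times> V" _ _ "\<lambda>z. \<tau> (fst z)" "\<lambda>z. \<sigma> (snd z)"])
      (use * 1 2 in \<open>auto simp: open_Times mem_Times_iff intro: holomorphic2_on_of_fst holomorphic2_on_of_snd\<close>)
qed

text \<open>
  The patch around \<open>(0, 1)\<close> does not belong to the standard atlas of the product of two projective
  lines, but it is compatible with it; so one blows up in a larger atlas.
\<close>

lemma complex_atlas_Mtilde: "complex_atlas (blowup_atlas p1p1_atlas centre_charts)"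
proof (rule complex_atlas_subset)
  show "complex_atlas (blowup_atlas product_atlas centre_charts)"
  proof (rule complex_atlas_blowup[OF complex_atlas_product])
    show "(UNIV, \<kappa>) \<in> product_atlas" if "\<kappa> \<in> centre_charts" for \<kappa>
      using that unfolding centre_charts_def product_atlas_def line_charts_def by auto
    show "finite centre_charts" by (simp add: centre_charts_def)
    show "\<kappa> = \<kappa>'" if "\<kappa> \<in> centre_charts" "\<kappa>' \<in> centre_charts" "centre \<kappa> \<in> range \<kappa>'" for \<kappa> \<kappa>'
      using that by (auto simp: centre_charts_def centre_def aff_inv_def split: if_splits)
  qed
  have "p1p1_atlas \<subseteq> product_atlas"
    unfolding p1p1_atlas_def product_atlas_def line_charts_def by blast
  then show "blowup_atlas p1p1_atlas centre_charts \<subseteq> blowup_atlas product_atlas centre_charts"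
    unfolding blowup_atlas_def by blast
qed

section \<open>Charts and boundary curves\<close>

text \<open>
  \<open>T\<close>, \<open>S\<close>, \<open>Q\<close>, \<open>R\<close> stand for the coordinates \<open>t\<close>, \<open>1 / t\<close>, \<open>q\<close>, \<open>1 / q\<close>; \<open>E1\<close>, \<open>E0\<close>, \<open>EI\<close> for the patches along
  the exceptional curves over \<open>(0, 1)\<close>, \<open>(\<infinity>, 0)\<close>, \<open>(\<infinity>, \<infinity>)\<close>.
\<close>

datatype chart = TQ | SQ | TR | SR | E1a | E1b | E0a | E0b | EIa | EIb

lemma UNIV_chart: "(UNIV :: chart set) = {TQ, SQ, TR, SR, E1a, E0a, EIa, E1b, E0b, EIb}"
  by (auto intro: chart.exhaust)

definition chart_dom :: "chart \<Rightarrow> (complex \<times> complex) set" where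
  "chart_dom i = (case i of TQ \<Rightarrow> - {(0, 1)} | SQ \<Rightarrow> - {(0, 0)} | TR \<Rightarrow> - {(0, 1)} | SR \<Rightarrow> - {(0, 0)} | _ \<Rightarrow> UNIV)"

fun chart_map :: "chart \<Rightarrow> complex \<times> complex \<Rightarrow> point" where
  "chart_map TQ (a, b) = Pt (Aff a, Aff b)"
| "chart_map SQ (a, b) = Pt (aff_inv a, Aff b)"
| "chart_map TR (a, b) = Pt (Aff a, aff_inv b)"
| "chart_map SR (a, b) = Pt (aff_inv a, aff_inv b)"
| "chart_map E1a (a, b) = (if a = 0 then Exc (Aff 0, Aff 1) (Aff b) else Pt (Aff a, Aff (1 + a * b)))"
| "chart_map E1b (a, b) = (if b = 0 then Exc (Aff 0, Aff 1) (aff_inv a) else Pt (Aff (a * b), Aff (1 + b)))"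
| "chart_map E0a (a, b) = (if a = 0 then Exc (Infty, Aff 0) (Aff b) else Pt (aff_inv a, Aff (a * b)))"
| "chart_map E0b (a, b) = (if b = 0 then Exc (Infty, Aff 0) (aff_inv a) else Pt (aff_inv (a * b), Aff b))"
| "chart_map EIa (a, b) = (if a = 0 then Exc (Infty, Infty) (Aff b) else Pt (aff_inv a, aff_inv (a * b)))"
| "chart_map EIb (a, b) = (if b = 0 then Exc (Infty, Infty) (aff_inv a) else Pt (aff_inv (a * b), aff_inv b))"

abbreviation Matlas :: "point atlas2" where
  "Matlas \<equiv> blowup_atlas p1p1_atlas centre_charts"

lemma centres: "centre ` centre_charts = {(Aff 0, Aff 1), (Infty, Aff 0), (Infty, Infty)}"
  by (simp add: centre_charts_def centre_def aff_inv_def)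

lemma aff_inv_0: "aff_inv 0 = Infty"
  by (simp add: aff_inv_def)

lemma aff_inv_simps: "aff_inv a = Infty \<longleftrightarrow> a = 0" "aff_inv a = Aff c \<longleftrightarrow> c \<noteq> 0 \<and> a * c = 1"
  by (auto simp: aff_inv_def field_simps)

lemma aff_inv_simps': "Infty = aff_inv a \<longleftrightarrow> a = 0" "Aff c = aff_inv a \<longleftrightarrow> c \<noteq> 0 \<and> a * c = 1"
  using aff_inv_simps by metis+

lemma Matlas_eq: "Matlas = range (\<lambda>i. (chart_dom i, chart_map i))"
proof -
  have p: "p1p1_atlas = {(UNIV, \<lambda>(x, y). (Aff x, Aff y)), (UNIV, \<lambda>(x, y). (aff_inv x, Aff y)),
      (UNIV, \<lambda>(x, y). (Aff x, aff_inv y)), (UNIV, \<lambda>(x, y). (aff_inv x, aff_inv y))}"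
    unfolding p1p1_atlas_def by auto
  have b: "(chart_dom TQ, chart_map TQ) = ({z \<in> UNIV. (\<lambda>(x, y). (Aff x, Aff y)) z \<notin> centre ` centre_charts}, Pt \<circ> (\<lambda>(x, y). (Aff x, Aff y)))"
    "(chart_dom SQ, chart_map SQ) = ({z \<in> UNIV. (\<lambda>(x, y). (aff_inv x, Aff y)) z \<notin> centre ` centre_charts}, Pt \<circ> (\<lambda>(x, y). (aff_inv x, Aff y)))"
    "(chart_dom TR, chart_map TR) = ({z \<in> UNIV. (\<lambda>(x, y). (Aff x, aff_inv y)) z \<notin> centre ` centre_charts}, Pt \<circ> (\<lambda>(x, y). (Aff x, aff_inv y)))"
    "(chart_dom SR, chart_map SR) = ({z \<in> UNIV. (\<lambda>(x, y). (aff_inv x, aff_inv y)) z \<notin> centre ` centre_charts}, Pt \<circ> (\<lambda>(x, y). (aff_inv x, aff_inv y)))"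
    unfolding centres by (auto simp: chart_dom_def fun_eq_iff aff_inv_simps)
  have c: "(chart_dom E1a, chart_map E1a) = (UNIV, blowup_chart1 (\<lambda>(x, y). (Aff x, Aff (1 + y))))"
    "(chart_dom E1b, chart_map E1b) = (UNIV, blowup_chart2 (\<lambda>(x, y). (Aff x, Aff (1 + y))))"
    "(chart_dom E0a, chart_map E0a) = (UNIV, blowup_chart1 (\<lambda>(x, y). (aff_inv x, Aff y)))"
    "(chart_dom E0b, chart_map E0b) = (UNIV, blowup_chart2 (\<lambda>(x, y). (aff_inv x, Aff y)))"
    "(chart_dom EIa, chart_map EIa) = (UNIV, blowup_chart1 (\<lambda>(x, y). (aff_inv x, aff_inv y)))"
    "(chart_dom EIb, chart_map EIb) = (UNIV, blowup_chart2 (\<lambda>(x, y). (aff_inv x, aff_inv y)))"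
    by (simp_all add: chart_dom_def fun_eq_iff blowup_chart1_def blowup_chart2_def centre_def aff_inv_0)
  have "range (\<lambda>i. (chart_dom i, chart_map i)) =
    {(chart_dom TQ, chart_map TQ), (chart_dom SQ, chart_map SQ), (chart_dom TR, chart_map TR), (chart_dom SR, chart_map SR)} \<union>
    {(chart_dom E1a, chart_map E1a), (chart_dom E0a, chart_map E0a), (chart_dom EIa, chart_map EIa)} \<union>
    {(chart_dom E1b, chart_map E1b), (chart_dom E0b, chart_map E0b), (chart_dom EIb, chart_map EIb)}"
    unfolding UNIV_chart by (simp only: image_insert image_empty Un_insert_left Un_empty_left)
  also have "\<dots> = Matlas"
    unfolding b c blowup_atlas_def p by (simp only: image_insert image_empty centre_charts_def prod.case)
  finally show ?thesis ..
qed

interpretation M: surface Matlas rewrites "surface_of_atlas Matlas = Mtilde"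
  by (unfold_locales, rule complex_atlas_Mtilde) (simp add: Mtilde_def)

lemma chart_mem: "(chart_dom i, chart_map i) \<in> Matlas"
  unfolding Matlas_eq by blast

lemma topspace_chart:
  assumes "x \<in> topspace (ctop Mtilde)"
  obtains i z where "z \<in> chart_dom i" "chart_map i z = x"
proof -
  obtain D \<psi> z where D: "(D, \<psi>) \<in> Matlas" "z \<in> D" "\<psi> z = x" using M.chart_at[OF assms] .
  then obtain i where "D = chart_dom i" "\<psi> = chart_map i" unfolding Matlas_eq by auto
  then show ?thesis using that[of z i] D by simp
qed

lemma chart_in_topspace: "z \<in> chart_dom i \<Longrightarrow> chart_map i z \<in> topspace (ctop Mtilde)"
  unfolding M.topspace_X using chart_mem[of i] by blast

text \<open>
  \<open>I\<close> stands for infinity, and an exceptional curve is named after the value of \<open>q\<close> at its centre.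
\<close>

datatype bcurve = A0 | AI | Q0 | Q1 | QI | B1 | B0 | BI

lemma UNIV_bcurve: "(UNIV :: bcurve set) = {A0, AI, Q0, Q1, QI, B1, B0, BI}"
  by (auto intro: bcurve.exhaust)

lemma finite_bcurve: "finite (UNIV :: bcurve set)"
  unfolding UNIV_bcurve by simp

text \<open>
  Explicit point sets for the eight boundary curves. The direction of \<open>{t = const}\<close> at a centre is
  \<open>Infty\<close> and that of \<open>{q = const}\<close> is \<open>Aff 0\<close>, because the first centred coordinate depends on \<open>t\<close> only.
\<close>

fun bdry :: "bcurve \<Rightarrow> point set" where
  "bdry A0 = {Pt (Aff 0, q) | q. q \<noteq> Aff 1} \<union> {Exc (Aff 0, Aff 1) Infty}"
| "bdry AI = {Pt (Infty, q) | q. q \<noteq> Aff 0 \<and> q \<noteq> Infty} \<union> {Exc (Infty, Aff 0) Infty, Exc (Infty, Infty) Infty}"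
| "bdry Q0 = {Pt (t, Aff 0) | t. t \<noteq> Infty} \<union> {Exc (Infty, Aff 0) (Aff 0)}"
| "bdry Q1 = {Pt (t, Aff 1) | t. t \<noteq> Aff 0} \<union> {Exc (Aff 0, Aff 1) (Aff 0)}"
| "bdry QI = {Pt (t, Infty) | t. t \<noteq> Infty} \<union> {Exc (Infty, Infty) (Aff 0)}"
| "bdry B1 = range (Exc (Aff 0, Aff 1))"
| "bdry B0 = range (Exc (Infty, Aff 0))"
| "bdry BI = range (Exc (Infty, Infty))"

text \<open>The local equations of the boundary curves; the value \<open>1\<close> means that the curve misses the chart.\<close>

definition chart_eqn :: "chart \<Rightarrow> bcurve \<Rightarrow> complex \<times> complex \<Rightarrow> complex" where
  "chart_eqn i c z = (let a = fst z; b = snd z in case i of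
      TQ \<Rightarrow> (case c of A0 \<Rightarrow> a | Q0 \<Rightarrow> b | Q1 \<Rightarrow> b - 1 | _ \<Rightarrow> 1)
    | SQ \<Rightarrow> (case c of AI \<Rightarrow> a | Q0 \<Rightarrow> b | Q1 \<Rightarrow> b - 1 | _ \<Rightarrow> 1)
    | TR \<Rightarrow> (case c of A0 \<Rightarrow> a | QI \<Rightarrow> b | Q1 \<Rightarrow> 1 - b | _ \<Rightarrow> 1)
    | SR \<Rightarrow> (case c of AI \<Rightarrow> a | QI \<Rightarrow> b | Q1 \<Rightarrow> 1 - b | _ \<Rightarrow> 1)
    | E1a \<Rightarrow> (case c of B1 \<Rightarrow> a | Q1 \<Rightarrow> b | Q0 \<Rightarrow> 1 + a * b | _ \<Rightarrow> 1)
    | E1b \<Rightarrow> (case c of B1 \<Rightarrow> b | A0 \<Rightarrow> a | Q0 \<Rightarrow> 1 + b | _ \<Rightarrow> 1)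
    | E0a \<Rightarrow> (case c of B0 \<Rightarrow> a | Q0 \<Rightarrow> b | Q1 \<Rightarrow> a * b - 1 | _ \<Rightarrow> 1)
    | E0b \<Rightarrow> (case c of B0 \<Rightarrow> b | AI \<Rightarrow> a | Q1 \<Rightarrow> b - 1 | _ \<Rightarrow> 1)
    | EIa \<Rightarrow> (case c of BI \<Rightarrow> a | QI \<Rightarrow> b | Q1 \<Rightarrow> 1 - a * b | _ \<Rightarrow> 1)
    | EIb \<Rightarrow> (case c of BI \<Rightarrow> b | AI \<Rightarrow> a | Q1 \<Rightarrow> 1 - b | _ \<Rightarrow> 1))"

lemma mem_bdry: "z \<in> chart_dom i \<Longrightarrow> chart_map i z \<in> bdry c \<longleftrightarrow> chart_eqn i c z = 0"
  by (cases z; cases i; cases c)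
    (auto simp: chart_eqn_def chart_dom_def aff_inv_simps aff_inv_simps' add_eq_0_iff)

lemma bdry_topspace: "bdry c \<subseteq> topspace (ctop Mtilde)"
proof -
  have Pt: "Pt p \<in> topspace (ctop Mtilde)" if "p \<notin> centre ` centre_charts" for p
  proof -
    obtain t q where p: "p = (t, q)" by (cases p)
    have T: "t = Infty \<Longrightarrow> t = aff_inv 0" "q = Infty \<Longrightarrow> q = aff_inv 0" by (simp_all add: aff_inv_def)
    show ?thesis
    proof (cases t; cases q)
      fix a b assume "t = Aff a" "q = Aff b"
      then show ?thesis using chart_in_topspace[of "(a, b)" TQ] that unfolding centres by (auto simp: p chart_dom_def)
    next
      fix a assume "t = Aff a" "q = Infty"
      then show ?thesis using chart_in_topspace[of "(a, 0)" TR] that T unfolding centres by (auto simp: p chart_dom_def aff_inv_def)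
    next
      fix b assume "t = Infty" "q = Aff b"
      then show ?thesis using chart_in_topspace[of "(0, b)" SQ] that T unfolding centres by (auto simp: p chart_dom_def aff_inv_def)
    next
      assume "t = Infty" "q = Infty"
      then show ?thesis using that unfolding centres by (auto simp: p)
    qed
  qed
  have Exc: "Exc c d \<in> topspace (ctop Mtilde)" if "c \<in> centre ` centre_charts" for c d
  proof (cases d)
    case (Aff v)
    then show ?thesis
      using chart_in_topspace[of "(0, v)" E1a] chart_in_topspace[of "(0, v)" E0a] chart_in_topspace[of "(0, v)" EIa] that
      unfolding centres by (auto simp: chart_dom_def)
  next
    case Infty
    then show ?thesis
      using chart_in_topspace[of "(0, 0)" E1b] chart_in_topspace[of "(0, 0)" E0b] chart_in_topspace[of "(0, 0)" EIb] that
      unfolding centres by (auto simp: chart_dom_def aff_inv_def)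
  qed
  show ?thesis by (cases c) (auto intro!: Pt[unfolded centres] Exc[unfolded centres])
qed

lemma bdry_Mopen: "bdry c \<inter> Mopen = {}"
  by (cases c) (auto simp: Mopen_def)

lemma Pt_in_Mopen: "Pt (Aff t, Aff q) \<in> Mopen \<longleftrightarrow> t \<noteq> 0 \<and> q \<noteq> 0 \<and> q \<noteq> 1"
  by (simp add: Mopen_def)

lemma Mopen_chart: "z \<in> chart_dom i \<Longrightarrow> chart_map i z \<in> Mopen \<longleftrightarrow> (\<forall>c. chart_eqn i c z \<noteq> 0)"
proof
  assume "z \<in> chart_dom i" "chart_map i z \<in> Mopen"
  then show "\<forall>c. chart_eqn i c z \<noteq> 0" using mem_bdry bdry_Mopen by blast
next
  assume z: "z \<in> chart_dom i" "\<forall>c. chart_eqn i c z \<noteq> 0"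
  obtain a b where ab: "z = (a, b)" by (cases z)
  have "chart_eqn i A0 (a, b) \<noteq> 0" "chart_eqn i AI (a, b) \<noteq> 0" "chart_eqn i Q0 (a, b) \<noteq> 0" "chart_eqn i Q1 (a, b) \<noteq> 0"
    "chart_eqn i QI (a, b) \<noteq> 0" "chart_eqn i B1 (a, b) \<noteq> 0" "chart_eqn i B0 (a, b) \<noteq> 0" "chart_eqn i BI (a, b) \<noteq> 0"
    using z(2) ab by blast+
  then show "chart_map i z \<in> Mopen"
    unfolding ab by (cases i) (simp_all add: chart_eqn_def Pt_in_Mopen aff_inv_def)
qed

lemma Mopen_topspace: "Mopen \<subseteq> topspace (ctop Mtilde)"
proof
  fix x assume "x \<in> Mopen"
  then obtain t q where "x = chart_map TQ (t, q)" "(t, q) \<in> chart_dom TQ" by (auto simp: Mopen_def chart_dom_def)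
  then show "x \<in> topspace (ctop Mtilde)" using chart_in_topspace by blast
qed

lemma holomorphic2_on_diff:
  assumes "holomorphic2_on f D" "holomorphic2_on g D"
  shows "holomorphic2_on (\<lambda>z. f z - g z) D"
  using holomorphic2_on_add[OF assms(1) holomorphic2_on_mult[OF holomorphic2_on_const[of "- 1"] assms(2)]] by simp

lemma chart_eqn_holomorphic: "holomorphic2_on (chart_eqn i c) D"
  unfolding chart_eqn_def[abs_def] Let_def
  by (cases i; cases c; simp) (intro holomorphic2_intros holomorphic2_on_diff)+

text \<open>
  All entries of the table are affine in each variable separately, with non-vanishing gradient along
  their zeros. So a zero can be left by moving one coordinate.
\<close>

lemma chart_eqn_biaffine:
  "\<exists>m n. (\<forall>s. chart_eqn i c (a + s, b) = chart_eqn i c (a, b) + s * m) \<and> (\<forall>s. chart_eqn i c (a, b + s) = chart_eqn i c (a, b) + s * n) \<and>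
    (chart_eqn i c (a, b) = 0 \<longrightarrow> m \<noteq> 0 \<or> n \<noteq> 0)"
proof (intro exI conjI allI impI)
  let ?m = "chart_eqn i c (a + 1, b) - chart_eqn i c (a, b)" and ?n = "chart_eqn i c (a, b + 1) - chart_eqn i c (a, b)"
  show "chart_eqn i c (a + s, b) = chart_eqn i c (a, b) + s * ?m" for s
    by (cases i; cases c; simp add: chart_eqn_def algebra_simps)
  show "chart_eqn i c (a, b + s) = chart_eqn i c (a, b) + s * ?n" for s
    by (cases i; cases c; simp add: chart_eqn_def algebra_simps)
  show "?m \<noteq> 0 \<or> ?n \<noteq> 0" if "chart_eqn i c (a, b) = 0"
    using that by (cases i; cases c; auto simp: chart_eqn_def algebra_simps)
qed

lemma chart_eqn_nonzero_dense:
  assumes U: "open U" "U \<noteq> {}"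
  shows "\<exists>z\<in>U. chart_eqn i c z \<noteq> 0"
proof -
  obtain a b where ab: "(a, b) \<in> U" using U by auto
  obtain r where r: "r > 0" "cball a r \<times> cball b r \<subseteq> U" using polydisc_nbhd[OF U(1) ab] by auto
  have in_U: "(a + of_real r, b) \<in> U" "(a, b + of_real r) \<in> U"
    using r by (auto intro!: subsetD[OF r(2)] simp: dist_norm)
  obtain m n where mn: "\<And>s. chart_eqn i c (a + s, b) = chart_eqn i c (a, b) + s * m"
    "\<And>s. chart_eqn i c (a, b + s) = chart_eqn i c (a, b) + s * n" "chart_eqn i c (a, b) = 0 \<Longrightarrow> m \<noteq> 0 \<or> n \<noteq> 0"
    using chart_eqn_biaffine[of i c a b] by blast
  show ?thesis
  proof (cases "chart_eqn i c (a, b) = 0")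
    case True
    then show ?thesis using mn(3) mn(1)[of "of_real r"] mn(2)[of "of_real r"] in_U r(1)
      by (metis add_0 mult_eq_0_iff of_real_eq_0_iff order_less_irrefl)
  qed (use ab in blast)
qed

lemma open_chart_eqn_nonzero: "open {z. chart_eqn i c z \<noteq> 0}"
proof -
  have "open (UNIV \<inter> chart_eqn i c -` (- {0}))"
    by (rule continuous_open_preimage[OF holomorphic2_on_continuous[OF chart_eqn_holomorphic]]) auto
  then show ?thesis by (simp add: vimage_def Compl_eq)
qed

lemma all_chart_eqn_nonzero_dense:
  assumes U: "open U" "U \<noteq> {}"
  shows "\<exists>z\<in>U. \<forall>c. chart_eqn i c z \<noteq> 0"
proof -
  have "\<exists>z\<in>U. \<forall>c\<in>S. chart_eqn i c z \<noteq> 0" if "finite S" for S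
    using that U
  proof (induction S arbitrary: U rule: finite_induct)
    case (insert c S)
    have "open (U \<inter> {z. chart_eqn i c z \<noteq> 0})" using insert.prems(1) open_chart_eqn_nonzero by blast
    moreover have "U \<inter> {z. chart_eqn i c z \<noteq> 0} \<noteq> {}" using chart_eqn_nonzero_dense[OF insert.prems] by blast
    ultimately obtain z where "z \<in> U \<inter> {z. chart_eqn i c z \<noteq> 0}" "\<forall>c\<in>S. chart_eqn i c z \<noteq> 0" using insert.IH by blast
    then show ?case by blast
  qed auto
  from this[of UNIV] finite_bcurve show ?thesis by simp
qed

lemma Mopen_open: "openin (ctop Mtilde) Mopen"
  unfolding M.openin_iff atlas_open_def
proof (intro conjI)
  show "Mopen \<subseteq> (\<Union>(D, \<psi>)\<in>Matlas. \<psi> ` D)" using Mopen_topspace unfolding M.topspace_X .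
  have "open {z \<in> chart_dom i. chart_map i z \<in> Mopen}" for i
  proof -
    have "{z \<in> chart_dom i. chart_map i z \<in> Mopen} = chart_dom i \<inter> (\<Inter>c. {z. chart_eqn i c z \<noteq> 0})"
      using Mopen_chart by blast
    moreover have "open (\<Inter>c. {z. chart_eqn i c z \<noteq> 0})" by (intro open_INT ballI open_chart_eqn_nonzero finite_bcurve)
    ultimately show ?thesis using M.chart_dom[OF chart_mem] by (simp add: open_Int)
  qed
  then show "\<forall>(D, \<psi>)\<in>Matlas. open {z \<in> D. \<psi> z \<in> Mopen}" unfolding Matlas_eq by auto
qed

lemma Mopen_dense:
  assumes W: "openin (ctop Mtilde) W" "W \<noteq> {}"
  shows "W \<inter> Mopen \<noteq> {}"
proof -
  obtain x where x: "x \<in> W" using W by blast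
  then obtain i z where z: "z \<in> chart_dom i" "chart_map i z = x" using topspace_chart openin_subset[OF W(1)] by blast
  have "open {z \<in> chart_dom i. chart_map i z \<in> W}" by (rule M.open_vimage[OF W(1) chart_mem])
  from all_chart_eqn_nonzero_dense[OF this, of i] obtain w where "w \<in> chart_dom i" "chart_map i w \<in> W" "\<forall>c. chart_eqn i c w \<noteq> 0"
    using z x by blast
  then show ?thesis using Mopen_chart by blast
qed

interpretation M: dense_surface Matlas Mopen rewrites "surface_of_atlas Matlas = Mtilde"
  by (unfold_locales) (use Mopen_open Mopen_dense in \<open>simp_all add: Mtilde_def\<close>)

section \<open>Curves parametrized by the line\<close>

context surface
begin

definition holomorphic_curve :: "(complex \<Rightarrow> 'a) \<Rightarrow> complex set \<Rightarrow> bool" where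
  "holomorphic_curve \<gamma> S \<longleftrightarrow> open S \<and> \<gamma> ` S \<subseteq> topspace (ctop X) \<and>
     (\<forall>W F. hol X W F \<longrightarrow> open {s \<in> S. \<gamma> s \<in> W} \<and> (F \<circ> \<gamma>) holomorphic_on {s \<in> S. \<gamma> s \<in> W})"

lemma holomorphic_curve_open:
  assumes "holomorphic_curve \<gamma> S" "openin (ctop X) W"
  shows "open {s \<in> S. \<gamma> s \<in> W}"
  using assms hol_const[OF assms(2), of 0] unfolding holomorphic_curve_def by blast

lemma holomorphic_curve_vertical:
  assumes D: "(D, \<psi>) \<in> A" and S: "open S" "\<And>s. s \<in> S \<Longrightarrow> (k, s) \<in> D"
  shows "holomorphic_curve (\<lambda>s. \<psi> (k, s)) S"
  unfolding holomorphic_curve_def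
proof (intro conjI allI impI)
  show "(\<lambda>s. \<psi> (k, s)) ` S \<subseteq> topspace (ctop X)" unfolding topspace_X using D S(2) by blast
  fix W F assume F: "hol X W F"
  have "open {z \<in> D. \<psi> z \<in> W}" by (rule open_vimage[OF hol_openin[OF F] D])
  then have "open (S \<inter> (\<lambda>s. (k, s)) -` {z \<in> D. \<psi> z \<in> W})"
    by (intro continuous_open_preimage S(1) continuous_intros)
  moreover have "S \<inter> (\<lambda>s. (k, s)) -` {z \<in> D. \<psi> z \<in> W} = {s \<in> S. \<psi> (k, s) \<in> W}" using S(2) by auto
  ultimately show "open {s \<in> S. \<psi> (k, s) \<in> W}" by simp
  show "(F \<circ> (\<lambda>s. \<psi> (k, s))) holomorphic_on {s \<in> S. \<psi> (k, s) \<in> W}"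
    using holomorphic2_on_slice_snd[OF hol_chartD[OF F D], of "{s \<in> S. \<psi> (k, s) \<in> W}" k] S(2) by (simp add: comp_def)
qed (rule S(1))

lemma holomorphic_curve_horizontal:
  assumes D: "(D, \<psi>) \<in> A" and S: "open S" "\<And>s. s \<in> S \<Longrightarrow> (s, k) \<in> D"
  shows "holomorphic_curve (\<lambda>s. \<psi> (s, k)) S"
  unfolding holomorphic_curve_def
proof (intro conjI allI impI)
  show "(\<lambda>s. \<psi> (s, k)) ` S \<subseteq> topspace (ctop X)" unfolding topspace_X using D S(2) by blast
  fix W F assume F: "hol X W F"
  have "open {z \<in> D. \<psi> z \<in> W}" by (rule open_vimage[OF hol_openin[OF F] D])
  then have "open (S \<inter> (\<lambda>s. (s, k)) -` {z \<in> D. \<psi> z \<in> W})"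
    by (intro continuous_open_preimage S(1) continuous_intros)
  moreover have "S \<inter> (\<lambda>s. (s, k)) -` {z \<in> D. \<psi> z \<in> W} = {s \<in> S. \<psi> (s, k) \<in> W}" using S(2) by auto
  ultimately show "open {s \<in> S. \<psi> (s, k) \<in> W}" by simp
  show "(F \<circ> (\<lambda>s. \<psi> (s, k))) holomorphic_on {s \<in> S. \<psi> (s, k) \<in> W}"
    using holomorphic2_on_slice_fst[OF hol_chartD[OF F D], of "{s \<in> S. \<psi> (s, k) \<in> W}" k] S(2) by (simp add: comp_def)
qed (rule S(1))

text \<open>
  The identity theorem in one variable: the interior of the preimage of \<open>Z\<close> is closed in \<open>S\<close>.
\<close>

lemma holomorphic_curve_identity:
  assumes Z: "analytic_subset X Z" and \<gamma>: "holomorphic_curve \<gamma> S" and S: "connected S"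
    and U: "open U" "U \<noteq> {}" "U \<subseteq> S" "\<gamma> ` U \<subseteq> Z"
  shows "\<gamma> ` S \<subseteq> Z"
proof -
  define T where "T = interior {s \<in> S. \<gamma> s \<in> Z}"
  have opS: "open S" using \<gamma> by (simp add: holomorphic_curve_def)
  have T: "open T" "T \<subseteq> S" "\<gamma> ` T \<subseteq> Z" unfolding T_def using interior_subset[of "{s \<in> S. \<gamma> s \<in> Z}"] by auto
  have "U \<subseteq> T" unfolding T_def by (rule interior_maximal) (use U in auto)
  then have ne: "T \<noteq> {}" using U by blast
  have "s \<in> T" if s: "s \<in> S" "s \<in> closure T" for s
  proof -
    have "\<gamma> s \<in> topspace (ctop X)" using \<gamma> s by (auto simp: holomorphic_curve_def)
    then obtain W F where W: "\<gamma> s \<in> W" "openin (ctop X) W" "\<forall>f\<in>F. hol X W f" "Z \<inter> W = {y \<in> W. \<forall>f\<in>F. f y = 0}"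
      using Z unfolding analytic_subset_def by blast
    let ?O = "{s \<in> S. \<gamma> s \<in> W}"
    have "open ?O" by (rule holomorphic_curve_open[OF \<gamma> W(2)])
    then obtain e where e: "e > 0" "ball s e \<subseteq> ?O" 
      using s W(1) unfolding open_contains_ball by blast
    have b: "ball s e \<inter> T \<noteq> {}" using open_Int_closure_eq_empty[of "ball s e" T] s(2) centre_in_ball[of s e] e(1) by blast
    have "\<gamma> w \<in> Z" if w: "w \<in> ball s e" for w
    proof -
      have "f (\<gamma> w) = 0" if f: "f \<in> F" for f
      proof -
        have "(f \<circ> \<gamma>) holomorphic_on ?O" using \<gamma> bspec[OF W(3) f] unfolding holomorphic_curve_def by blast
        then have h: "(f \<circ> \<gamma>) holomorphic_on ball s e" using e(2) holomorphic_on_subset by blast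
        have "(f \<circ> \<gamma>) w = 0"
        proof (rule analytic_continuation_open[where s = "ball s e \<inter> T" and s' = "ball s e" and f = "f \<circ> \<gamma>" and g = "\<lambda>_. 0"])
          show "(f \<circ> \<gamma>) z = 0" if z: "z \<in> ball s e \<inter> T" for z
          proof -
            have "\<gamma> z \<in> Z \<inter> W" using z T(3) e(2) by blast
            then have "\<gamma> z \<in> {y \<in> W. \<forall>f\<in>F. f y = 0}" using W(4) by blast
            then show ?thesis using f by simp
          qed
        qed (use b h w T(1) in auto)
        then show ?thesis by simp
      qed
      moreover have "\<gamma> w \<in> W" using w e(2) by blast
      ultimately show ?thesis using W(4) by blast
    qed
    then have "ball s e \<subseteq> {s \<in> S. \<gamma> s \<in> Z}" using e(2) by auto
    then have "ball s e \<subseteq> T" unfolding T_def by (rule interior_maximal) simp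
    then show "s \<in> T" using e(1) by auto
  qed
  then have "closedin (top_of_set S) T"
    using T(2) closure_subset[of T] by (auto simp: closedin_closed intro!: exI[of _ "closure T"])
  moreover have "openin (top_of_set S) T" using T opS by (simp add: open_openin_trans)
  ultimately have "T = S" using S ne unfolding connected_clopen by blast
  then show ?thesis using T by simp
qed

lemma limit_in_closed:
  assumes Z: "closedin (ctop X) Z" and \<gamma>: "holomorphic_curve \<gamma> S" and s: "s \<in> S" "\<gamma> ` (S - {s}) \<subseteq> Z"
  shows "\<gamma> s \<in> Z"
proof (rule ccontr)
  assume n: "\<gamma> s \<notin> Z"
  let ?O = "{s \<in> S. \<gamma> s \<in> topspace (ctop X) - Z}"
  have "open ?O" by (rule holomorphic_curve_open[OF \<gamma>]) (use Z in auto)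
  moreover have "\<gamma> s \<in> topspace (ctop X)" using \<gamma> s by (auto simp: holomorphic_curve_def)
  then have "?O = {s}" using n s by auto
  ultimately show False using not_open_singleton[of s] by simp
qed

text \<open>
  A union of two analytic sets has one of them containing an open piece of the connected
  parametrized part, hence all of it; the remaining point is then forced by closedness.
\<close>

lemma irreducible_of_curve:
  assumes C: "analytic_subset X C" and \<gamma>: "holomorphic_curve \<gamma> S" "connected S" "S \<noteq> {}"
    and \<delta>: "holomorphic_curve \<delta> T" "s \<in> T" "\<delta> ` (T - {s}) \<subseteq> \<gamma> ` S" and CU: "C = insert (\<delta> s) (\<gamma> ` S)"
  shows "irreducible_subset X C"
  unfolding irreducible_subset_def
proof (intro conjI allI impI)
  fix Z1 Z2 assume Z: "analytic_subset X Z1" "analytic_subset X Z2" "C = Z1 \<union> Z2"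
  have whole: "C \<subseteq> Z'" if "analytic_subset X Z'" "\<gamma> ` S \<subseteq> Z'" for Z'
    using limit_in_closed[OF analytic_subset_closed[OF that(1)] \<delta>(1,2)] \<delta>(3) CU that(2) by blast
  show "C = Z1 \<or> C = Z2"
  proof (cases "\<gamma> ` S \<subseteq> Z1")
    case True
    then show ?thesis using whole[OF Z(1)] Z(3) by blast
  next
    case False
    let ?U = "{s \<in> S. \<gamma> s \<in> topspace (ctop X) - Z1}"
    have top: "\<gamma> ` S \<subseteq> topspace (ctop X)" using \<gamma>(1) by (simp add: holomorphic_curve_def)
    have "open ?U" by (rule holomorphic_curve_open[OF \<gamma>(1)]) (use analytic_subset_closed[OF Z(1)] in auto)
    moreover have "?U \<noteq> {}" using False top by blast
    moreover have "\<gamma> ` ?U \<subseteq> Z2" using CU Z(3) by blast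
    ultimately have "\<gamma> ` S \<subseteq> Z2" using holomorphic_curve_identity[OF Z(2) \<gamma>(1,2), of ?U] by blast
    then show ?thesis using whole[OF Z(2)] Z(3) by blast
  qed
qed (use C CU in auto)

end

section \<open>The boundary curves are prime divisors\<close>

abbreviation chart_img :: "chart \<Rightarrow> point set" where
  "chart_img i \<equiv> chart_map i ` chart_dom i"

abbreviation chart_inv :: "chart \<Rightarrow> point \<Rightarrow> complex \<times> complex" where
  "chart_inv i \<equiv> inv_into (chart_dom i) (chart_map i)"

definition point_eqn :: "chart \<Rightarrow> bcurve \<Rightarrow> point \<Rightarrow> complex" where
  "point_eqn i c = chart_eqn i c \<circ> chart_inv i"

lemma chart_inv: "z \<in> chart_dom i \<Longrightarrow> chart_inv i (chart_map i z) = z"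
  using M.chart_inj[OF chart_mem] by (simp add: inv_into_f_f)

lemma point_eqn_chart: "z \<in> chart_dom i \<Longrightarrow> point_eqn i c (chart_map i z) = chart_eqn i c z"
  by (simp add: point_eqn_def chart_inv)

lemma point_eqn_zero: "y \<in> chart_img i \<Longrightarrow> point_eqn i c y = 0 \<longleftrightarrow> y \<in> bdry c"
  using point_eqn_chart mem_bdry by fastforce

lemma chart_img_open: "openin (ctop Mtilde) (chart_img i)"
  by (rule M.chart_open[OF chart_mem M.chart_dom[OF chart_mem] order_refl])

lemma point_eqn_hol: "hol Mtilde (chart_img i) (point_eqn i c)"
  unfolding point_eqn_def by (rule M.hol_chartI[OF chart_mem M.chart_dom[OF chart_mem] order_refl chart_eqn_holomorphic])

lemma topspace_chart_img: "x \<in> topspace (ctop Mtilde) \<Longrightarrow> \<exists>i. x \<in> chart_img i"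
  by (metis topspace_chart imageI)

lemma bdry_analytic: "analytic_subset Mtilde (bdry c)"
  unfolding analytic_subset_def
proof (intro conjI bdry_topspace ballI)
  fix x assume "x \<in> topspace (ctop Mtilde)"
  then obtain i where i: "x \<in> chart_img i" using topspace_chart_img by blast
  show "\<exists>W F. x \<in> W \<and> openin (ctop Mtilde) W \<and> finite F \<and> (\<forall>f\<in>F. hol Mtilde W f) \<and>
      bdry c \<inter> W = {y \<in> W. \<forall>f\<in>F. f y = 0}"
    by (intro exI[of _ "chart_img i"] exI[of _ "{point_eqn i c}"] conjI)
      (use i chart_img_open point_eqn_hol in \<open>auto simp: point_eqn_zero\<close>)
qed

lemmas bdry_closed = M.analytic_subset_closed[OF bdry_analytic]

lemma vertical: "open S \<Longrightarrow> (\<And>s. s \<in> S \<Longrightarrow> (k, s) \<in> chart_dom i) \<Longrightarrow> M.holomorphic_curve (\<lambda>s. chart_map i (k, s)) S"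
  by (rule M.holomorphic_curve_vertical[OF chart_mem])

lemma horizontal: "open S \<Longrightarrow> (\<And>s. s \<in> S \<Longrightarrow> (s, k) \<in> chart_dom i) \<Longrightarrow> M.holomorphic_curve (\<lambda>s. chart_map i (s, k)) S"
  by (rule M.holomorphic_curve_horizontal[OF chart_mem])

lemma aff_inv_nonzero: "s \<noteq> 0 \<Longrightarrow> aff_inv s = Aff (1 / s)"
  by (simp add: aff_inv_def)

text \<open>
  Each boundary curve is a projective line: all of it but one point is covered by a coordinate
  axis of one chart.
\<close>

lemma bdry_param:
  "bdry A0 = insert (chart_map TR (0, 0)) (range (\<lambda>s. chart_map E1b (0, s)))"
  "bdry AI = insert (chart_map EIb (0, 0)) (range (\<lambda>s. chart_map E0b (0, s)))"
  "bdry Q0 = insert (chart_map E0a (0, 0)) (range (\<lambda>s. chart_map TQ (s, 0)))"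
  "bdry Q1 = insert (chart_map SQ (0, 1)) (range (\<lambda>s. chart_map E1a (s, 0)))"
  "bdry QI = insert (chart_map EIa (0, 0)) (range (\<lambda>s. chart_map TR (s, 0)))"
  "bdry B1 = insert (chart_map E1b (0, 0)) (range (\<lambda>s. chart_map E1a (0, s)))"
  "bdry B0 = insert (chart_map E0b (0, 0)) (range (\<lambda>s. chart_map E0a (0, s)))"
  "bdry BI = insert (chart_map EIb (0, 0)) (range (\<lambda>s. chart_map EIa (0, s)))"
proof -
  have eqI: "C = insert d (range g)" if "d \<in> C" "\<And>s. g s \<in> C" "\<And>x. x \<in> C \<Longrightarrow> x = d \<or> (\<exists>s. x = g s)"
    for C d and g :: "complex \<Rightarrow> point"
    using that by blast
  show "bdry A0 = insert (chart_map TR (0, 0)) (range (\<lambda>s. chart_map E1b (0, s)))"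
  proof (rule eqI)
    fix x assume "x \<in> bdry A0"
    then consider "x = Exc (Aff 0, Aff 1) Infty" | "x = Pt (Aff 0, Infty)" | b where "x = Pt (Aff 0, Aff b)" "b \<noteq> 1"
      by (auto intro: proj_line.exhaust)
    then show "x = chart_map TR (0, 0) \<or> (\<exists>s. x = chart_map E1b (0, s))"
    proof cases
      case 3
      then show ?thesis by (intro disjI2 exI[of _ "b - 1"]) simp
    qed (auto simp: aff_inv_0 intro: exI[of _ 0])
  qed (auto simp: aff_inv_0)
  show "bdry AI = insert (chart_map EIb (0, 0)) (range (\<lambda>s. chart_map E0b (0, s)))"
  proof (rule eqI)
    fix x assume "x \<in> bdry AI"
    then consider "x = Exc (Infty, Aff 0) Infty" | "x = Exc (Infty, Infty) Infty" | b where "x = Pt (Infty, Aff b)" "b \<noteq> 0"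
      by (auto intro: proj_line.exhaust)
    then show "x = chart_map EIb (0, 0) \<or> (\<exists>s. x = chart_map E0b (0, s))"
    proof cases
      case 3
      then show ?thesis by (intro disjI2 exI[of _ b]) (simp add: aff_inv_0)
    qed (auto simp: aff_inv_0 intro: exI[of _ 0])
  qed (auto simp: aff_inv_0)
  show "bdry Q0 = insert (chart_map E0a (0, 0)) (range (\<lambda>s. chart_map TQ (s, 0)))"
  proof (rule eqI)
    fix x assume "x \<in> bdry Q0"
    then consider "x = Exc (Infty, Aff 0) (Aff 0)" | a where "x = Pt (Aff a, Aff 0)"
      by (auto intro: proj_line.exhaust)
    then show "x = chart_map E0a (0, 0) \<or> (\<exists>s. x = chart_map TQ (s, 0))" by cases auto
  qed auto
  show "bdry Q1 = insert (chart_map SQ (0, 1)) (range (\<lambda>s. chart_map E1a (s, 0)))"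
  proof (rule eqI)
    fix x assume "x \<in> bdry Q1"
    then consider "x = Exc (Aff 0, Aff 1) (Aff 0)" | "x = Pt (Infty, Aff 1)" | a where "x = Pt (Aff a, Aff 1)" "a \<noteq> 0"
      by (auto intro: proj_line.exhaust)
    then show "x = chart_map SQ (0, 1) \<or> (\<exists>s. x = chart_map E1a (s, 0))"
    proof cases
      case 3
      then show ?thesis by (intro disjI2 exI[of _ a]) simp
    qed (auto simp: aff_inv_0 intro: exI[of _ 0])
  qed (auto simp: aff_inv_0)
  show "bdry QI = insert (chart_map EIa (0, 0)) (range (\<lambda>s. chart_map TR (s, 0)))"
  proof (rule eqI)
    fix x assume "x \<in> bdry QI"
    then consider "x = Exc (Infty, Infty) (Aff 0)" | a where "x = Pt (Aff a, Infty)"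
      by (auto intro: proj_line.exhaust)
    then show "x = chart_map EIa (0, 0) \<or> (\<exists>s. x = chart_map TR (s, 0))" by cases (auto simp: aff_inv_0)
  qed (auto simp: aff_inv_0)
  have exc: "range (Exc c) = insert (Exc c Infty) (range (\<lambda>s. Exc c (Aff s)))" for c :: "proj_line \<times> proj_line"
    by (rule eqI) (auto intro: proj_line.exhaust)
  show "bdry B1 = insert (chart_map E1b (0, 0)) (range (\<lambda>s. chart_map E1a (0, s)))"
    "bdry B0 = insert (chart_map E0b (0, 0)) (range (\<lambda>s. chart_map E0a (0, s)))"
    "bdry BI = insert (chart_map EIb (0, 0)) (range (\<lambda>s. chart_map EIa (0, s)))"
    using exc by (simp_all add: aff_inv_0)
qed

text \<open>
  The remaining point is the limit at \<open>0\<close> of a line parallel to an axis in a second chart.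
\<close>

lemma bdry_irreducible: "irreducible_subset Mtilde (bdry c)"
proof -
  have irr: "irreducible_subset Mtilde (bdry c)"
    if "M.holomorphic_curve \<gamma> UNIV" "M.holomorphic_curve \<delta> T" "0 \<in> T" "\<And>s. s \<in> T \<Longrightarrow> s \<noteq> 0 \<Longrightarrow> \<exists>r. \<delta> s = \<gamma> r"
      "bdry c = insert (\<delta> 0) (range \<gamma>)" for \<gamma> \<delta> T c
    by (rule M.irreducible_of_curve[OF bdry_analytic that(1) _ _ that(2,3)]) (use that in auto)
  have op: "open (- {1 :: complex})" by auto
  show ?thesis
  proof (cases c)
    case A0
    show ?thesis unfolding A0
    proof (rule irr[OF vertical[of UNIV 0 E1b] vertical[OF op, of 0 TR] _ _ bdry_param(1)])
      fix s :: complex assume s: "s \<in> - {1}" "s \<noteq> 0"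
      show "\<exists>r. chart_map TR (0, s) = chart_map E1b (0, r)"
        by (rule exI[of _ "1 / s - 1"]) (use s in \<open>auto simp: aff_inv_nonzero\<close>)
    qed (auto simp: chart_dom_def)
  next
    case AI
    show ?thesis unfolding AI
    proof (rule irr[OF vertical[of UNIV 0 E0b] vertical[of UNIV 0 EIb] _ _ bdry_param(2)])
      fix s :: complex assume s: "s \<noteq> 0"
      show "\<exists>r. chart_map EIb (0, s) = chart_map E0b (0, r)"
        by (rule exI[of _ "1 / s"]) (use s in \<open>auto simp: aff_inv_nonzero\<close>)
    qed (auto simp: chart_dom_def)
  next
    case Q0
    show ?thesis unfolding Q0
    proof (rule irr[OF horizontal[of UNIV 0 TQ] horizontal[of UNIV 0 E0a] _ _ bdry_param(3)])
      fix s :: complex assume s: "s \<noteq> 0"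
      show "\<exists>r. chart_map E0a (s, 0) = chart_map TQ (r, 0)"
        by (rule exI[of _ "1 / s"]) (use s in \<open>auto simp: aff_inv_nonzero\<close>)
    qed (auto simp: chart_dom_def)
  next
    case Q1
    show ?thesis unfolding Q1
    proof (rule irr[OF horizontal[of UNIV 0 E1a] horizontal[of UNIV 1 SQ] _ _ bdry_param(4)])
      fix s :: complex assume s: "s \<noteq> 0"
      show "\<exists>r. chart_map SQ (s, 1) = chart_map E1a (r, 0)"
        by (rule exI[of _ "1 / s"]) (use s in \<open>auto simp: aff_inv_nonzero\<close>)
    qed (auto simp: chart_dom_def)
  next
    case QI
    show ?thesis unfolding QI
    proof (rule irr[OF horizontal[of UNIV 0 TR] horizontal[of UNIV 0 EIa] _ _ bdry_param(5)])
      fix s :: complex assume s: "s \<noteq> 0"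
      show "\<exists>r. chart_map EIa (s, 0) = chart_map TR (r, 0)"
        by (rule exI[of _ "1 / s"]) (use s in \<open>auto simp: aff_inv_nonzero aff_inv_0\<close>)
    qed (auto simp: chart_dom_def)
  next
    case B1
    show ?thesis unfolding B1
    proof (rule irr[OF vertical[of UNIV 0 E1a] horizontal[of UNIV 0 E1b] _ _ bdry_param(6)])
      fix s :: complex assume s: "s \<noteq> 0"
      show "\<exists>r. chart_map E1b (s, 0) = chart_map E1a (0, r)"
        by (rule exI[of _ "1 / s"]) (use s in \<open>auto simp: aff_inv_nonzero\<close>)
    qed (auto simp: chart_dom_def)
  next
    case B0
    show ?thesis unfolding B0
    proof (rule irr[OF vertical[of UNIV 0 E0a] horizontal[of UNIV 0 E0b] _ _ bdry_param(7)])
      fix s :: complex assume s: "s \<noteq> 0"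
      show "\<exists>r. chart_map E0b (s, 0) = chart_map E0a (0, r)"
        by (rule exI[of _ "1 / s"]) (use s in \<open>auto simp: aff_inv_nonzero\<close>)
    qed (auto simp: chart_dom_def)
  next
    case BI
    show ?thesis unfolding BI
    proof (rule irr[OF vertical[of UNIV 0 EIa] horizontal[of UNIV 0 EIb] _ _ bdry_param(8)])
      fix s :: complex assume s: "s \<noteq> 0"
      show "\<exists>r. chart_map EIb (s, 0) = chart_map EIa (0, r)"
        by (rule exI[of _ "1 / s"]) (use s in \<open>auto simp: aff_inv_nonzero\<close>)
    qed (auto simp: chart_dom_def)
  qed
qed

lemma bdry_prime: "prime_divisor Mtilde (bdry c)"
  unfolding prime_divisor_def
proof (intro conjI bdry_irreducible ballI)
  show "(ctop Mtilde) interior_of (bdry c) = {}" by (rule M.interior_of_avoiding_dense[OF bdry_Mopen])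
  fix x assume "x \<in> topspace (ctop Mtilde)"
  then obtain i where i: "x \<in> chart_img i" using topspace_chart_img by blast
  show "\<exists>W f. x \<in> W \<and> hol Mtilde W f \<and> bdry c \<inter> W = {y \<in> W. f y = 0}"
    by (intro exI[of _ "chart_img i"] exI[of _ "point_eqn i c"] conjI)
      (use i point_eqn_hol in \<open>auto simp: point_eqn_zero\<close>)
qed

text \<open>A point of each curve that lies on no other one.\<close>

lemma bdry_inj:
  assumes "bdry c = bdry d"
  shows "c = d"
proof -
  define p where "p c = (case c of A0 \<Rightarrow> Pt (Aff 0, Aff 2) | AI \<Rightarrow> Pt (Infty, Aff 2) | Q0 \<Rightarrow> Pt (Aff 1, Aff 0)
    | Q1 \<Rightarrow> Pt (Aff 1, Aff 1) | QI \<Rightarrow> Pt (Aff 1, Infty) | B1 \<Rightarrow> Exc (Aff 0, Aff 1) (Aff 1)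
    | B0 \<Rightarrow> Exc (Infty, Aff 0) (Aff 1) | BI \<Rightarrow> Exc (Infty, Infty) (Aff 1))" for c
  have "p c \<in> bdry c" by (cases c) (auto simp: p_def)
  moreover have "p c \<in> bdry d \<Longrightarrow> c = d" by (cases c; cases d) (auto simp: p_def)
  ultimately show ?thesis using assms by simp
qed

section \<open>Strict transforms\<close>

text \<open>
  This reaches the exceptional points of a strict transform.
\<close>

lemma limit_in_closure:
  assumes "M.holomorphic_curve \<gamma> UNIV" "\<And>s. s \<noteq> 0 \<Longrightarrow> \<gamma> s \<in> P"
  shows "\<gamma> 0 \<in> (ctop Mtilde) closure_of P"
proof (rule M.limit_in_closed[OF closedin_closure_of assms(1)])
  have "\<gamma> ` (UNIV - {0}) \<subseteq> topspace (ctop Mtilde) \<inter> P"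
    using assms unfolding M.holomorphic_curve_def by auto
  then show "\<gamma> ` (UNIV - {0}) \<subseteq> (ctop Mtilde) closure_of P"
    using closure_of_subset_Int[of "ctop Mtilde" P] by blast
qed simp

lemma strict_transform_eq:
  assumes "Pt ` (\<Gamma> - centre ` centre_charts) \<subseteq> bdry c"
    "bdry c - Pt ` (\<Gamma> - centre ` centre_charts) \<subseteq> (ctop Mtilde) closure_of (Pt ` (\<Gamma> - centre ` centre_charts))"
  shows "strict_transform \<Gamma> = bdry c"
  unfolding strict_transform_def
proof (rule equalityI)
  show "(ctop Mtilde) closure_of (Pt ` (\<Gamma> - centre ` centre_charts)) \<subseteq> bdry c"
    by (rule closure_of_minimal[OF assms(1) bdry_closed])
  have "Pt ` (\<Gamma> - centre ` centre_charts) \<subseteq> (ctop Mtilde) closure_of (Pt ` (\<Gamma> - centre ` centre_charts))"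
    by (rule closure_of_subset) (use assms(1) bdry_topspace in blast)
  then show "bdry c \<subseteq> (ctop Mtilde) closure_of (Pt ` (\<Gamma> - centre ` centre_charts))" using assms(2) by blast
qed

lemma mem_strict_part: "p \<in> \<Gamma> \<Longrightarrow> p \<notin> centre ` centre_charts \<Longrightarrow> Pt p \<in> Pt ` (\<Gamma> - centre ` centre_charts)"
  by blast

lemma curve_eq:
  "curveA (Aff 0) = bdry A0" "curveA Infty = bdry AI"
  "curveQ (Aff 0) = bdry Q0" "curveQ (Aff 1) = bdry Q1" "curveQ Infty = bdry QI"
  "curveB (Aff 1) (Aff 0) = bdry B1" "curveB (Aff 0) Infty = bdry B0" "curveB Infty Infty = bdry BI"
proof -
  show "curveB (Aff 1) (Aff 0) = bdry B1" "curveB (Aff 0) Infty = bdry B0" "curveB Infty Infty = bdry BI"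
    by (simp_all add: curveB_def)
  have v: "M.holomorphic_curve (\<lambda>s. chart_map i (0, s)) UNIV" if "chart_dom i = UNIV" for i
    by (rule vertical) (use that in auto)
  have h: "M.holomorphic_curve (\<lambda>s. chart_map i (s, 0)) UNIV" if "chart_dom i = UNIV" for i
    by (rule horizontal) (use that in auto)
  let ?P = "\<lambda>\<Gamma>. Pt ` (\<Gamma> - centre ` centre_charts)"
  let ?A = "\<lambda>j. {(t, q). t = j} :: (proj_line \<times> proj_line) set"
  let ?Q = "\<lambda>i. {(t, q). q = i} :: (proj_line \<times> proj_line) set"
  show "curveA (Aff 0) = bdry A0"
    unfolding curveA_def
  proof (rule strict_transform_eq)
    have "chart_map E1b (0, 0) \<in> (ctop Mtilde) closure_of ?P (?A (Aff 0))"
      by (rule limit_in_closure[OF v]) (auto simp: chart_dom_def centres)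
    then show "bdry A0 - ?P (?A (Aff 0)) \<subseteq> (ctop Mtilde) closure_of ?P (?A (Aff 0))"
      unfolding centres by (auto simp: aff_inv_0)
  qed (auto simp: centres)
  show "curveA Infty = bdry AI"
    unfolding curveA_def
  proof (rule strict_transform_eq)
    have "chart_map E0b (0, 0) \<in> (ctop Mtilde) closure_of ?P (?A Infty)"
      by (rule limit_in_closure[OF v]) (auto simp: chart_dom_def centres aff_inv_0)
    moreover have "chart_map EIb (0, 0) \<in> (ctop Mtilde) closure_of ?P (?A Infty)"
      by (rule limit_in_closure[OF v]) (auto simp: chart_dom_def centres aff_inv_0 aff_inv_nonzero)
    ultimately show "bdry AI - ?P (?A Infty) \<subseteq> (ctop Mtilde) closure_of ?P (?A Infty)"
      unfolding centres by (auto simp: aff_inv_0)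
  qed (auto simp: centres)
  show "curveQ (Aff 0) = bdry Q0"
    unfolding curveQ_def
  proof (rule strict_transform_eq)
    have "chart_map E0a (0, 0) \<in> (ctop Mtilde) closure_of ?P (?Q (Aff 0))"
      by (rule limit_in_closure[OF h]) (auto simp: chart_dom_def centres aff_inv_nonzero)
    then show "bdry Q0 - ?P (?Q (Aff 0)) \<subseteq> (ctop Mtilde) closure_of ?P (?Q (Aff 0))"
      unfolding centres by (auto simp: aff_inv_0)
  qed (auto simp: centres)
  show "curveQ (Aff 1) = bdry Q1"
    unfolding curveQ_def
  proof (rule strict_transform_eq)
    have "chart_map E1a (0, 0) \<in> (ctop Mtilde) closure_of ?P (?Q (Aff 1))"
      by (rule limit_in_closure[OF h]) (auto simp: chart_dom_def centres)
    moreover have "Pt (t, Aff 1) \<in> ?P (?Q (Aff 1))" if "t \<noteq> Aff 0" for t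
      by (rule mem_strict_part) (use that in \<open>auto simp: centres\<close>)
    ultimately show "bdry Q1 - ?P (?Q (Aff 1)) \<subseteq> (ctop Mtilde) closure_of ?P (?Q (Aff 1))" by fastforce
  qed (auto simp: centres)
  show "curveQ Infty = bdry QI"
    unfolding curveQ_def
  proof (rule strict_transform_eq)
    have "chart_map EIa (0, 0) \<in> (ctop Mtilde) closure_of ?P (?Q Infty)"
      by (rule limit_in_closure[OF h]) (auto simp: chart_dom_def centres aff_inv_nonzero aff_inv_0)
    then show "bdry QI - ?P (?Q Infty) \<subseteq> (ctop Mtilde) closure_of ?P (?Q Infty)"
      unfolding centres by (auto simp: aff_inv_0)
  qed (auto simp: centres)
qed

section \<open>Local equations of the boundary curves\<close>

lemma divide_by_second_coordinate:
  assumes U: "open U" and c: "c \<in> U" and f: "holomorphic2_on f U"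
    and van: "\<And>z. z \<in> U \<Longrightarrow> snd z = snd c \<Longrightarrow> f z = 0"
  shows "\<exists>V h. open V \<and> c \<in> V \<and> V \<subseteq> U \<and> holomorphic2_on h V \<and> (\<forall>z\<in>V. f z = (snd z - snd c) * h z)"
proof -
  let ?s = "\<lambda>z :: complex \<times> complex. (snd z, fst z)"
  have op: "open (?s -` S)" if "open S" for S
    by (rule open_vimage[OF that]) (intro continuous_intros)
  have sw: "holomorphic2_on (\<lambda>z. g (?s z)) (?s -` S)" if "holomorphic2_on g S" for g S
    by (rule holomorphic2_on_compose[OF holomorphic2_on_snd holomorphic2_on_fst that]) auto
  have "\<exists>V h. open V \<and> ?s c \<in> V \<and> V \<subseteq> ?s -` U \<and> holomorphic2_on h V \<and> (\<forall>z\<in>V. f (?s z) = (fst z - fst (?s c)) * h z)"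
    by (rule divide_by_coordinate[OF op[OF U] _ sw[OF f]]) (use c van in auto)
  then obtain V h where V: "open V" "?s c \<in> V" "V \<subseteq> ?s -` U" "holomorphic2_on h V"
    "\<forall>z\<in>V. f (?s z) = (fst z - fst (?s c)) * h z" by blast
  have "f z = (snd z - snd c) * h (?s z)" if "z \<in> ?s -` V" for z
    using V(5) that by force
  moreover have "?s -` V \<subseteq> U" using V(3) by force
  ultimately show ?thesis
    using op[OF V(1)] sw[OF V(4)] V(2)
    by (intro exI[of _ "?s -` V"] exI[of _ "\<lambda>z. h (?s z)"]) auto
qed

text \<open>
  A chart that contains almost all of the curve and in which the curve is a line parallel to an axis.
\<close>

definition gen_chart :: "bcurve \<Rightarrow> chart" where
  "gen_chart c = (case c of A0 \<Rightarrow> TQ | AI \<Rightarrow> SQ | Q0 \<Rightarrow> TQ | Q1 \<Rightarrow> TQ | QI \<Rightarrow> TR | B1 \<Rightarrow> E1a | B0 \<Rightarrow> E0a | BI \<Rightarrow> EIa)"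

lemma gen_chart_chart_eqn: "(\<exists>k. \<forall>z. chart_eqn (gen_chart c) c z = fst z - k) \<or> (\<exists>k. \<forall>z. chart_eqn (gen_chart c) c z = snd z - k)"
  by (cases c) (auto simp: gen_chart_def chart_eqn_def intro: exI[of _ 0])

lemma divide_by_chart_eqn:
  assumes U: "open U" "z0 \<in> U" and g: "holomorphic2_on g U" and z0: "chart_eqn (gen_chart c) c z0 = 0"
    and van: "\<And>z. z \<in> U \<Longrightarrow> chart_eqn (gen_chart c) c z = 0 \<Longrightarrow> g z = 0"
  shows "\<exists>V h. open V \<and> z0 \<in> V \<and> V \<subseteq> U \<and> holomorphic2_on h V \<and> (\<forall>z\<in>V. g z = chart_eqn (gen_chart c) c z * h z)"
proof (rule disjE[OF gen_chart_chart_eqn[of c]])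
  assume "\<exists>k. \<forall>z. chart_eqn (gen_chart c) c z = fst z - k"
  then obtain k where k: "\<And>z. chart_eqn (gen_chart c) c z = fst z - k" by blast
  then have "chart_eqn (gen_chart c) c z = fst z - fst z0" for z using z0 by simp
  then show ?thesis using divide_by_coordinate[OF U g] van by simp
next
  assume "\<exists>k. \<forall>z. chart_eqn (gen_chart c) c z = snd z - k"
  then obtain k where k: "\<And>z. chart_eqn (gen_chart c) c z = snd z - k" by blast
  then have "chart_eqn (gen_chart c) c z = snd z - snd z0" for z using z0 by simp
  then show ?thesis using divide_by_second_coordinate[OF U g] van by simp
qed

text \<open>
  The quotient by the equation is holomorphic near each point by division by a coordinate; the local
  quotients agree where the equation does not vanish and glue.
\<close>

lemma bdry_local_equation: "local_equation Mtilde (bdry c) (chart_img (gen_chart c)) (point_eqn (gen_chart c) c)"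
  unfolding local_equation_def
proof (intro conjI point_eqn_hol allI impI)
  let ?i = "gen_chart c"
  let ?l = "point_eqn ?i c"
  fix V g
  assume V: "V \<subseteq> chart_img ?i" and g: "hol Mtilde V g"
  show "(\<forall>y\<in>V \<inter> bdry c. g y = 0) \<longleftrightarrow> (\<exists>h. hol Mtilde V h \<and> (\<forall>y\<in>V. g y = ?l y * h y))"
  proof
    assume "\<exists>h. hol Mtilde V h \<and> (\<forall>y\<in>V. g y = ?l y * h y)"
    then show "\<forall>y\<in>V \<inter> bdry c. g y = 0" using point_eqn_zero V by (metis IntE mult_zero_left subsetD)
  next
    assume van: "\<forall>y\<in>V \<inter> bdry c. g y = 0"
    note Vop = M.hol_openin[OF g]
    have l: "hol Mtilde V ?l" by (rule M.hol_subset[OF point_eqn_hol Vop V])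
    have N: "?l y \<noteq> 0" if "y \<in> V \<inter> Mopen" for y using point_eqn_zero[of y ?i c] bdry_Mopen[of c] V that by blast
    have "\<exists>u. hol Mtilde V u \<and> (\<forall>y\<in>V \<inter> Mopen. u y = g y / ?l y)"
    proof (rule M.glue[OF Vop])
      fix x assume x: "x \<in> V"
      show "\<exists>V' u. x \<in> V' \<and> hol Mtilde V' u \<and> (\<forall>y\<in>V' \<inter> Mopen. u y = g y / ?l y)"
      proof (cases "?l x = 0")
        case False
        let ?V = "{y \<in> V. ?l y \<noteq> 0}"
        have op: "openin (ctop Mtilde) ?V" by (rule M.openin_nonzero[OF l])
        have "hol Mtilde ?V (\<lambda>y. g y * inverse (?l y))"
          by (intro M.hol_mult M.hol_inverse M.hol_subset[OF g op] M.hol_subset[OF l op]) auto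
        then show ?thesis using False x
          by (intro exI[of _ ?V] exI[of _ "\<lambda>y. g y * inverse (?l y)"]) (auto simp: divide_inverse)
      next
        case True
        obtain z0 where z0: "z0 \<in> chart_dom ?i" "chart_map ?i z0 = x" using V x by blast
        let ?U = "{z \<in> chart_dom ?i. chart_map ?i z \<in> V}"
        have U: "open ?U" "z0 \<in> ?U" using M.open_vimage[OF Vop chart_mem] z0 x by auto
        have h: "holomorphic2_on (g \<circ> chart_map ?i) ?U" by (rule M.hol_chartD[OF g chart_mem])
        have l0: "chart_eqn ?i c z0 = 0" using True point_eqn_chart[OF z0(1)] z0(2) by simp
        have "(g \<circ> chart_map ?i) z = 0" if "z \<in> ?U" "chart_eqn ?i c z = 0" for z
          using van mem_bdry[of z ?i c] that by auto
        from divide_by_chart_eqn[OF U h l0 this] obtain U' k where U': "open U'" "z0 \<in> U'" "U' \<subseteq> ?U" "holomorphic2_on k U'"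
          "\<forall>z\<in>U'. (g \<circ> chart_map ?i) z = chart_eqn ?i c z * k z" by blast
        have dom: "U' \<subseteq> chart_dom ?i" using U'(3) by blast
        have "hol Mtilde (chart_map ?i ` U') (k \<circ> chart_inv ?i)"
          by (rule M.hol_chartI[OF chart_mem U'(1) dom U'(4)])
        moreover have "(k \<circ> chart_inv ?i) y = g y / ?l y" if y: "y \<in> chart_map ?i ` U' \<inter> Mopen" for y
        proof -
          obtain z where z: "z \<in> U'" "y = chart_map ?i z" using y by blast
          then have zd: "z \<in> chart_dom ?i" "y \<in> V" using U'(3) by auto
          have "?l y \<noteq> 0" using N y zd by blast
          moreover have "g y = ?l y * k z" using U'(5) z point_eqn_chart[OF zd(1)] by auto
          ultimately show ?thesis using z chart_inv[OF zd(1)] by simp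
        qed
        ultimately show ?thesis using U'(2) z0(2)
          by (intro exI[of _ "chart_map ?i ` U'"] exI[of _ "k \<circ> chart_inv ?i"]) auto
      qed
    qed
    then obtain u where u: "hol Mtilde V u" "\<forall>y\<in>V \<inter> Mopen. u y = g y / ?l y" by blast
    have "g y = ?l y * u y" if y: "y \<in> V" for y
      by (rule M.eq_of_eq_on_dense[OF g M.hol_mult[OF l u(1)] _ y]) (use u(2) N in auto)
    then show "\<exists>h. hol Mtilde V h \<and> (\<forall>y\<in>V. g y = ?l y * h y)" using u(1) by blast
  qed
qed

text \<open>
  The exceptions are the crossings with other boundary curves and the points outside the chosen chart.
\<close>

lemma bdry_generic:
  "\<exists>F. finite F \<and> (\<forall>x\<in>bdry c - F. x \<in> chart_img (gen_chart c) \<and> (\<forall>d. d \<noteq> c \<longrightarrow> x \<notin> bdry d))"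
proof -
  define F where "F = (case c of
      A0 \<Rightarrow> {Pt (Aff 0, Aff 0), Pt (Aff 0, Infty), Exc (Aff 0, Aff 1) Infty}
    | AI \<Rightarrow> {Pt (Infty, Aff 1), Exc (Infty, Aff 0) Infty, Exc (Infty, Infty) Infty}
    | Q0 \<Rightarrow> {Pt (Aff 0, Aff 0), Exc (Infty, Aff 0) (Aff 0)}
    | Q1 \<Rightarrow> {Pt (Infty, Aff 1), Exc (Aff 0, Aff 1) (Aff 0)}
    | QI \<Rightarrow> {Pt (Aff 0, Infty), Exc (Infty, Infty) (Aff 0)}
    | B1 \<Rightarrow> Exc (Aff 0, Aff 1) ` {Aff 0, Infty}
    | B0 \<Rightarrow> Exc (Infty, Aff 0) ` {Aff 0, Infty}
    | BI \<Rightarrow> Exc (Infty, Infty) ` {Aff 0, Infty})"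
  have "finite F" by (cases c) (simp_all add: F_def)
  moreover have "x \<notin> bdry d" if "x \<in> bdry c - F" "d \<noteq> c" for x d
    using that by (cases c; cases d; auto simp: F_def)
  moreover have "\<exists>z. z \<in> chart_dom (gen_chart c) \<and> chart_map (gen_chart c) z = x" if x: "x \<in> bdry c - F" for x
  proof (cases c)
    case A0
    with x obtain b where "x = Pt (Aff 0, Aff b)" "b \<noteq> 1" by (auto simp: F_def elim: proj_line.exhaust) (metis proj_line.exhaust)
    then show ?thesis using A0 by (intro exI[of _ "(0, b)"]) (simp add: gen_chart_def chart_dom_def)
  next
    case AI
    with x obtain b where "x = Pt (Infty, Aff b)" "b \<noteq> 0" by (auto simp: F_def) (metis proj_line.exhaust)
    then show ?thesis using AI by (intro exI[of _ "(0, b)"]) (simp add: gen_chart_def chart_dom_def aff_inv_0)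
  next
    case Q0
    with x obtain a where "x = Pt (Aff a, Aff 0)" by (auto simp: F_def) (metis proj_line.exhaust)
    then show ?thesis using Q0 by (intro exI[of _ "(a, 0)"]) (simp add: gen_chart_def chart_dom_def)
  next
    case Q1
    with x obtain a where "x = Pt (Aff a, Aff 1)" "a \<noteq> 0" by (auto simp: F_def) (metis proj_line.exhaust)
    then show ?thesis using Q1 by (intro exI[of _ "(a, 1)"]) (simp add: gen_chart_def chart_dom_def)
  next
    case QI
    with x obtain a where "x = Pt (Aff a, Infty)" by (auto simp: F_def) (metis proj_line.exhaust)
    then show ?thesis using QI by (intro exI[of _ "(a, 0)"]) (simp add: gen_chart_def chart_dom_def aff_inv_0)
  next
    case B1
    with x obtain v where "x = Exc (Aff 0, Aff 1) (Aff v)" by (auto simp: F_def) (metis proj_line.exhaust)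
    then show ?thesis using B1 by (intro exI[of _ "(0, v)"]) (simp add: gen_chart_def chart_dom_def)
  next
    case B0
    with x obtain v where "x = Exc (Infty, Aff 0) (Aff v)" by (auto simp: F_def) (metis proj_line.exhaust)
    then show ?thesis using B0 by (intro exI[of _ "(0, v)"]) (simp add: gen_chart_def chart_dom_def)
  next
    case BI
    with x obtain v where "x = Exc (Infty, Infty) (Aff v)" by (auto simp: F_def) (metis proj_line.exhaust)
    then show ?thesis using BI by (intro exI[of _ "(0, v)"]) (simp add: gen_chart_def chart_dom_def)
  qed
  ultimately show ?thesis by (intro exI[of _ F]) (fastforce simp: image_iff)
qed

section \<open>Divisors of monomials\<close>

definition bdry_div :: "(bcurve \<Rightarrow> int) \<Rightarrow> (point set \<Rightarrow>\<^sub>0 int)" where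
  "bdry_div n = (\<Sum>c\<in>UNIV. frag_cmul (n c) (frag_of (bdry c)))"

lemma lookup_bdry_div: "Poly_Mapping.lookup (bdry_div n) C = (\<Sum>c\<in>UNIV. if bdry c = C then n c else 0)"
  unfolding bdry_div_def lookup_sum by (rule sum.cong) auto

lemma lookup_bdry_div_bdry: "Poly_Mapping.lookup (bdry_div n) (bdry c) = n c"
proof -
  have "(\<Sum>d\<in>UNIV. if bdry d = bdry c then n d else 0) = (\<Sum>d\<in>UNIV. if d = c then n d else 0)"
    by (intro sum.cong) (auto dest: bdry_inj)
  then show ?thesis by (simp add: lookup_bdry_div finite_bcurve)
qed

lemma keys_bdry_div: "Poly_Mapping.keys (bdry_div n) = bdry ` {c. n c \<noteq> 0}"
proof (intro equalityI subsetI)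
  fix C assume C: "C \<in> Poly_Mapping.keys (bdry_div n)"
  then have "(\<Sum>c\<in>UNIV. if bdry c = C then n c else 0) \<noteq> 0" by (simp add: in_keys_iff lookup_bdry_div)
  then obtain c where "(if bdry c = C then n c else 0) \<noteq> 0" by (rule sum.not_neutral_contains_not_neutral)
  then have "bdry c = C" by (simp split: if_splits)
  then show "C \<in> bdry ` {c. n c \<noteq> 0}" using C by (auto simp: in_keys_iff lookup_bdry_div_bdry)
next
  fix C assume "C \<in> bdry ` {c. n c \<noteq> 0}"
  then show "C \<in> Poly_Mapping.keys (bdry_div n)" by (auto simp: in_keys_iff lookup_bdry_div_bdry)
qed

lemma bdry_div_diff: "bdry_div n - bdry_div m = bdry_div (\<lambda>c. n c - m c)"
proof (rule poly_mapping_eqI)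
  fix C
  show "Poly_Mapping.lookup (bdry_div n - bdry_div m) C = Poly_Mapping.lookup (bdry_div (\<lambda>c. n c - m c)) C"
    unfolding lookup_minus lookup_bdry_div sum_subtractf[symmetric] by (rule sum.cong) auto
qed

lemma bdry_div_divisor: "bdry_div n \<in> divisors Mtilde"
  using bdry_prime by (auto simp: divisors_def keys_bdry_div)

lemma supp_bdry_div: "supp (bdry_div n) = \<Union> (bdry ` {c. n c \<noteq> 0})"
  by (simp add: supp_def keys_bdry_div)

lemma supp_bdry_div_Mopen: "supp (bdry_div n) \<inter> Mopen = {}"
  using bdry_Mopen unfolding supp_bdry_div by blast

text \<open>
  A function that in every chart is the product of powers of the local equations, with the same
  exponents in all charts and up to a constant. The exponents are the orders along the curves.
\<close>

definition monomial :: "(point \<Rightarrow> complex) \<Rightarrow> (bcurve \<Rightarrow> int) \<Rightarrow> bool" where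
  "monomial g n \<longleftrightarrow> (\<exists>k. k \<noteq> 0 \<and> (\<forall>i. \<forall>y\<in>chart_img i \<inter> Mopen. g y = k * (\<Prod>c\<in>UNIV. point_eqn i c y powi n c)))"

lemma point_eqn_nonzero: "y \<in> chart_img i \<Longrightarrow> y \<notin> bdry c \<Longrightarrow> point_eqn i c y \<noteq> 0"
  using point_eqn_zero by blast

lemma point_eqn_unit: "openin (ctop Mtilde) V \<Longrightarrow> V \<subseteq> chart_img i \<Longrightarrow> V \<inter> bdry c = {} \<Longrightarrow> hol_unit Mtilde V (point_eqn i c)"
  unfolding hol_unit_def using M.hol_subset[OF point_eqn_hol] point_eqn_nonzero by blast

lemma openin_off_curves:
  assumes "openin (ctop Mtilde) W"
  shows "openin (ctop Mtilde) (W - \<Union> (bdry ` S))"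
proof -
  have "finite S" using finite_bcurve by (rule finite_subset[rotated]) simp
  then have "closedin (ctop Mtilde) (\<Union> (bdry ` S))" by (intro closedin_Union) (auto simp: bdry_closed)
  with assms show ?thesis by blast
qed

text \<open>
  In each chart the product of the factors with positive exponents and that of the factors with
  negative exponents exhibit \<open>g\<close> as a quotient. Off the support of the divisor all factors with a nonzero
  exponent are units, and so are, at a generic point of a curve, all factors but the one of this
  curve.
\<close>

lemma monomial_divisor:
  assumes g: "monomial g n" and W: "openin (ctop Mtilde) W" and nm: "\<And>c. bdry c \<inter> W \<noteq> {} \<Longrightarrow> n c = m c"
  shows "fun_has_divisor_on Mtilde W (W \<inter> Mopen) g (bdry_div m)"
  unfolding fun_has_divisor_on_def has_divisor_on_def
proof (intro conjI ballI)
  obtain k where k: "k \<noteq> 0" "\<And>i y. y \<in> chart_img i \<inter> Mopen \<Longrightarrow> g y = k * (\<Prod>c\<in>UNIV. point_eqn i c y powi n c)"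
    using g unfolding monomial_def by blast
  have WM: "openin (ctop Mtilde) (W \<inter> Mopen)" using W Mopen_open by (rule openin_Int)
  let ?tr = "trivial_bundle Mtilde"
  show "bdry_div m \<in> divisors Mtilde" by (rule bdry_div_divisor)
  show "openin (ctop Mtilde) W" "W \<inter> Mopen \<subseteq> W" using W by auto
  show "W \<subseteq> (ctop Mtilde) closure_of (W \<inter> Mopen)" by (rule M.dense_closure[OF _ W]) auto
  show "hol_section Mtilde ?tr (W \<inter> Mopen) (\<lambda>x. (x, g x))"
    unfolding hol_section_def trivial_bundle_def
  proof (simp, intro conjI ballI WM)
    show "y \<in> topspace (ctop Mtilde)" if "y \<in> W \<inter> Mopen" for y using that Mopen_topspace by blast
    have eq: "W \<inter> Mopen \<inter> topspace (ctop Mtilde) = W \<inter> Mopen" using Mopen_topspace by blast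
    have "hol Mtilde (W \<inter> Mopen) g"
    proof (rule M.hol_local)
      fix x assume x: "x \<in> W \<inter> Mopen"
      then obtain i where i: "x \<in> chart_img i" using topspace_chart_img Mopen_topspace by blast
      let ?V = "chart_img i \<inter> (W \<inter> Mopen)"
      have op: "openin (ctop Mtilde) ?V" using chart_img_open WM by (rule openin_Int)
      have "hol_unit Mtilde ?V (\<lambda>y. k * (\<Prod>c\<in>UNIV. point_eqn i c y powi n c))"
        by (intro M.hol_unit_mult M.hol_unit_const[OF op k(1)] M.hol_unit_prod[OF op] M.hol_unit_powi point_eqn_unit[OF op])
          (use bdry_Mopen in auto)
      then have "hol Mtilde ?V (\<lambda>y. k * (\<Prod>c\<in>UNIV. point_eqn i c y powi n c))" by (rule M.hol_unitD(1))
      moreover have "k * (\<Prod>c\<in>UNIV. point_eqn i c y powi n c) = g y" if "y \<in> ?V" for y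
        by (rule k(2)[symmetric]) (use that in blast)
      moreover have "x \<in> ?V" using x i by blast
      ultimately show "\<exists>V h. x \<in> V \<and> V \<subseteq> W \<inter> Mopen \<and> hol Mtilde V h \<and> (\<forall>y\<in>V. h y = g y)"
        by (intro exI[of _ ?V] exI[of _ "\<lambda>y. k * (\<Prod>c\<in>UNIV. point_eqn i c y powi n c)"] conjI ballI) blast+
    qed
    then show "hol Mtilde (W \<inter> Mopen \<inter> topspace (ctop Mtilde)) (snd \<circ> (\<lambda>x. (x, g x)))"
      unfolding eq by (simp add: comp_def)
  qed
  show "meromorphic_at Mtilde ?tr (W \<inter> Mopen) (\<lambda>x. (x, g x)) x" if x: "x \<in> W" for x
  proof -
    obtain i where i: "x \<in> chart_img i" using topspace_chart_img openin_subset[OF W] x by blast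
    let ?V = "chart_img i"
    let ?a = "\<lambda>y. k * (\<Prod>c\<in>UNIV. point_eqn i c y ^ nat (n c))" and ?b = "\<lambda>y. \<Prod>c\<in>UNIV. point_eqn i c y ^ nat (- n c)"
    have pw: "hol Mtilde ?V (\<lambda>y. point_eqn i c y ^ p)" for c p
      by (induction p) (auto intro: M.hol_const[OF chart_img_open] M.hol_mult point_eqn_hol)
    have pr: "hol Mtilde ?V (\<lambda>y. \<Prod>c\<in>S. point_eqn i c y ^ p c)" for S p
      by (induction S rule: infinite_finite_induct) (auto intro: M.hol_const[OF chart_img_open] M.hol_mult pw)
    have ab: "?b y * g y = ?a y" "?b y \<noteq> 0" if y: "y \<in> ?V \<inter> Mopen" for y
    proof -
      have l: "point_eqn i c y \<noteq> 0" for c using point_eqn_nonzero y bdry_Mopen by blast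
      have "point_eqn i c y ^ nat (- n c) * point_eqn i c y powi n c = point_eqn i c y ^ nat (n c)" for c
        using l[of c] by (simp add: power_int_def field_simps)
      then have "?b y * (\<Prod>c\<in>UNIV. point_eqn i c y powi n c) = (\<Prod>c\<in>UNIV. point_eqn i c y ^ nat (n c))"
        by (simp add: prod.distrib[symmetric])
      then show "?b y * g y = ?a y" using k(2)[OF y] by (simp add: mult.left_commute)
      show "?b y \<noteq> 0" using l by (simp add: finite_bcurve)
    qed
    have int: "(ctop Mtilde) interior_of {y \<in> ?V. ?b y = 0} = {}"
      by (rule M.interior_of_avoiding_dense) (use ab(2) in blast)
    have a: "hol Mtilde ?V ?a" by (rule M.hol_mult[OF M.hol_const[OF chart_img_open] pr])
    have b: "hol Mtilde ?V ?b" by (rule pr)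
    have eq: "\<forall>y\<in>?V \<inter> (W \<inter> Mopen). ?b y * snd (y, g y) = ?a y"
    proof
      fix y assume "y \<in> ?V \<inter> (W \<inter> Mopen)"
      then have "y \<in> ?V \<inter> Mopen" by blast
      from ab(1)[OF this] show "?b y * snd (y, g y) = ?a y" by simp
    qed
    show ?thesis
      unfolding meromorphic_at_def
      by (rule exI[of _ ?V], rule exI[of _ snd], rule exI[of _ ?a], rule exI[of _ ?b])
        (intro conjI i M.trivial_fibre_coord_snd[OF chart_img_open] a b int eq)
  qed
  show "frame_at Mtilde ?tr (W \<inter> Mopen) (\<lambda>x. (x, g x)) x" if x: "x \<in> W - supp (bdry_div m)" for x
  proof -
    obtain i where i: "x \<in> chart_img i" using topspace_chart_img openin_subset[OF W] x by blast
    let ?S = "{c. n c \<noteq> 0}"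
    let ?V = "chart_img i \<inter> W - \<Union> (bdry ` ?S)"
    have op: "openin (ctop Mtilde) ?V" using openin_off_curves chart_img_open W by blast
    let ?u = "\<lambda>y. k * (\<Prod>c\<in>?S. point_eqn i c y powi n c)"
    have "hol_unit Mtilde ?V ?u"
      by (intro M.hol_unit_mult M.hol_unit_const[OF op k(1)] M.hol_unit_prod[OF op] M.hol_unit_powi point_eqn_unit[OF op]) auto
    moreover have "?u y = g y" if "y \<in> ?V \<inter> (W \<inter> Mopen)" for y
    proof -
      have "(\<Prod>c\<in>?S. point_eqn i c y powi n c) = (\<Prod>c\<in>UNIV. point_eqn i c y powi n c)"
        by (intro prod.mono_neutral_left finite_bcurve) auto
      moreover have "y \<in> chart_img i \<inter> Mopen" using that by blast
      ultimately show ?thesis using k(2)[of y i] by simp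
    qed
    moreover have "x \<in> ?V"
    proof -
      have "x \<notin> bdry c" if "n c \<noteq> 0" for c
        using nm[of c] x that unfolding supp_bdry_div by fastforce
      then show ?thesis using x i by blast
    qed
    ultimately show ?thesis
      unfolding frame_at_def snd_conv
      by (intro exI[of _ ?V] exI[of _ snd] exI[of _ ?u] conjI ballI M.trivial_fibre_coord_snd[OF op])
        (blast, blast, simp)
  qed
  fix C assume "C \<in> Poly_Mapping.keys (bdry_div m)"
  then obtain c where C: "C = bdry c" by (auto simp: keys_bdry_div)
  obtain F where F: "finite F" "\<And>x. x \<in> bdry c - F \<Longrightarrow> x \<in> chart_img (gen_chart c)"
    "\<And>x d. x \<in> bdry c - F \<Longrightarrow> d \<noteq> c \<Longrightarrow> x \<notin> bdry d"
    using bdry_generic[of c] by blast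
  have "order_at Mtilde ?tr (W \<inter> Mopen) (\<lambda>x. (x, g x)) (bdry c) (m c) x" if x: "x \<in> bdry c \<inter> W - F" for x
  proof -
    let ?i = "gen_chart c" and ?S = "{d. d \<noteq> c}"
    let ?V = "chart_img ?i \<inter> W - \<Union> (bdry ` ?S)"
    have op: "openin (ctop Mtilde) ?V" using openin_off_curves chart_img_open W by blast
    let ?u = "\<lambda>y. k * (\<Prod>d\<in>?S. point_eqn ?i d y powi n d)"
    have u: "hol_unit Mtilde ?V ?u"
      by (intro M.hol_unit_mult M.hol_unit_const[OF op k(1)] M.hol_unit_prod[OF op] M.hol_unit_powi point_eqn_unit[OF op]) auto
    have l: "local_equation Mtilde (bdry c) ?V (point_eqn ?i c)"
      by (rule M.local_equation_subset[OF bdry_local_equation op]) auto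
    have eq: "\<forall>y\<in>?V \<inter> (W \<inter> Mopen). snd (y, g y) = ?u y * point_eqn ?i c y powi m c"
    proof
      fix y assume y: "y \<in> ?V \<inter> (W \<inter> Mopen)"
      have "?S = UNIV - {c}" by auto
      then have "(\<Prod>d\<in>UNIV. point_eqn ?i d y powi n d) = point_eqn ?i c y powi n c * (\<Prod>d\<in>?S. point_eqn ?i d y powi n d)"
        using prod.remove[OF finite_bcurve, of c "\<lambda>d. point_eqn ?i d y powi n d"] by simp
      moreover have "n c = m c" using nm x by blast
      moreover have "y \<in> chart_img ?i \<inter> Mopen" using y by blast
      ultimately show "snd (y, g y) = ?u y * point_eqn ?i c y powi m c" using k(2)[of y ?i] by (simp add: mult_ac)
    qed
    have V: "x \<in> ?V" using F(2,3) x by blast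
    show ?thesis
      unfolding order_at_def
      by (rule exI[of _ ?V], rule exI[of _ snd], rule exI[of _ "point_eqn ?i c"], rule exI[of _ ?u])
        (intro conjI V M.trivial_fibre_coord_snd[OF op] l u eq)
  qed
  then have "{x \<in> C \<inter> W. \<not> order_at Mtilde ?tr (W \<inter> Mopen) (\<lambda>x. (x, g x)) C (Poly_Mapping.lookup (bdry_div m) C) x} \<subseteq> F"
    unfolding C lookup_bdry_div_bdry by blast
  then show "finite {x \<in> C \<inter> W. \<not> order_at Mtilde ?tr (W \<inter> Mopen) (\<lambda>x. (x, g x)) C (Poly_Mapping.lookup (bdry_div m) C) x}"
    using F(1) by (rule finite_subset)
qed

section \<open>The four frames\<close>

datatype frame = F1 | F2 | F3 | F4

fun vert_factor :: "frame \<Rightarrow> complex \<Rightarrow> complex \<Rightarrow> complex" where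
  "vert_factor F1 t q = 1"
| "vert_factor F2 t q = - 1 / (q - 1)\<^sup>2"
| "vert_factor F3 t q = - 1 / (q * t)"
| "vert_factor F4 t q = - 1 / (q - 1)"

definition frame_of :: "bcurve \<Rightarrow> frame" where
  "frame_of c = (case c of A0 \<Rightarrow> F1 | Q0 \<Rightarrow> F2 | QI \<Rightarrow> F2 | B0 \<Rightarrow> F2 | BI \<Rightarrow> F2 | Q1 \<Rightarrow> F3 | AI \<Rightarrow> F3 | B1 \<Rightarrow> F4)"

lemma vertical_factors_eq: "vertical_factors = range (\<lambda>c. (bdry c, vert_factor (frame_of c)))"
proof -
  have v: "vert_factor F1 = (\<lambda>t q. 1)" "vert_factor F2 = (\<lambda>t q. - 1 / (q - 1)\<^sup>2)" "vert_factor F3 = (\<lambda>t q. - 1 / (q * t))"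
    "vert_factor F4 = (\<lambda>t q. - 1 / (q - 1))" by (simp_all add: fun_eq_iff)
  have U: "(UNIV :: bcurve set) = {A0, Q0, QI, B0, BI, Q1, AI, B1}" by (auto intro: bcurve.exhaust)
  show ?thesis
    unfolding vertical_factors_def curve_eq U image_insert image_empty v[symmetric] frame_of_def bcurve.case ..
qed

text \<open>
  Only the values on the open part matter.
\<close>

fun tco :: "point \<Rightarrow> complex" where
  "tco (Pt (Aff t, Aff q)) = t"
| "tco _ = 0"

fun qco :: "point \<Rightarrow> complex" where
  "qco (Pt (Aff t, Aff q)) = q"
| "qco _ = 0"

definition ord_t :: "bcurve \<Rightarrow> int" where
  "ord_t c = (case c of A0 \<Rightarrow> 1 | B1 \<Rightarrow> 1 | AI \<Rightarrow> - 1 | B0 \<Rightarrow> - 1 | BI \<Rightarrow> - 1 | _ \<Rightarrow> 0)"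

definition ord_q :: "bcurve \<Rightarrow> int" where
  "ord_q c = (case c of Q0 \<Rightarrow> 1 | B0 \<Rightarrow> 1 | QI \<Rightarrow> - 1 | BI \<Rightarrow> - 1 | _ \<Rightarrow> 0)"

definition ord_q1 :: "bcurve \<Rightarrow> int" where
  "ord_q1 c = (case c of Q1 \<Rightarrow> 1 | B1 \<Rightarrow> 1 | QI \<Rightarrow> - 1 | BI \<Rightarrow> - 1 | _ \<Rightarrow> 0)"

lemma monomialI:
  assumes "\<And>i a b. (a, b) \<in> chart_dom i \<Longrightarrow> (\<And>c. chart_eqn i c (a, b) \<noteq> 0) \<Longrightarrow>
    g (chart_map i (a, b)) = (\<Prod>c\<in>UNIV. chart_eqn i c (a, b) powi n c)"
  shows "monomial g n"
  unfolding monomial_def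
proof (intro exI[of _ 1] conjI allI ballI)
  fix i y assume y: "y \<in> chart_img i \<inter> Mopen"
  then obtain a b where z: "y = chart_map i (a, b)" "(a, b) \<in> chart_dom i" by auto
  then have "chart_eqn i c (a, b) \<noteq> 0" for c using Mopen_chart y by blast
  from assms[OF z(2) this] show "g y = 1 * (\<Prod>c\<in>UNIV. point_eqn i c y powi n c)" using z by (simp add: point_eqn_chart)
qed simp

lemma prod_bcurve:
  "(\<Prod>c\<in>UNIV. f c) = f A0 * f AI * f Q0 * f Q1 * f QI * f B1 * f B0 * (f BI :: complex)"
  unfolding UNIV_bcurve by (simp add: mult_ac)

lemma monomial_t: "monomial tco ord_t"
  and monomial_q: "monomial qco ord_q"
  and monomial_q1: "monomial (\<lambda>y. qco y - 1) ord_q1"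
proof -
  have ne: "chart_eqn i A0 z \<noteq> 0" "chart_eqn i AI z \<noteq> 0" "chart_eqn i Q0 z \<noteq> 0" "chart_eqn i Q1 z \<noteq> 0" "chart_eqn i QI z \<noteq> 0"
    "chart_eqn i B1 z \<noteq> 0" "chart_eqn i B0 z \<noteq> 0" "chart_eqn i BI z \<noteq> 0" if "\<And>c. chart_eqn i c z \<noteq> 0" for i z
    using that by blast+
  show "monomial tco ord_t"
  proof (rule monomialI)
    fix i a b assume "\<And>c. chart_eqn i c (a, b) \<noteq> 0"
    from ne[OF this] show "tco (chart_map i (a, b)) = (\<Prod>c\<in>UNIV. chart_eqn i c (a, b) powi ord_t c)"
      unfolding prod_bcurve by (cases i) (simp_all add: chart_eqn_def ord_t_def aff_inv_def power_int_minus field_simps)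
  qed
  show "monomial qco ord_q"
  proof (rule monomialI)
    fix i a b assume "\<And>c. chart_eqn i c (a, b) \<noteq> 0"
    from ne[OF this] show "qco (chart_map i (a, b)) = (\<Prod>c\<in>UNIV. chart_eqn i c (a, b) powi ord_q c)"
      unfolding prod_bcurve by (cases i) (simp_all add: chart_eqn_def ord_q_def aff_inv_def power_int_minus field_simps)
  qed
  show "monomial (\<lambda>y. qco y - 1) ord_q1"
  proof (rule monomialI)
    fix i a b assume "\<And>c. chart_eqn i c (a, b) \<noteq> 0"
    from ne[OF this] show "qco (chart_map i (a, b)) - 1 = (\<Prod>c\<in>UNIV. chart_eqn i c (a, b) powi ord_q1 c)"
      unfolding prod_bcurve by (cases i) (simp_all add: chart_eqn_def ord_q1_def aff_inv_def power_int_minus field_simps)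
  qed
qed

lemma monomial_const: "k \<noteq> 0 \<Longrightarrow> monomial (\<lambda>y. k) (\<lambda>c. 0)"
  unfolding monomial_def by (intro exI[of _ k]) simp

lemma monomial_mult:
  assumes "monomial f n" "monomial g m"
  shows "monomial (\<lambda>y. f y * g y) (\<lambda>c. n c + m c)"
proof -
  obtain k where k: "k \<noteq> 0" "\<And>i y. y \<in> chart_img i \<inter> Mopen \<Longrightarrow> f y = k * (\<Prod>c\<in>UNIV. point_eqn i c y powi n c)"
    using assms(1) unfolding monomial_def by blast
  obtain l where l: "l \<noteq> 0" "\<And>i y. y \<in> chart_img i \<inter> Mopen \<Longrightarrow> g y = l * (\<Prod>c\<in>UNIV. point_eqn i c y powi m c)"
    using assms(2) unfolding monomial_def by blast
  show ?thesis
    unfolding monomial_def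
  proof (intro exI[of _ "k * l"] conjI allI ballI)
    fix i y assume y: "y \<in> chart_img i \<inter> Mopen"
    have "point_eqn i c y \<noteq> 0" for c using point_eqn_nonzero y bdry_Mopen by blast
    then have "(\<Prod>c\<in>UNIV. point_eqn i c y powi (n c + m c)) = (\<Prod>c\<in>UNIV. point_eqn i c y powi n c) * (\<Prod>c\<in>UNIV. point_eqn i c y powi m c)"
      by (simp add: power_int_add prod.distrib)
    then show "f y * g y = k * l * (\<Prod>c\<in>UNIV. point_eqn i c y powi (n c + m c))"
      using k(2)[OF y] l(2)[OF y] by (simp add: mult_ac)
  qed (use k l in simp)
qed

lemma monomial_inverse:
  assumes "monomial f n"
  shows "monomial (\<lambda>y. inverse (f y)) (\<lambda>c. - n c)"
proof -
  obtain k where k: "k \<noteq> 0" "\<And>i y. y \<in> chart_img i \<inter> Mopen \<Longrightarrow> f y = k * (\<Prod>c\<in>UNIV. point_eqn i c y powi n c)"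
    using assms(1) unfolding monomial_def by blast
  show ?thesis
    unfolding monomial_def
  proof (intro exI[of _ "inverse k"] conjI allI ballI)
    fix i y assume y: "y \<in> chart_img i \<inter> Mopen"
    have "(\<Prod>c\<in>UNIV. point_eqn i c y powi (- n c)) = inverse (\<Prod>c\<in>UNIV. point_eqn i c y powi n c)"
      by (simp add: power_int_minus prod_inversef[symmetric] comp_def)
    then show "inverse (f y) = inverse k * (\<Prod>c\<in>UNIV. point_eqn i c y powi (- n c))" using k(2)[OF y] by simp
  qed (use k in simp)
qed

definition frame_fun :: "frame \<Rightarrow> point \<Rightarrow> complex" where
  "frame_fun k y = vert_factor k (tco y) (qco y)"

definition frame_ord :: "frame \<Rightarrow> bcurve \<Rightarrow> int" where
  "frame_ord k c = (case k of F1 \<Rightarrow> 0 | F2 \<Rightarrow> - 2 * ord_q1 c | F3 \<Rightarrow> - ord_q c - ord_t c | F4 \<Rightarrow> - ord_q1 c)"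

lemma monomial_frame: "monomial (frame_fun k) (frame_ord k)"
proof (cases k)
  case F1
  show ?thesis using monomial_const[of 1] by (simp add: F1 frame_fun_def[abs_def] frame_ord_def[abs_def])
next
  case F2
  show ?thesis
    using monomial_mult[OF monomial_const[of "- 1"] monomial_inverse[OF monomial_mult[OF monomial_q1 monomial_q1]]]
    by (simp add: F2 frame_fun_def[abs_def] frame_ord_def[abs_def] divide_inverse power2_eq_square)
next
  case F3
  show ?thesis
    using monomial_mult[OF monomial_const[of "- 1"] monomial_inverse[OF monomial_mult[OF monomial_q monomial_t]]]
    by (simp add: F3 frame_fun_def[abs_def] frame_ord_def[abs_def] divide_inverse)
next
  case F4
  show ?thesis
    using monomial_mult[OF monomial_const[of "- 1"] monomial_inverse[OF monomial_q1]]
    by (simp add: F4 frame_fun_def[abs_def] frame_ord_def[abs_def] divide_inverse)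
qed

text \<open>The order of the section \<open>1\<close> along each curve is that of its vertical coordinate.\<close>

definition ord_D :: "bcurve \<Rightarrow> int" where
  "ord_D c = frame_ord (frame_of c) c"

abbreviation divD :: "point set \<Rightarrow>\<^sub>0 int" where
  "divD \<equiv> bdry_div ord_D"

text \<open>
  On this set the monomial has the divisor \<open>D\<close>.
\<close>

definition frame_dom :: "frame \<Rightarrow> point set" where
  "frame_dom k = topspace (ctop Mtilde) - \<Union> (bdry ` {c. frame_ord k c \<noteq> ord_D c})"

lemma frame_dom_open: "openin (ctop Mtilde) (frame_dom k)"
  unfolding frame_dom_def by (rule openin_off_curves) simp

lemma Mopen_frame_dom: "Mopen \<subseteq> frame_dom k"
  using Mopen_topspace bdry_Mopen unfolding frame_dom_def by blast

lemmas frame_ord_simps = frame_ord_def frame_of_def ord_D_def ord_q1_def ord_q_def ord_t_def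

lemma bad_curves:
  "{c. frame_ord F1 c \<noteq> ord_D c} = {AI, QI, BI, B1}"
  "{c. frame_ord F2 c \<noteq> ord_D c} = {AI, Q1, B1}"
  "{c. frame_ord F3 c \<noteq> ord_D c} = {Q0, QI, A0}"
  "{c. frame_ord F4 c \<noteq> ord_D c} = {QI, BI, AI, Q1}"
proof -
  have eq: "{c. P c} = S" if "\<And>c. P c \<longleftrightarrow> c \<in> S" for P and S :: "bcurve set" using that by blast
  show "{c. frame_ord F1 c \<noteq> ord_D c} = {AI, QI, BI, B1}"
    by (rule eq, rename_tac c, case_tac c) (simp_all add: frame_ord_simps)
  show "{c. frame_ord F2 c \<noteq> ord_D c} = {AI, Q1, B1}"
    by (rule eq, rename_tac c, case_tac c) (simp_all add: frame_ord_simps)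
  show "{c. frame_ord F3 c \<noteq> ord_D c} = {Q0, QI, A0}"
    by (rule eq, rename_tac c, case_tac c) (simp_all add: frame_ord_simps)
  show "{c. frame_ord F4 c \<noteq> ord_D c} = {QI, BI, AI, Q1}"
    by (rule eq, rename_tac c, case_tac c) (simp_all add: frame_ord_simps)
qed

text \<open>
  Among these pairs, \<open>Q\<^sup>0\<close> and \<open>Q\<^sup>\<infinity>\<close> with \<open>A\<^sub>\<infinity>\<close> and \<open>Q\<^sup>1\<close> with \<open>A\<^sub>0\<close> met before blowing up.
\<close>

lemma disjoint_curves:
  "bdry Q0 \<inter> bdry AI = {}" "bdry Q0 \<inter> bdry QI = {}" "bdry Q0 \<inter> bdry BI = {}" "bdry Q0 \<inter> bdry B1 = {}" "bdry Q0 \<inter> bdry Q1 = {}"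
  "bdry QI \<inter> bdry AI = {}" "bdry QI \<inter> bdry Q1 = {}" "bdry QI \<inter> bdry B1 = {}"
  "bdry A0 \<inter> bdry AI = {}" "bdry A0 \<inter> bdry BI = {}" "bdry A0 \<inter> bdry Q1 = {}"
  by auto

text \<open>
  A point outside the domain of the third monomial lies on \<open>Q\<^sup>0\<close>, \<open>Q\<^sup>\<infinity>\<close> or \<open>A\<^sub>0\<close>; in these three cases it
  lies in the domain of the first, second, or (off \<open>Q\<^sup>\<infinity>\<close>) fourth one.
\<close>

lemma frame_dom_cover:
  assumes "x \<in> topspace (ctop Mtilde)"
  shows "\<exists>k. x \<in> frame_dom k"
proof (rule ccontr)
  assume "\<nexists>k. x \<in> frame_dom k"
  then have n: "x \<in> \<Union> (bdry ` {c. frame_ord k c \<noteq> ord_D c})" for k using assms unfolding frame_dom_def by blast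
  note n = n[of F1, unfolded bad_curves] n[of F2, unfolded bad_curves] n[of F3, unfolded bad_curves] n[of F4, unfolded bad_curves]
  consider "x \<in> bdry Q0" | "x \<in> bdry QI" | "x \<in> bdry A0" "x \<notin> bdry QI" using n(3) by blast
  then show False
  proof cases
    case 1
    then have "x \<notin> bdry AI" "x \<notin> bdry QI" "x \<notin> bdry BI" "x \<notin> bdry B1" using disjoint_curves(1-4) by blast+
    then show ?thesis using n(1) by blast
  next
    case 2
    then have "x \<notin> bdry AI" "x \<notin> bdry Q1" "x \<notin> bdry B1" using disjoint_curves(6-8) by blast+
    then show ?thesis using n(2) by blast
  next
    case 3
    then have "x \<notin> bdry AI" "x \<notin> bdry BI" "x \<notin> bdry Q1" using disjoint_curves(9-11) by blast+
    then show ?thesis using n(4) 3 by blast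
  qed
qed

lemma bdry_sub_frame_dom:
  "bdry Q0 \<subseteq> frame_dom F1" "bdry QI \<subseteq> frame_dom F2" "bdry Q1 \<subseteq> frame_dom F3" "bdry AI \<subseteq> frame_dom F3"
proof -
  note sub = bdry_topspace[of Q0] bdry_topspace[of QI] bdry_topspace[of Q1] bdry_topspace[of AI]
  show "bdry Q0 \<subseteq> frame_dom F1" unfolding frame_dom_def bad_curves using sub(1) disjoint_curves(1-4) by blast
  show "bdry QI \<subseteq> frame_dom F2" unfolding frame_dom_def bad_curves using sub(2) disjoint_curves(6-8) by blast
  show "bdry Q1 \<subseteq> frame_dom F3" unfolding frame_dom_def bad_curves using sub(3) disjoint_curves(5,7,11) by blast
  show "bdry AI \<subseteq> frame_dom F3" unfolding frame_dom_def bad_curves using sub(4) disjoint_curves(1,6,9) by blast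
qed

lemma frame_divisor: "fun_has_divisor_on Mtilde (frame_dom k) (frame_dom k \<inter> Mopen) (frame_fun k) divD"
  by (rule monomial_divisor[OF monomial_frame frame_dom_open]) (auto simp: frame_dom_def)

text \<open>
  The extension of the monomial to a local equation of \<open>D\<close>.
\<close>

definition frame_ext :: "frame \<Rightarrow> point \<Rightarrow> complex" where
  "frame_ext k = (SOME f. (\<forall>y\<in>frame_dom k \<inter> Mopen. f y = frame_fun k y) \<and> (frame_dom k, f) \<in> local_equations Mtilde divD)"

lemma frame_ext: "y \<in> Mopen \<Longrightarrow> frame_ext k y = frame_fun k y" "(frame_dom k, frame_ext k) \<in> local_equations Mtilde divD"
  using someI_ex[OF M.fun_has_divisor_on_extend[OF frame_divisor[of k] supp_bdry_div_Mopen]] Mopen_frame_dom[of k]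
  unfolding frame_ext_def[symmetric] by blast+

abbreviation frame_pair :: "frame \<Rightarrow> point set \<times> (point \<Rightarrow> complex)" where
  "frame_pair k \<equiv> (frame_dom k, frame_ext k)"

lemma finite_frame: "finite (UNIV :: frame set)"
proof -
  have U: "(UNIV :: frame set) = {F1, F2, F3, F4}" by (auto intro: frame.exhaust)
  show ?thesis unfolding U by simp
qed

interpretation M: covered_divisor Matlas Mopen divD "range frame_pair"
  rewrites "surface_of_atlas Matlas = Mtilde"
proof (unfold_locales, unfold Mtilde_def[symmetric])
  show "divD \<in> divisors Mtilde" by (rule bdry_div_divisor)
  show "supp divD \<inter> Mopen = {}" by (rule supp_bdry_div_Mopen)
  show "finite (range frame_pair)" using finite_frame by simp
  show "range frame_pair \<subseteq> local_equations Mtilde divD" using frame_ext by blast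
  show "\<exists>(W, f)\<in>range frame_pair. x \<in> W" if "x \<in> topspace (ctop Mtilde)" for x
    using frame_dom_cover[OF that] by auto
qed simp

section \<open>The extension of the trivial bundle\<close>

lemma frame_fun_Pt: "Pt (Aff t, Aff q) \<in> Mopen \<Longrightarrow> frame_fun k (Pt (Aff t, Aff q)) = vert_factor k t q"
  by (simp add: frame_fun_def)

lemma Mopen_PtE:
  assumes "y \<in> Mopen"
  obtains t q where "y = Pt (Aff t, Aff q)"
  using assms by (auto simp: Mopen_def)

lemma generic_in_frame_dom:
  "\<exists>F. finite F \<and> bdry c - F \<subseteq> frame_dom (frame_of c)"
proof -
  obtain F where F: "finite F" "\<forall>x\<in>bdry c - F. x \<in> chart_img (gen_chart c) \<and> (\<forall>d. d \<noteq> c \<longrightarrow> x \<notin> bdry d)"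
    using bdry_generic[of c] by blast
  have "x \<in> frame_dom (frame_of c)" if x: "x \<in> bdry c - F" for x
    unfolding frame_dom_def
  proof
    show "x \<in> topspace (ctop Mtilde)" using x bdry_topspace by blast
    have "frame_ord (frame_of c) d = ord_D d" if "x \<in> bdry d" for d
      using F(2) x that by (cases "d = c") (auto simp: ord_D_def)
    then show "x \<notin> \<Union> (bdry ` {d. frame_ord (frame_of c) d \<noteq> ord_D d})" by blast
  qed
  then show ?thesis using F(1) by blast
qed

lemma trivialU_iff:
  "bundle_iso (crestrict Mtilde Mopen) L trivialU \<iota> \<longleftrightarrow>
   bundle_iso (crestrict Mtilde Mopen) L (trivial_bundle (crestrict Mtilde Mopen)) \<iota>"
  by (simp add: trivialU_def)

text \<open>
  Fibre coordinates on the four domains that are related like the vertical coordinates make \<open>L\<close> an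
  extension: each curve lies, up to finitely many points, in the domain of its vertical coordinate.
\<close>

lemma extension_of_frames:
  assumes L: "is_line_bundle Mtilde L" and \<phi>: "\<And>k. fibre_coord Mtilde L (frame_dom k) (\<phi> k)"
    and rel: "\<And>k e t q. e \<in> total_space L \<Longrightarrow> proj L e = Pt (Aff t, Aff q) \<Longrightarrow> proj L e \<in> Mopen \<Longrightarrow>
      \<phi> k e = vert_factor k t q * \<phi> F1 e"
  shows "is_extension L (\<lambda>e. (proj L e, \<phi> F1 e))"
  unfolding is_extension_def trivialU_iff
proof (intro conjI ballI)
  show "is_line_bundle Mtilde L" by (rule L)
  show "bundle_iso (crestrict Mtilde Mopen) (bundle_restrict L Mopen) (trivial_bundle (crestrict Mtilde Mopen))
      (\<lambda>e. (proj L e, \<phi> F1 e))"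
    by (rule M.bundle_iso_restrict[OF L \<phi> Mopen_frame_dom])
  fix p assume "p \<in> vertical_factors"
  then obtain c where p: "p = (bdry c, vert_factor (frame_of c))" unfolding vertical_factors_eq by blast
  let ?k = "frame_of c"
  obtain F where F: "finite F" "bdry c - F \<subseteq> frame_dom ?k" using generic_in_frame_dom by blast
  let ?good = "\<lambda>x. \<exists>W \<psi>. x \<in> W \<and> fibre_coord Mtilde L W \<psi> \<and>
      (\<forall>e\<in>total_space L. \<forall>t q. proj L e = Pt (Aff t, Aff q) \<longrightarrow> proj L e \<in> W \<inter> Mopen \<longrightarrow>
         \<psi> e = vert_factor ?k t q * snd (proj L e, \<phi> F1 e))"
  have good: "?good x" if "x \<in> bdry c - F" for x
    by (rule exI[of _ "frame_dom ?k"], rule exI[of _ "\<phi> ?k"])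
      (use that F(2) \<phi>[of ?k] rel[where k = ?k] in auto)
  have "{x \<in> bdry c. \<not> ?good x} \<subseteq> F" using good by blast
  then have "finite {x \<in> bdry c. \<not> ?good x}" using F(1) by (rule finite_subset)
  then show "case p of (C, c) \<Rightarrow> finite {x \<in> C. \<not> (\<exists>W \<phi>'. x \<in> W \<and> fibre_coord Mtilde L W \<phi>' \<and>
          (\<forall>e\<in>total_space L. \<forall>t q. proj L e = Pt (Aff t, Aff q) \<longrightarrow> proj L e \<in> W \<inter> Mopen \<longrightarrow>
             \<phi>' e = c t q * snd (proj L e, \<phi> F1 e)))}"
    unfolding p prod.case .
qed

lemma extension_exists: "is_extension M.flat_bundle (\<lambda>(x, c). (x, M.tr (M.sel x) (frame_pair F1) x * c))"
proof -
  let ?\<phi> = "\<lambda>k (x, c). M.tr (M.sel x) (frame_pair k) x * c"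
  have "is_extension M.flat_bundle (\<lambda>e. (proj M.flat_bundle e, ?\<phi> F1 e))"
  proof (rule extension_of_frames[where \<phi> = ?\<phi>])
    show "is_line_bundle Mtilde M.flat_bundle" by (rule M.flat_bundle_is_line_bundle)
    show "fibre_coord Mtilde M.flat_bundle (frame_dom k) (?\<phi> k)" for k
      using M.flat_bundle_coord[of "frame_pair k"] by simp
    fix k t q and e :: "point \<times> complex"
    assume e: "e \<in> total_space M.flat_bundle" "proj M.flat_bundle e = Pt (Aff t, Aff q)" "proj M.flat_bundle e \<in> Mopen"
    obtain x c where x: "e = (x, c)" by (cases e)
    have x': "x = Pt (Aff t, Aff q)" "x \<in> Mopen" using e x by (simp_all add: M.flat_bundle_simps)
    have dom: "x \<in> frame_dom F1 \<inter> frame_dom k" using x'(2) Mopen_frame_dom by blast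
    have "frame_ext k x = M.tr (frame_pair F1) (frame_pair k) x * frame_ext F1 x"
      by (rule M.tr(2)[OF frame_ext(2) frame_ext(2)]) (use dom x'(2) supp_bdry_div_Mopen in blast)
    then have "M.tr (frame_pair F1) (frame_pair k) x = vert_factor k t q"
      using frame_ext(1)[OF x'(2)] x' by (simp add: frame_fun_Pt)
    moreover have "M.tr (M.sel x) (frame_pair k) x * c =
       M.tr (frame_pair F1) (frame_pair k) x * (M.tr (M.sel x) (frame_pair F1) x * c)"
      by (rule M.flat_bundle_ratio) (use dom in auto)
    ultimately show "?\<phi> k e = vert_factor k t q * ?\<phi> F1 e" by (simp add: x)
  qed
  moreover have "(\<lambda>e. (proj M.flat_bundle e, ?\<phi> F1 e)) = (\<lambda>(x, c). (x, M.tr (M.sel x) (frame_pair F1) x * c))"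
    by (auto simp: M.flat_bundle_simps)
  ultimately show ?thesis by simp
qed

text \<open>
  At a generic boundary point the vertical coordinate of the section is one of the four local
  equations of \<open>D\<close>; the finitely many other points are removable.
\<close>

lemma adapted_unit_section:
  assumes ext: "is_extension L \<iota>"
  shows "M.adapted L (unit_section L \<iota>)"
proof -
  let ?s = "unit_section L \<iota>"
  have L: "is_line_bundle Mtilde L" using ext by (simp add: is_extension_def)
  have iso: "bundle_iso (crestrict Mtilde Mopen) (bundle_restrict L Mopen) (trivial_bundle (crestrict Mtilde Mopen)) \<iota>"
    using ext by (simp add: is_extension_def trivialU_iff)
  have top: "topspace (ctop (crestrict Mtilde Mopen)) = Mopen"
    using Mopen_topspace by (auto simp: M.topspace_crestrict)
  have bij: "bij_betw \<iota> (total_space (bundle_restrict L Mopen)) (Mopen \<times> UNIV)"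
    using iso by (simp add: bundle_iso_def M.trivial_bundle_simps top)
  have pr: "\<forall>e\<in>total_space (bundle_restrict L Mopen). fst (\<iota> e) = proj L e"
    using iso by (simp add: bundle_iso_def M.trivial_bundle_simps M.bundle_restrict_simps)
  have s: "?s y \<in> total_space L \<and> proj L (?s y) = y \<and> \<iota> (?s y) = (y, 1)" if y: "y \<in> Mopen" for y
  proof -
    have im: "(y, 1) \<in> \<iota> ` total_space (bundle_restrict L Mopen)" using bij y by (simp add: bij_betw_def)
    have \<iota>s: "\<iota> (?s y) = (y, 1)" unfolding unit_section_def by (rule f_inv_into_f[OF im])
    have m: "?s y \<in> total_space (bundle_restrict L Mopen)" unfolding unit_section_def by (rule inv_into_into[OF im])
    then have "proj L (?s y) = y" using pr \<iota>s by force
    then show ?thesis using \<iota>s m by (simp add: M.bundle_restrict_simps)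
  qed
  \<comment> \<open>All points of the open part are good, and by the vertical coordinates all but finitely many boundary points.\<close>
  define good where "good x \<longleftrightarrow> (\<exists>k V \<phi>. x \<in> V \<and> V \<subseteq> frame_dom k \<and> fibre_coord Mtilde L V \<phi> \<and>
     (\<forall>y\<in>V \<inter> Mopen. \<phi> (?s y) = frame_ext k y))" for x
  have goodM: "good x" if x: "x \<in> Mopen" for x
  proof -
    have "fibre_coord Mtilde L Mopen (snd \<circ> \<iota>)" by (rule M.fibre_coord_of_restricted_iso[OF L Mopen_open iso])
    moreover have "(snd \<circ> \<iota>) (?s y) = frame_ext F1 y" if "y \<in> Mopen" for y
      using s[OF that] frame_ext(1)[OF that, of F1] by (simp add: frame_fun_def)
    ultimately show ?thesis unfolding good_def using x Mopen_frame_dom[of F1] by blast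
  qed
  have "finite {x \<in> bdry c. \<not> good x}" for c
  proof -
    let ?k = "frame_of c"
    let ?P = "\<lambda>x. \<exists>W \<phi>. x \<in> W \<and> fibre_coord Mtilde L W \<phi> \<and>
          (\<forall>e\<in>total_space L. \<forall>t q. proj L e = Pt (Aff t, Aff q) \<longrightarrow> proj L e \<in> W \<inter> Mopen \<longrightarrow>
             \<phi> e = vert_factor ?k t q * snd (\<iota> e))"
    have "(bdry c, vert_factor ?k) \<in> vertical_factors" unfolding vertical_factors_eq by blast
    from bspec[OF ext[unfolded is_extension_def, THEN conjunct2, THEN conjunct2] this]
    have fin: "finite {x \<in> bdry c. \<not> ?P x}" unfolding prod.case .
    obtain F where F: "finite F" "bdry c - F \<subseteq> frame_dom ?k" using generic_in_frame_dom by blast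
    have "good x" if x: "x \<in> bdry c - F" "?P x" for x
    proof -
      obtain W \<phi> where W: "x \<in> W" "fibre_coord Mtilde L W \<phi>" "\<forall>e\<in>total_space L. \<forall>t q. proj L e = Pt (Aff t, Aff q) \<longrightarrow>
         proj L e \<in> W \<inter> Mopen \<longrightarrow> \<phi> e = vert_factor ?k t q * snd (\<iota> e)" using x(2) by blast
      let ?V = "W \<inter> frame_dom ?k"
      have "openin (ctop Mtilde) ?V" using fibre_coordD(1)[OF W(2)] frame_dom_open by (rule openin_Int)
      then have fV: "fibre_coord Mtilde L ?V \<phi>" by (rule M.fibre_coord_subset[OF W(2)]) simp
      have eq: "\<phi> (?s y) = frame_ext ?k y" if y: "y \<in> ?V \<inter> Mopen" for y
      proof -
        have yM: "y \<in> Mopen" using y by blast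
        then obtain t q where tq: "y = Pt (Aff t, Aff q)" by (rule Mopen_PtE)
        note sy = s[OF yM]
        have "\<phi> (?s y) = vert_factor ?k t q * snd (\<iota> (?s y))"
          by (rule W(3)[rule_format]) (use sy y tq in auto)
        then show ?thesis using sy frame_ext(1)[OF yM, of ?k] frame_fun_Pt[of t q ?k] yM tq by simp
      qed
      have "x \<in> ?V" using x(1) F(2) W(1) by blast
      then show ?thesis unfolding good_def
        by (intro exI[of _ ?k] exI[of _ ?V] exI[of _ \<phi>] conjI ballI fV eq) blast+
    qed
    then have "{x \<in> bdry c. \<not> good x} \<subseteq> F \<union> {x \<in> bdry c. \<not> ?P x}" by blast
    then show ?thesis by (rule finite_subset) (use F(1) fin in simp)
  qed
  then have fin: "finite (\<Union>c. {x \<in> bdry c. \<not> good x})" by (intro finite_UN_I finite_bcurve)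
  define bad where "bad = (\<Union>c. {x \<in> bdry c. \<not> good x})"
  have bad: "finite bad" "bad \<inter> Mopen = {}" using fin bdry_Mopen unfolding bad_def by blast+
  have off_bad: "good x" if x: "x \<in> topspace (ctop Mtilde)" "x \<notin> bad" for x
  proof (cases "x \<in> Mopen")
    case True
    then show ?thesis by (rule goodM)
  next
    case False
    obtain i z where z: "z \<in> chart_dom i" "chart_map i z = x" using topspace_chart[OF x(1)] .
    then obtain c where "chart_eqn i c z = 0" using False Mopen_chart by blast
    then have "x \<in> bdry c" using mem_bdry z by blast
    then show ?thesis using x(2) unfolding bad_def by blast
  qed
  have "\<exists>W f V \<phi> u. (W, f) \<in> range frame_pair \<and> x \<in> V \<and> V \<subseteq> W \<and> fibre_coord Mtilde L V \<phi> \<and> hol_unit Mtilde V u \<and>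
        (\<forall>y\<in>V \<inter> Mopen. \<phi> (?s y) = u y * f y)" if x: "x \<in> topspace (ctop Mtilde)" for x
  proof -
    obtain k where k: "x \<in> frame_dom k" using frame_dom_cover[OF x] by blast
    obtain U \<eta> where U: "(U, \<eta>) \<in> coords L" "x \<in> U" using is_line_bundleD(2)[OF L x] by blast
    note fU = M.fibre_coord_of_coords[OF L U(1)]
    let ?V = "U \<inter> frame_dom k"
    have op: "openin (ctop Mtilde) ?V" using fibre_coordD(1)[OF fU] frame_dom_open by (rule openin_Int)
    have fV: "fibre_coord Mtilde L ?V \<eta>" by (rule M.fibre_coord_subset[OF fU op]) simp
    have nz: "frame_ext l y \<noteq> 0" if "y \<in> Mopen" for l y
      by (rule M.LE_nonzero[OF frame_ext(2)]) (use that Mopen_frame_dom in blast)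
    have loc: "M.unit_ext (\<lambda>y. \<eta> (?s y) / frame_ext k y) w" if w: "w \<in> ?V - bad" for w
    proof -
      have "w \<in> topspace (ctop Mtilde)" using w openin_subset[OF op] by blast
      then have "good w" using off_bad w by blast
      then obtain l V \<phi> where V: "w \<in> V" "V \<subseteq> frame_dom l" "fibre_coord Mtilde L V \<phi>"
        "\<forall>y\<in>V \<inter> Mopen. \<phi> (?s y) = frame_ext l y" unfolding good_def by blast
      obtain g where g: "hol_unit Mtilde (V \<inter> ?V) g"
        "\<forall>e\<in>total_space L. proj L e \<in> V \<inter> ?V \<longrightarrow> \<eta> e = g (proj L e) * \<phi> e"
        using M.fibre_coord_ratio[OF L V(3) fV] by blast
      let ?t = "M.tr (frame_pair k) (frame_pair l)"
      have t: "hol_unit Mtilde (V \<inter> ?V) ?t"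
        by (rule M.hol_unit_subset[OF M.tr(1)[OF frame_ext(2) frame_ext(2)] M.hol_unit_openin[OF g(1)]]) (use V(2) in blast)
      show ?thesis
      proof (rule M.unit_extI[OF M.hol_unit_mult[OF g(1) t]])
        show "w \<in> V \<inter> ?V" using V(1) w by blast
        fix y assume y: "y \<in> V \<inter> ?V \<inter> Mopen"
        have "frame_ext l y = ?t y * frame_ext k y"
          by (rule M.tr(2)[OF frame_ext(2) frame_ext(2)]) (use y V(2) supp_bdry_div_Mopen in blast)
        moreover have "\<eta> (?s y) = g y * frame_ext l y" using g(2) V(4) s[of y] y by auto
        ultimately show "g y * ?t y = \<eta> (?s y) / frame_ext k y" using nz[of y k] y by simp
      qed
    qed
    have "M.unit_ext (\<lambda>y. \<eta> (?s y) / frame_ext k y) w" if "w \<in> ?V" for w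
      by (rule M.unit_ext_off_finite[OF op bad loc that])
    from M.unit_glue[OF op this] obtain u where u: "hol_unit Mtilde ?V u"
      "\<forall>y\<in>?V \<inter> Mopen. u y = \<eta> (?s y) / frame_ext k y" by blast
    have eq: "\<forall>y\<in>?V \<inter> Mopen. \<eta> (?s y) = u y * frame_ext k y" using u(2) nz[of _ k] by simp
    have "frame_pair k \<in> range frame_pair" "x \<in> ?V" using k U(2) by blast+
    then have all: "frame_pair k \<in> range frame_pair \<and> x \<in> ?V \<and> ?V \<subseteq> frame_dom k \<and> fibre_coord Mtilde L ?V \<eta> \<and>
        hol_unit Mtilde ?V u \<and> (\<forall>y\<in>?V \<inter> Mopen. \<eta> (?s y) = u y * frame_ext k y)"
      using u(1) fV eq by (intro conjI Int_lower2)
    show ?thesis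
      by (rule exI[of _ "frame_dom k"], rule exI[of _ "frame_ext k"], rule exI[of _ ?V],
        rule exI[of _ \<eta>], rule exI[of _ u]) (rule all)
  qed
  note loc = this
  show ?thesis
    unfolding M.adapted_def
  proof (intro conjI ballI L)
    show "?s y \<in> total_space L" "proj L (?s y) = y" if "y \<in> Mopen" for y using s[OF that] by blast+
  qed (rule loc)
qed

definition ord_E :: "bcurve \<Rightarrow> int" where
  "ord_E c = (case c of A0 \<Rightarrow> 1 | Q1 \<Rightarrow> 2 | B1 \<Rightarrow> 2 | B0 \<Rightarrow> - 1 | BI \<Rightarrow> - 1 | _ \<Rightarrow> 0)"

lemma bdry_div_ord_E:
  "frag_of (curveA (Aff 0)) + frag_cmul 2 (frag_of (curveQ (Aff 1))) + frag_cmul 2 (frag_of (curveB (Aff 1) (Aff 0)))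
     - frag_of (curveB (Aff 0) Infty) - frag_of (curveB Infty Infty) = bdry_div ord_E"
  unfolding bdry_div_def curve_eq UNIV_bcurve by (simp add: ord_E_def del: bdry.simps)

text \<open>The difference of the two divisors is the divisor of \<open>1 / ((q - 1)\<^sup>2 t)\<close>.\<close>

lemma divD_equivalent: "linearly_equivalent Mtilde divD (bdry_div ord_E)"
proof -
  let ?h = "\<lambda>y. inverse ((qco y - 1) * (qco y - 1) * tco y)"
  have m: "monomial ?h (\<lambda>c. - (ord_q1 c + ord_q1 c + ord_t c))"
    by (intro monomial_inverse monomial_mult monomial_q1 monomial_t)
  have "- (ord_q1 c + ord_q1 c + ord_t c) = ord_D c - ord_E c" for c
    by (cases c) (simp_all add: frame_ord_simps ord_E_def)
  then have "fun_has_divisor_on Mtilde (topspace (ctop Mtilde)) (topspace (ctop Mtilde) \<inter> Mopen) ?h (bdry_div (\<lambda>c. ord_D c - ord_E c))"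
    by (intro monomial_divisor[OF m]) auto
  then show ?thesis unfolding linearly_equivalent_def bdry_div_diff by blast
qed

theorem theorem2:
  shows "(\<exists>(L :: (point, point \<times> complex) line_bundle) \<iota>. is_extension L \<iota>) \<and>
    (\<forall>(L :: (point, 'e) line_bundle) \<iota>. is_extension L \<iota> \<longrightarrow>
      (\<exists>D. has_divisor Mtilde L Mopen (unit_section L \<iota>) D \<and>
        isomorphic_bundles Mtilde L (divisor_bundle Mtilde D) \<and>
        linearly_equivalent Mtilde D
          (frag_of (curveA (Aff 0)) + frag_cmul 2 (frag_of (curveQ (Aff 1)))
            + frag_cmul 2 (frag_of (curveB (Aff 1) (Aff 0)))
            - frag_of (curveB (Aff 0) Infty) - frag_of (curveB Infty Infty)) \<and>
        (\<forall>C\<in>{curveQ (Aff 0), curveQ (Aff 1), curveQ Infty, curveA Infty}.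
          trivial_on Mtilde (divisor_bundle Mtilde D) C)))"
proof (intro conjI allI impI)
  show "\<exists>(L :: (point, point \<times> complex) line_bundle) \<iota>. is_extension L \<iota>"
    using extension_exists by blast
  fix L :: "(point, 'e) line_bundle" and \<iota>
  assume "is_extension L \<iota>"
  note a = adapted_unit_section[OF this]
  have "trivial_on Mtilde (divisor_bundle Mtilde divD) C"
    if "C \<in> {curveQ (Aff 0), curveQ (Aff 1), curveQ Infty, curveA Infty}" for C
    using that M.OD_trivial_on[OF frame_ext(2)] bdry_sub_frame_dom unfolding curve_eq by blast
  then show "\<exists>D. has_divisor Mtilde L Mopen (unit_section L \<iota>) D \<and>
        isomorphic_bundles Mtilde L (divisor_bundle Mtilde D) \<and>
        linearly_equivalent Mtilde D
          (frag_of (curveA (Aff 0)) + frag_cmul 2 (frag_of (curveQ (Aff 1)))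
            + frag_cmul 2 (frag_of (curveB (Aff 1) (Aff 0)))
            - frag_of (curveB (Aff 0) Infty) - frag_of (curveB Infty Infty)) \<and>
        (\<forall>C\<in>{curveQ (Aff 0), curveQ (Aff 1), curveQ Infty, curveA Infty}.
          trivial_on Mtilde (divisor_bundle Mtilde D) C)"
    unfolding bdry_div_ord_E
    using M.adapted_has_divisor[OF a] M.adapted_iso[OF a] divD_equivalent by (intro exI[of _ divD] conjI ballI) 
qed

end
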